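(* Let $(M,g)$ be a $1$-dimensional compact connected Riemannian manifold without boundary. Then $(M,g)$ is isometric, after arc-length reparameterization, to a circle of length $\ell$ for some $\ell>0$. Consequently, for every eigenvalue $\lambda$ of $\sqrt{-\Delta_g}$ and every $x\in M$, $$\sum_{j:\lambda_j=\lambda}|e_j(x)|^2=\frac{\#\{j:\lambda_j=\lambda\}}{|M|},$$ and therefore the following holds. Let $E\subset M$ be measurable, let $S$ be a finite subset of the spectrum $\{\lambda_j\}$ of $\sqrt{-\Delta_g}$, let $X_S=\{j:\lambda_j\in S\}$, and let $0\le\epsilon,\epsilon'<1$ satisfy $0<1-\epsilon-\epsilon'\le1$. If $f\in L^2(M)$ is nonzero and $$\int_E|f(x)|^2\,dx\ge(1-\epsilon)\|f\|_{L^2(M)}^2,\qquad \sum_{j\in X_S}|\widehat f(j)|^2\ge(1-\epsilon')\|f\|_{L^2(M)}^2,$$ then $$(1-\epsilon-\epsilon')^2\le\frac{|E|}{|M|}\cdot\#X_S .$$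
   Context: $\Delta_g$ is the Laplace-Beltrami operator of $(M,g)$. $\{e_j\}$ is an $L^2(M)$-orthonormal basis of eigenfunctions, $-\Delta_g e_j=\lambda_j^2e_j$, with $0=\lambda_0\le\lambda_1\le\cdots$ (repeated according to multiplicity). $\widehat f(j)=\langle f,e_j\rangle_{L^2(M)}$. $dx$ is the Riemannian volume (length) measure, and $|E|,|M|$ denote the measures of $E$ and $M$. A circle of length $\ell$ is $\mathbb{R}/\ell\mathbb{Z}$ with the flat metric $ds^2$. *)

theory Defs
  imports "HOL-Analysis.Analysis"
begin

text \<open>\<open>D n\<close> is the \<open>n\<close>-th derivative of \<open>f\<close> on the (open) set \<open>S\<close>.\<close>

definition smooth_on :: "real set \<Rightarrow> (real \<Rightarrow> 'b::real_normed_vector) \<Rightarrow> bool" where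
  "smooth_on S f \<longleftrightarrow>
     (\<exists>D :: nat \<Rightarrow> real \<Rightarrow> 'b.
        (\<forall>t\<in>S. D 0 t = f t) \<and>
        (\<forall>n. \<forall>t\<in>S. (D n has_vector_derivative D (Suc n) t) (at t)))"

section \<open>One-dimensional Riemannian manifolds\<close>

text \<open>A chart is a pair \<open>(U, \<phi>)\<close>; only the values of \<open>\<phi>\<close> on \<open>U\<close> matter.\<close>

type_synonym 'a chart = "'a set \<times> ('a \<Rightarrow> real)"

definition chart_inv :: "'a chart \<Rightarrow> real \<Rightarrow> 'a" where
  "chart_inv c = inv_into (fst c) (snd c)"

text \<open>
  The Riemannian metric is given by its single component in each chart:
  \<open>rm_metric M c p = g\<^sub>p(\<partial>\<^sub>t, \<partial>\<^sub>t)\<close>, where \<open>t\<close> is the coordinate of the chart \<open>c\<close>. In other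
  words \<open>g = rm_metric M c \<cdot> dt\<^sup>2\<close> on the domain of \<open>c\<close>.
\<close>

record 'a riem1 =
  rm_top :: "'a topology"
  rm_atlas :: "'a chart set"
  rm_metric :: "'a chart \<Rightarrow> 'a \<Rightarrow> real"

abbreviation rm_points :: "'a riem1 \<Rightarrow> 'a set" where
  "rm_points M \<equiv> topspace (rm_top M)"

text \<open>
  Charts take values in open subsets of the real line, so the manifold has dimension 1 and no
  boundary. The atlas need not be maximal. The last clause is the transformation law of the
  metric, \<open>g\<^sub>c = g\<^sub>d (d\<phi>\<^sub>d/d\<phi>\<^sub>c)\<^sup>2\<close>.
\<close>

definition riemannian_1_manifold :: "'a riem1 \<Rightarrow> bool" where
  "riemannian_1_manifold M \<longleftrightarrow>
     Hausdorff_space (rm_top M) \<and> second_countable (rm_top M) \<and>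
     (\<Union>c\<in>rm_atlas M. fst c) = rm_points M \<and>
     (\<forall>c\<in>rm_atlas M.
        openin (rm_top M) (fst c) \<and> open (snd c ` fst c) \<and>
        homeomorphic_map (subtopology (rm_top M) (fst c)) (top_of_set (snd c ` fst c)) (snd c)) \<and>
     (\<forall>c\<in>rm_atlas M. \<forall>d\<in>rm_atlas M.
        smooth_on (snd c ` (fst c \<inter> fst d)) (snd d \<circ> chart_inv c)) \<and>
     (\<forall>c\<in>rm_atlas M.
        (\<forall>p\<in>fst c. rm_metric M c p > 0) \<and>
        smooth_on (snd c ` fst c) (rm_metric M c \<circ> chart_inv c)) \<and>
     (\<forall>c\<in>rm_atlas M. \<forall>d\<in>rm_atlas M. \<forall>p\<in>fst c \<inter> fst d.
        rm_metric M c p = rm_metric M d p * (deriv (snd d \<circ> chart_inv c) (snd c p))\<^sup>2)"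

definition smooth_map :: "'a riem1 \<Rightarrow> 'b riem1 \<Rightarrow> ('a \<Rightarrow> 'b) \<Rightarrow> bool" where
  "smooth_map M N F \<longleftrightarrow>
     continuous_map (rm_top M) (rm_top N) F \<and>
     (\<forall>c\<in>rm_atlas M. \<forall>d\<in>rm_atlas N.
        smooth_on (snd c ` {p \<in> fst c. F p \<in> fst d}) (snd d \<circ> F \<circ> chart_inv c))"

text \<open>A diffeomorphism \<open>F\<close> with \<open>F\<^sup>* g\<^sub>N = g\<^sub>M\<close>.\<close>

definition riem_isometry :: "'a riem1 \<Rightarrow> 'b riem1 \<Rightarrow> ('a \<Rightarrow> 'b) \<Rightarrow> bool" where
  "riem_isometry M N F \<longleftrightarrow>
     bij_betw F (rm_points M) (rm_points N) \<and>
     smooth_map M N F \<and> smooth_map N M (inv_into (rm_points M) F) \<and>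
     (\<forall>c\<in>rm_atlas M. \<forall>d\<in>rm_atlas N. \<forall>p\<in>fst c. F p \<in> fst d \<longrightarrow>
        rm_metric M c p = rm_metric N d (F p) * (deriv (snd d \<circ> F \<circ> chart_inv c) (snd c p))\<^sup>2)"

definition isometric :: "'a riem1 \<Rightarrow> 'b riem1 \<Rightarrow> bool" where
  "isometric M N \<longleftrightarrow> (\<exists>F. riem_isometry M N F)"

section \<open>The circle \<open>\<real>/\<ell>\<int>\<close> with its flat metric\<close>

definition circle_proj :: "real \<Rightarrow> real \<Rightarrow> real set" where
  "circle_proj l x = {x + of_int k * l | k :: int. True}"

text \<open>
  Points are the cosets \<open>x + \<ell>\<int>\<close>, the topology is the quotient topology, and the charts are the
  inverses of the projection restricted to the intervals \<open>(a, a + \<ell>)\<close>.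
\<close>

definition circle_chart :: "real \<Rightarrow> real \<Rightarrow> (real set) chart" where
  "circle_chart l a =
     (circle_proj l ` {a<..<a + l}, inv_into {a<..<a + l} (circle_proj l))"

definition circle :: "real \<Rightarrow> (real set) riem1" where
  "circle l =
     \<lparr>rm_top = topology (\<lambda>V. V \<subseteq> range (circle_proj l) \<and> open (circle_proj l -` V)),
      rm_atlas = range (circle_chart l),
      rm_metric = (\<lambda>c p. 1)\<rparr>"

section \<open>Riemannian measure and \<open>L\<^sup>2(M)\<close>\<close>

text \<open>
  The Riemannian volume is the unique Borel measure that equals \<open>\<surd>g dt\<close> in every chart; its
  completion is used, so that the measurable subsets of \<open>M\<close> are the Lebesgue measurable ones.
\<close>

definition riem_borel_volume :: "'a riem1 \<Rightarrow> 'a measure" where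
  "riem_borel_volume M =
     (THE \<mu>. space \<mu> = rm_points M \<and>
        sets \<mu> = sigma_sets (rm_points M) {U. openin (rm_top M) U} \<and>
        (\<forall>c\<in>rm_atlas M. \<forall>B\<in>sets \<mu>. B \<subseteq> fst c \<longrightarrow>
           emeasure \<mu> B =
             (\<integral>\<^sup>+t\<in>snd c ` B. ennreal (sqrt (rm_metric M c (chart_inv c t))) \<partial>lborel)))"

definition riem_volume :: "'a riem1 \<Rightarrow> 'a measure" where
  "riem_volume M = completion (riem_borel_volume M)"

text \<open>
  Elements of \<open>L\<^sup>2(M)\<close> are represented by functions; two of them are equal in \<open>L\<^sup>2(M)\<close> iff they
  agree almost everywhere.
\<close>

definition L2 :: "'a riem1 \<Rightarrow> ('a \<Rightarrow> complex) set" where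
  "L2 M = {f. f \<in> borel_measurable (riem_volume M) \<and>
              integrable (riem_volume M) (\<lambda>x. (cmod (f x))\<^sup>2)}"

definition L2_inner :: "'a riem1 \<Rightarrow> ('a \<Rightarrow> complex) \<Rightarrow> ('a \<Rightarrow> complex) \<Rightarrow> complex" where
  "L2_inner M f h = (LINT x|riem_volume M. f x * cnj (h x))"

definition L2_norm :: "'a riem1 \<Rightarrow> ('a \<Rightarrow> complex) \<Rightarrow> real" where
  "L2_norm M f = sqrt (LINT x|riem_volume M. (cmod (f x))\<^sup>2)"

section \<open>The Laplace-Beltrami operator\<close>

definition smooth_function :: "'a riem1 \<Rightarrow> ('a \<Rightarrow> complex) \<Rightarrow> bool" where
  "smooth_function M u \<longleftrightarrow>
     (\<forall>c\<in>rm_atlas M. smooth_on (snd c ` fst c) (u \<circ> chart_inv c))"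

text \<open>
  The coordinate formula \<open>\<Delta> u = |g|\<^sup>-\<^sup>1\<^sup>/\<^sup>2 \<partial>\<^sub>i (|g|\<^sup>1\<^sup>/\<^sup>2 g\<^sup>i\<^sup>j \<partial>\<^sub>j u)\<close> in dimension 1, where
  \<open>g\<^sup>1\<^sup>1 = 1/g\<close>.
\<close>

definition laplace_in_chart :: "'a riem1 \<Rightarrow> 'a chart \<Rightarrow> ('a \<Rightarrow> complex) \<Rightarrow> 'a \<Rightarrow> complex" where
  "laplace_in_chart M c u p =
     (let G = rm_metric M c \<circ> chart_inv c; t = snd c p in
        (1 / sqrt (G t)) *\<^sub>R
        vector_derivative
          (\<lambda>s. (sqrt (G s) * (1 / G s)) *\<^sub>R vector_derivative (u \<circ> chart_inv c) (at s)) (at t))"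

text \<open>For smooth \<open>u\<close> the value does not depend on the chart chosen around \<open>p\<close>.\<close>

definition laplace_beltrami :: "'a riem1 \<Rightarrow> ('a \<Rightarrow> complex) \<Rightarrow> 'a \<Rightarrow> complex" where
  "laplace_beltrami M u p =
     laplace_in_chart M (SOME c. c \<in> rm_atlas M \<and> p \<in> fst c) u p"

text \<open>\<open>u\<close> is smooth and \<open>-\<Delta> u = \<lambda>\<^sup>2 u\<close>; the case \<open>u = 0\<close> is not excluded here.\<close>

definition laplace_eigenfunction :: "'a riem1 \<Rightarrow> real \<Rightarrow> ('a \<Rightarrow> complex) \<Rightarrow> bool" where
  "laplace_eigenfunction M \<mu> u \<longleftrightarrow>
     smooth_function M u \<and>
     (\<forall>p\<in>rm_points M. - laplace_beltrami M u p = (of_real \<mu>)\<^sup>2 * u p)"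

text \<open>Eigenvalues of \<open>\<surd>(-\<Delta>)\<close>: the nonnegative \<open>\<mu>\<close> such that \<open>\<mu>\<^sup>2\<close> is an eigenvalue of \<open>-\<Delta>\<close>.\<close>

definition sqrt_laplace_eigenvalue :: "'a riem1 \<Rightarrow> real \<Rightarrow> bool" where
  "sqrt_laplace_eigenvalue M \<mu> \<longleftrightarrow>
     0 \<le> \<mu> \<and> (\<exists>u. laplace_eigenfunction M \<mu> u \<and> (\<exists>p\<in>rm_points M. u p \<noteq> 0))"

definition L2_orthonormal_basis :: "'a riem1 \<Rightarrow> (nat \<Rightarrow> 'a \<Rightarrow> complex) \<Rightarrow> bool" where
  "L2_orthonormal_basis M e \<longleftrightarrow>
     (\<forall>j. e j \<in> L2 M) \<and>
     (\<forall>i j. L2_inner M (e i) (e j) = (if i = j then 1 else 0)) \<and>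
     (\<forall>f\<in>L2 M.
        (\<lambda>N. L2_norm M (\<lambda>x. f x - (\<Sum>j<N. L2_inner M f (e j) * e j x))) \<longlonglongrightarrow> 0)"

definition laplace_eigenbasis :: "'a riem1 \<Rightarrow> (nat \<Rightarrow> 'a \<Rightarrow> complex) \<Rightarrow> (nat \<Rightarrow> real) \<Rightarrow> bool" where
  "laplace_eigenbasis M e lam \<longleftrightarrow>
     L2_orthonormal_basis M e \<and>
     (\<forall>j. laplace_eigenfunction M (lam j) (e j)) \<and>
     lam 0 = 0 \<and> incseq lam"

end

theory Submission
  imports Defs
begin

text \<open>
  The circle is produced by travelling along \<open>M\<close> at unit speed. In a chart the arc length is a
  primitive \<open>G\<close> of \<open>\<surd>g\<close>, and a curve has unit speed exactly when \<open>G\<close> grows along it with slope \<open>1\<close> or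
  \<open>-1\<close>. Hence unit-speed curves exist through every point, are locally injective and open, and two of
  them that meet agree up to a time shift and possibly a reversal of time
  (\<open>arc_length_coordinate\<close>, \<open>unit_in_chart_local_uniqueness\<close>, \<open>local_existence\<close>).

  Compactness gives one time \<open>\<epsilon>\<close> for which unit-speed curves exist around every point, so a curve can be
  prolonged forever, to some \<open>\<gamma> : \<real> \<rightarrow> M\<close> (\<open>unit_speed_line\<close>). Its range is open and closed, hence all of
  \<open>M\<close>. It is not injective, since \<open>M\<close> is compact and \<open>\<gamma>\<close> is an open map. If it meets itself, the two branches
  cannot run in opposite directions, because at the midpoint in time \<open>\<gamma>\<close> would fold back on itself; so
  they run in the same direction and \<open>\<gamma>\<close> is periodic. With \<open>l\<close> its least period, \<open>\<gamma> s = \<gamma> t\<close> holds iff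
  \<open>s - t\<close> is a multiple of \<open>l\<close> (\<open>least_period\<close>), and \<open>\<gamma> t \<mapsto> t + l\<int>\<close> is an isometry onto the circle
  (\<open>isometric_circle\<close>).

  The remaining claims are pulled back to the line. The Riemannian volume is the image under \<open>\<gamma>\<close> of
  Lebesgue measure on \<open>[0, l]\<close> (\<open>riem_borel_volume_eq\<close>), by the change of variables formula. Along
  \<open>\<gamma>\<close> the Laplace-Beltrami operator is the second derivative, so a nonzero eigenfunction for \<open>\<mu>\<close> is
  \<open>a e\<^sup>i\<^sup>\<mu>\<^sup>t + b e\<^sup>-\<^sup>i\<^sup>\<mu>\<^sup>t\<close> with \<open>e\<^sup>i\<^sup>\<mu>\<^sup>l = 1\<close> (\<open>eigenfunction_eq_waves\<close>).

  If \<open>e\<^sub>j = a\<^sub>j e\<^sup>i\<^sup>\<mu>\<^sup>t + b\<^sub>j e\<^sup>-\<^sup>i\<^sup>\<mu>\<^sup>t\<close> are the basis functions with eigenvalue \<open>\<mu> > 0\<close>, then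
  \<open>|e\<^sub>j|\<^sup>2 = 1/l + 2 Re (a\<^sub>j cnj b\<^sub>j e\<^sup>2\<^sup>i\<^sup>\<mu>\<^sup>t)\<close>, because \<open>e\<^sub>j\<close> has norm \<open>1\<close>. Completeness of the basis,
  in the form of Parseval's identity for the orthogonal pair \<open>e\<^sup>i\<^sup>\<mu>\<^sup>t\<close> and \<open>e\<^sup>-\<^sup>i\<^sup>\<mu>\<^sup>t\<close>, says that the
  coefficients \<open>a\<^sub>j cnj b\<^sub>j\<close> sum to \<open>0\<close>; so the oscillating parts cancel in the sum over \<open>j\<close>
  (\<open>cross_terms_cancel\<close>, \<open>eigenspace_kernel\<close>).

  For the last claim let \<open>P\<close> be the projection to the span of the \<open>e\<^sub>j\<close> with \<open>j \<in> X\<^sub>S\<close>. By the identity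
  just proved, \<open>|P f|\<^sup>2 \<le> \<parallel>P f\<parallel>\<^sup>2 #X\<^sub>S / |M|\<close> at every point, so \<open>\<integral>\<^sub>E |P f|\<^sup>2 \<le> c\<^sup>2 \<parallel>P f\<parallel>\<^sup>2\<close> with
  \<open>c\<^sup>2 = |E| #X\<^sub>S / |M|\<close>; so \<open>c\<close> bounds the cosine of the angle between the two subspaces. Expanding
  \<open>\<parallel>f - (1\<^sub>E f + P f) / (1 + c)\<parallel>\<^sup>2 \<ge> 0\<close> then yields
  \<open>\<parallel>1\<^sub>E f\<parallel>\<^sup>2 + \<parallel>P f\<parallel>\<^sup>2 \<le> (1 + c) \<parallel>f\<parallel>\<^sup>2\<close> (\<open>concentration_sum_bound\<close>), and the hypotheses bound the
  left-hand side below by \<open>(2 - \<epsilon> - \<epsilon>') \<parallel>f\<parallel>\<^sup>2\<close>, whence \<open>1 - \<epsilon> - \<epsilon>' \<le> c\<close>.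
\<close>

section \<open>Finitely and infinitely differentiable functions of one variable\<close>

text \<open>
  Smoothness is handled through finite orders of differentiability: closure under products and
  compositions, and bootstrapping for differential equations, are inductions on the order.
\<close>

primrec n_diff :: "nat \<Rightarrow> real set \<Rightarrow> (real \<Rightarrow> 'b::real_normed_vector) \<Rightarrow> bool" where
  "n_diff 0 S f \<longleftrightarrow> True"
| "n_diff (Suc n) S f \<longleftrightarrow>
     (\<forall>t\<in>S. f differentiable (at t)) \<and> n_diff n S (\<lambda>t. vector_derivative f (at t))"

lemma has_vector_derivative_cong_on_open:
  assumes "open S" "t \<in> S" "\<And>s. s \<in> S \<Longrightarrow> f s = g s"
  shows "(f has_vector_derivative d) (at t) \<longleftrightarrow> (g has_vector_derivative d) (at t)"
  using assms
  by (metis (no_types, lifting) has_vector_derivative_transform_within_open)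

lemma vector_derivative_cong_on_open:
  assumes "open S" "t \<in> S" "\<And>s. s \<in> S \<Longrightarrow> f s = g s"
  shows "vector_derivative f (at t) = vector_derivative g (at t)"
  unfolding vector_derivative_def using has_vector_derivative_cong_on_open[OF assms] by simp

lemma differentiable_iff_has_vector_derivative:
  fixes f :: "real \<Rightarrow> 'b::real_normed_vector"
  shows "f differentiable (at t) \<longleftrightarrow> (\<exists>d. (f has_vector_derivative d) (at t))"
  using vector_derivative_works differentiableI_vector by blast

lemma n_diff_cong:
  assumes "open S" "\<And>t. t \<in> S \<Longrightarrow> f t = g t" "n_diff n S f"
  shows "n_diff n S g"
  using assms(2,3)
proof (induction n arbitrary: f g)
  case (Suc n)
  have "n_diff n S (\<lambda>t. vector_derivative g (at t))"
    by (rule Suc.IH[of "\<lambda>t. vector_derivative f (at t)"])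
      (use Suc.prems vector_derivative_cong_on_open[OF assms(1)] in auto)
  moreover have "g differentiable (at t)" if "t \<in> S" for t
  proof -
    have "(f has_vector_derivative d) (at t) \<longleftrightarrow> (g has_vector_derivative d) (at t)" for d
      by (rule has_vector_derivative_cong_on_open[OF assms(1) that]) (rule Suc.prems)
    then show ?thesis
      using that Suc.prems(2) unfolding n_diff.simps differentiable_iff_has_vector_derivative
      by metis
  qed
  ultimately show ?case by simp
qed simp

lemma n_diff_SucI:
  assumes "open S" "\<And>t. t \<in> S \<Longrightarrow> (f has_vector_derivative f' t) (at t)" "n_diff n S f'"
  shows "n_diff (Suc n) S f"
  unfolding n_diff.simps
proof
  show "\<forall>t\<in>S. f differentiable (at t)"
    using assms(2) differentiable_iff_has_vector_derivative by blast
  show "n_diff n S (\<lambda>t. vector_derivative f (at t))"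
    by (rule n_diff_cong[OF assms(1) _ assms(3)]) (use assms(2) vector_derivative_at in fastforce)
qed

text \<open>
  A derivative depends only on the germ of the function; this is what allows smoothness to be checked
  with formulas that differ from place to place, for instance by a sign.
\<close>

lemma n_diff_local:
  assumes "\<And>t. t \<in> S \<Longrightarrow> \<exists>N. t \<in> N \<and> n_diff n N f"
  shows "n_diff n S f"
  using assms
proof (induction n arbitrary: f)
  case (Suc n)
  have "f differentiable (at t)" if "t \<in> S" for t
    using Suc.prems[OF that] by auto
  moreover have "n_diff n S (\<lambda>t. vector_derivative f (at t))"
  proof (rule Suc.IH)
    fix t assume "t \<in> S"
    then show "\<exists>N. t \<in> N \<and> n_diff n N (\<lambda>t. vector_derivative f (at t))"
      using Suc.prems by (metis n_diff.simps(2))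
  qed
  ultimately show ?case by simp
qed simp

lemma n_diff_subset: "n_diff n S f \<Longrightarrow> T \<subseteq> S \<Longrightarrow> n_diff n T f"
  by (rule n_diff_local) blast

lemma n_diff_Suc_imp: "n_diff (Suc n) S f \<Longrightarrow> n_diff n S f"
proof (induction n arbitrary: f)
  case (Suc n)
  have "n_diff n S (\<lambda>t. vector_derivative f (at t))"
    using Suc.IH Suc.prems unfolding n_diff.simps(2)[of "Suc n" S f] by blast
  then show ?case using Suc.prems by simp
qed simp

text \<open>
  The iterated derivatives of \<open>f\<close> itself serve as the witnessing sequence, since on an open set any
  witness must agree with them.
\<close>

lemma smooth_on_iff_n_diff:
  assumes "open S"
  shows "smooth_on S f \<longleftrightarrow> (\<forall>n. n_diff n S f)"
proof
  assume "smooth_on S f"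
  then obtain D where D: "\<forall>t\<in>S. D 0 t = f t"
    "\<And>n t. t \<in> S \<Longrightarrow> (D n has_vector_derivative D (Suc n) t) (at t)"
    unfolding smooth_on_def by blast
  have "n_diff n S (D m)" for n m
  proof (induction n arbitrary: m)
    case (Suc n)
    show ?case by (rule n_diff_SucI[OF assms D(2) Suc.IH])
  qed simp
  then show "\<forall>n. n_diff n S f" using n_diff_cong[OF assms] D(1) by blast
next
  assume f: "\<forall>n. n_diff n S f"
  define D where "D n = ((\<lambda>g t. vector_derivative g (at t)) ^^ n) f" for n
  have "n_diff m S (D n)" for m n
  proof (induction n arbitrary: m)
    case 0 then show ?case using f by (simp add: D_def)
  next
    case (Suc n)
    show ?case using Suc.IH[of "Suc m"] by (simp add: D_def)
  qed
  from this[of "Suc 0"] have "(D n has_vector_derivative D (Suc n) t) (at t)" if "t \<in> S" for n t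
    using that by (simp add: D_def vector_derivative_works)
  moreover have "D 0 t = f t" for t by (simp add: D_def)
  ultimately show "smooth_on S f" unfolding smooth_on_def by blast
qed

lemma n_diff_add:
  assumes "open S" "n_diff n S f" "n_diff n S g"
  shows "n_diff n S (\<lambda>t. f t + g t)"
  using assms(2,3)
proof (induction n arbitrary: f g)
  case (Suc n)
  show ?case
    by (rule n_diff_SucI[OF assms(1) _ Suc.IH])
      (use Suc.prems in \<open>auto simp: vector_derivative_works intro!: has_vector_derivative_add\<close>)
qed simp

lemma n_diff_mult:
  fixes f g :: "real \<Rightarrow> real"
  assumes "open S" "n_diff n S f" "n_diff n S g"
  shows "n_diff n S (\<lambda>t. f t * g t)"
  using assms(2,3)
proof (induction n arbitrary: f g)
  case (Suc n)
  show ?case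
  proof (rule n_diff_SucI[OF assms(1)])
    fix t assume "t \<in> S"
    then show "((\<lambda>t. f t * g t) has_vector_derivative
        f t * vector_derivative g (at t) + vector_derivative f (at t) * g t) (at t)"
      using Suc.prems by (auto simp: vector_derivative_works intro!: has_vector_derivative_mult)
  next
    show "n_diff n S (\<lambda>t. f t * vector_derivative g (at t) + vector_derivative f (at t) * g t)"
      using Suc.prems n_diff_Suc_imp[OF Suc.prems(1)] n_diff_Suc_imp[OF Suc.prems(2)]
      by (intro n_diff_add[OF assms(1)] Suc.IH) simp_all
  qed
qed simp

lemma n_diff_const:
  assumes "open S"
  shows "n_diff n S (\<lambda>t. a)"
proof (induction n arbitrary: a)
  case (Suc n)
  show ?case by (rule n_diff_SucI[OF assms has_vector_derivative_const Suc.IH])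
qed simp

lemma n_diff_compose:
  fixes f g :: "real \<Rightarrow> real"
  assumes "open S" "n_diff n R f" "n_diff n S g" "g ` S \<subseteq> R"
  shows "n_diff n S (f \<circ> g)"
  using assms(2,3)
proof (induction n arbitrary: f)
  case (Suc n)
  let ?f' = "\<lambda>t. vector_derivative f (at t)" and ?g' = "\<lambda>t. vector_derivative g (at t)"
  show ?case
  proof (rule n_diff_SucI[OF assms(1)])
    fix t assume t: "t \<in> S"
    have "(g has_vector_derivative ?g' t) (at t)" "(f has_vector_derivative ?f' (g t)) (at (g t))"
      using Suc.prems t assms(4) by (auto simp: vector_derivative_works)
    then show "(f \<circ> g has_vector_derivative ?g' t * (?f' \<circ> g) t) (at t)"
      using vector_diff_chain_at by fastforce
  next
    show "n_diff n S (\<lambda>t. ?g' t * (?f' \<circ> g) t)"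
      using Suc.prems n_diff_Suc_imp[OF Suc.prems(2)]
      by (intro n_diff_mult[OF assms(1)] Suc.IH) simp_all
  qed
qed simp

text \<open>
  The exponents \<open>1/2\<close> and \<open>-1/2\<close> give \<open>\<surd>g\<close> and \<open>1/\<surd>g\<close>, the only nonlinear functions of the metric
  that occur.
\<close>

lemma smooth_on_powr: "smooth_on {0<..} (\<lambda>x::real. x powr r)"
  unfolding smooth_on_def
proof (intro exI conjI allI ballI)
  fix n and t :: real assume "t \<in> {0<..}"
  then show "((\<lambda>x. (\<Prod>i<n. r - real i) * x powr (r - real n)) has_vector_derivative
      (\<Prod>i<Suc n. r - real i) * t powr (r - real (Suc n))) (at t)"
    unfolding has_real_derivative_iff_has_vector_derivative[symmetric]
    by (auto intro!: derivative_eq_intros simp: algebra_simps)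
qed auto

lemma smooth_on_powr_compose:
  fixes f :: "real \<Rightarrow> real"
  assumes "open S" "smooth_on S f" "\<And>t. t \<in> S \<Longrightarrow> f t > 0"
  shows "smooth_on S (\<lambda>t. f t powr r)"
proof -
  have "n_diff n S ((\<lambda>x. x powr r) \<circ> f)" for n
  proof (rule n_diff_compose[OF assms(1)])
    show "n_diff n {0<..} (\<lambda>x::real. x powr r)"
      using smooth_on_powr smooth_on_iff_n_diff[of "{0<..}"] by auto
    show "n_diff n S f" using assms by (simp add: smooth_on_iff_n_diff)
    show "f ` S \<subseteq> {0<..}" using assms(3) by auto
  qed
  then show ?thesis using assms(1) by (simp add: smooth_on_iff_n_diff o_def)
qed

text \<open>
  The constant \<open>c\<close> may depend on the point: below it is the sign that tells in which direction a
  coordinate runs through arc length.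
\<close>

lemma smooth_on_locally_primitive:
  fixes f h :: "real \<Rightarrow> real"
  assumes S: "open S" and h: "smooth_on S h"
    and f: "\<And>t. t \<in> S \<Longrightarrow> \<exists>c. \<forall>\<^sub>F s in nhds t. (f has_real_derivative c * h s) (at s)"
  shows "smooth_on S f"
  unfolding smooth_on_iff_n_diff[OF S]
proof
  fix n
  show "n_diff n S f"
  proof (rule n_diff_local)
    fix t assume t: "t \<in> S"
    obtain c N where N: "open N" "t \<in> N" "\<And>s. s \<in> N \<Longrightarrow> (f has_real_derivative c * h s) (at s)"
      using f[OF t] unfolding eventually_nhds by blast
    let ?N = "N \<inter> S"
    have "n_diff (Suc n) ?N f"
    proof (rule n_diff_SucI)
      show "open ?N" using N S by blast
      show "(f has_vector_derivative c * h s) (at s)" if "s \<in> ?N" for s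
        using N(3) that by (simp add: has_real_derivative_iff_has_vector_derivative)
      show "n_diff n ?N (\<lambda>s. c * h s)"
        using h S \<open>open ?N\<close>
        by (intro n_diff_mult n_diff_const) (auto simp: smooth_on_iff_n_diff intro: n_diff_subset)
    qed
    then show "\<exists>N. t \<in> N \<and> n_diff n N f" using t N(2) n_diff_Suc_imp by blast
  qed
qed

text \<open>
  Bootstrapping: if \<open>x\<close> is \<open>n\<close> times differentiable, so is \<open>k \<circ> x\<close>, hence \<open>x'\<close>, and so \<open>x\<close> is \<open>n + 1\<close>
  times differentiable. The inverse of an arc-length coordinate is smooth for this reason.
\<close>

lemma smooth_on_autonomous_ode:
  fixes x k :: "real \<Rightarrow> real"
  assumes S: "open S" and R: "open R" and k: "smooth_on R k" and x: "x ` S \<subseteq> R"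
    and ode: "\<And>t. t \<in> S \<Longrightarrow> \<exists>c. \<forall>\<^sub>F s in nhds t. (x has_real_derivative c * k (x s)) (at s)"
  shows "smooth_on S x"
  unfolding smooth_on_iff_n_diff[OF S]
proof
  fix n
  show "n_diff n S x"
  proof (induction n)
    case (Suc n)
    show ?case
    proof (rule n_diff_local)
      fix t assume t: "t \<in> S"
      obtain c N where N: "open N" "t \<in> N"
        "\<And>s. s \<in> N \<Longrightarrow> (x has_real_derivative c * k (x s)) (at s)"
        using ode[OF t] unfolding eventually_nhds by blast
      let ?N = "N \<inter> S"
      have "n_diff (Suc n) ?N x"
      proof (rule n_diff_SucI)
        show o: "open ?N" using N S by blast
        show "(x has_vector_derivative c * (k \<circ> x) s) (at s)" if "s \<in> ?N" for s
          using N(3) that by (simp add: has_real_derivative_iff_has_vector_derivative)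
        show "n_diff n ?N (\<lambda>s. c * (k \<circ> x) s)"
          using k R x n_diff_subset[OF Suc.IH]
          by (intro n_diff_mult n_diff_const n_diff_compose[of _ _ R] o)
            (auto simp: smooth_on_iff_n_diff)
      qed
      then show "\<exists>N. t \<in> N \<and> n_diff (Suc n) N x" using t N(2) by blast
    qed
  qed simp
qed

lemma smooth_on_imp_continuous_on:
  "smooth_on S f \<Longrightarrow> continuous_on S f"
  unfolding smooth_on_def
  by (metis continuous_at_imp_continuous_on continuous_on_cong has_vector_derivative_continuous)

lemma smooth_on_cong:
  assumes "smooth_on S f" "\<And>t. t \<in> S \<Longrightarrow> f t = g t"
  shows "smooth_on S g"
  using assms unfolding smooth_on_def by metis

lemma smooth_on_first_derivative:
  fixes f :: "real \<Rightarrow> real"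
  assumes "open S" "smooth_on S f"
  shows "\<And>t. t \<in> S \<Longrightarrow> (f has_real_derivative deriv f t) (at t)"
    and "continuous_on S (deriv f)"
proof -
  obtain D where D: "\<And>t. t \<in> S \<Longrightarrow> D 0 t = f t"
    "\<And>n t. t \<in> S \<Longrightarrow> (D n has_vector_derivative D (Suc n) t) (at t)"
    using assms(2) unfolding smooth_on_def by blast
  have d: "(f has_real_derivative D (Suc 0) t) (at t)" if "t \<in> S" for t
    using D(2)[OF that, of 0] has_vector_derivative_cong_on_open[OF assms(1) that D(1)]
    by (simp add: has_real_derivative_iff_has_vector_derivative)
  then have e: "D (Suc 0) t = deriv f t" if "t \<in> S" for t
    using that DERIV_imp_deriv by metis
  show "(f has_real_derivative deriv f t) (at t)" if "t \<in> S" for t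
    using d e that by simp
  have "continuous_on S (D (Suc 0))"
    using D(2) has_vector_derivative_continuous continuous_at_imp_continuous_on by blast
  then show "continuous_on S (deriv f)" using e by (simp cong: continuous_on_cong)
qed

section \<open>Charts and arc length\<close>

definition arc_density :: "'a riem1 \<Rightarrow> 'a chart \<Rightarrow> real \<Rightarrow> real" where
  "arc_density M c x = sqrt (rm_metric M c (chart_inv c x))"

text \<open>
  The curve has unit speed for the metric near time \<open>t\<close>: its coordinate has velocity \<open>\<sigma>/\<surd>g\<close>. The
  sign \<open>\<sigma>\<close>, which gives the direction of travel, is constant near \<open>t\<close> by definition, so that arc length
  is immediately seen to be affine in time.
\<close>

definition unit_in_chart :: "'a riem1 \<Rightarrow> 'a chart \<Rightarrow> real \<Rightarrow> (real \<Rightarrow> 'a) \<Rightarrow> real \<Rightarrow> bool" where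
  "unit_in_chart M c \<sigma> \<gamma> t \<longleftrightarrow> c \<in> rm_atlas M \<and> \<bar>\<sigma>\<bar> = 1 \<and>
     (\<forall>\<^sub>F s in nhds t. \<gamma> s \<in> fst c \<and>
        ((snd c \<circ> \<gamma>) has_real_derivative \<sigma> / arc_density M c (snd c (\<gamma> s))) (at s))"

definition unit_speed :: "'a riem1 \<Rightarrow> real set \<Rightarrow> (real \<Rightarrow> 'a) \<Rightarrow> bool" where
  "unit_speed M I \<gamma> \<longleftrightarrow> (\<forall>t\<in>I. \<exists>c \<sigma>. unit_in_chart M c \<sigma> \<gamma> t)"

locale riemannian_1 =
  fixes M :: "'a riem1"
  assumes manifold: "riemannian_1_manifold M"
begin

lemma Hausdorff: "Hausdorff_space (rm_top M)"
  using manifold unfolding riemannian_1_manifold_def by blast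

lemma charts_cover: "(\<Union>c\<in>rm_atlas M. fst c) = rm_points M"
  using manifold unfolding riemannian_1_manifold_def by blast

lemma
  assumes c: "c \<in> rm_atlas M"
  shows chart_domain_open: "openin (rm_top M) (fst c)"
    and chart_image_open: "open (snd c ` fst c)"
    and chart_homeomorphic:
      "homeomorphic_map (subtopology (rm_top M) (fst c)) (top_of_set (snd c ` fst c)) (snd c)"
    and metric_pos: "\<And>p. p \<in> fst c \<Longrightarrow> rm_metric M c p > 0"
    and metric_smooth: "smooth_on (snd c ` fst c) (rm_metric M c \<circ> chart_inv c)"
  using manifold c unfolding riemannian_1_manifold_def by blast+

lemma
  assumes c: "c \<in> rm_atlas M" and d: "d \<in> rm_atlas M"
  shows transition_smooth: "smooth_on (snd c ` (fst c \<inter> fst d)) (snd d \<circ> chart_inv c)"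
    and metric_transition: "\<And>p. p \<in> fst c \<Longrightarrow> p \<in> fst d \<Longrightarrow>
      rm_metric M c p = rm_metric M d p * (deriv (snd d \<circ> chart_inv c) (snd c p))\<^sup>2"
  using manifold c d unfolding riemannian_1_manifold_def by blast+

lemma chart_domain_subset: "c \<in> rm_atlas M \<Longrightarrow> fst c \<subseteq> rm_points M"
  using charts_cover by blast

lemma chart_inj:
  assumes c: "c \<in> rm_atlas M"
  shows "inj_on (snd c) (fst c)"
  using chart_homeomorphic[OF c] chart_domain_subset[OF c]
  by (auto simp: homeomorphic_eq_everything_map topspace_subtopology Int_absorb1)

lemma chart_inv_chart [simp]: "c \<in> rm_atlas M \<Longrightarrow> p \<in> fst c \<Longrightarrow> chart_inv c (snd c p) = p"
  using chart_inj by (simp add: chart_inv_def)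

lemma chart_chart_inv [simp]: "x \<in> snd c ` fst c \<Longrightarrow> snd c (chart_inv c x) = x"
  by (simp add: chart_inv_def f_inv_into_f)

lemma chart_inv_in [simp]: "x \<in> snd c ` fst c \<Longrightarrow> chart_inv c x \<in> fst c"
  by (simp add: chart_inv_def inv_into_into)

lemma chart_image_of_open:
  assumes c: "c \<in> rm_atlas M" and V: "openin (rm_top M) V"
  shows "open (snd c ` (fst c \<inter> V))"
proof -
  have "openin (subtopology (rm_top M) (fst c)) (fst c \<inter> V)"
    using V by (simp add: openin_subtopology_Int2)
  then have "openin (top_of_set (snd c ` fst c)) (snd c ` (fst c \<inter> V))"
    using homeomorphic_imp_open_map[OF chart_homeomorphic[OF c]] by (simp add: open_map_def)
  then show ?thesis using chart_image_open[OF c] openin_open_trans by blast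
qed

lemma chart_preimage_open:
  assumes c: "c \<in> rm_atlas M" and S: "open S"
  shows "openin (rm_top M) {p \<in> fst c. snd c p \<in> S}"
proof -
  have "continuous_map (subtopology (rm_top M) (fst c)) (top_of_set (snd c ` fst c)) (snd c)"
    using chart_homeomorphic[OF c] homeomorphic_imp_continuous_map by blast
  then have "continuous_map (subtopology (rm_top M) (fst c)) euclidean (snd c)"
    using continuous_map_in_subtopology by blast
  then have "openin (subtopology (rm_top M) (fst c))
      {p \<in> topspace (subtopology (rm_top M) (fst c)). snd c p \<in> S}"
    using S by (auto simp: continuous_map_def)
  moreover have "{p \<in> topspace (subtopology (rm_top M) (fst c)). snd c p \<in> S}
      = {p \<in> fst c. snd c p \<in> S}"
    using chart_domain_subset[OF c] by auto
  ultimately show ?thesis using openin_trans_full chart_domain_open[OF c] by metis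
qed

lemma arc_density_pos: "c \<in> rm_atlas M \<Longrightarrow> x \<in> snd c ` fst c \<Longrightarrow> arc_density M c x > 0"
  unfolding arc_density_def by (metis chart_inv_in metric_pos real_sqrt_gt_0_iff)

lemma arc_density_smooth:
  assumes c: "c \<in> rm_atlas M"
  shows "smooth_on (snd c ` fst c) (arc_density M c)"
    and "smooth_on (snd c ` fst c) (\<lambda>x. 1 / arc_density M c x)"
proof -
  let ?g = "rm_metric M c \<circ> chart_inv c"
  have pos: "?g x > 0" if "x \<in> snd c ` fst c" for x
    using that metric_pos[OF c] by auto
  note sm = smooth_on_powr_compose[OF chart_image_open[OF c] metric_smooth[OF c] pos]
  show "smooth_on (snd c ` fst c) (arc_density M c)"
  proof (rule smooth_on_cong[OF sm[where r = "1/2"]])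
    show "?g x powr (1/2) = arc_density M c x" if "x \<in> snd c ` fst c" for x
      using powr_half_sqrt[OF less_imp_le[OF pos[OF that]]] by (simp add: arc_density_def)
  qed
  show "smooth_on (snd c ` fst c) (\<lambda>x. 1 / arc_density M c x)"
  proof (rule smooth_on_cong[OF sm[where r = "- (1/2)"]])
    show "?g x powr (- (1/2)) = 1 / arc_density M c x" if "x \<in> snd c ` fst c" for x
      using powr_half_sqrt[OF less_imp_le[OF pos[OF that]]]
      by (simp only: powr_minus) (simp add: arc_density_def inverse_eq_divide)
  qed
qed

text \<open>
  \<open>G\<close> is arc length measured from \<open>p\<close>: a primitive of \<open>\<surd>g\<close> on an interval around the coordinate of
  \<open>p\<close>, injective because \<open>\<surd>g\<close> is positive.
\<close>

lemma arc_length_coordinate: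
  assumes c: "c \<in> rm_atlas M" and p: "p \<in> fst c"
  obtains J G where "open J" "snd c p \<in> J" "J \<subseteq> snd c ` fst c"
    "\<And>x. x \<in> J \<Longrightarrow> (G has_real_derivative arc_density M c x) (at x)"
    "inj_on G J" "G (snd c p) = 0" "open (G ` J)"
proof -
  let ?x = "snd c p"
  obtain r where r: "r > 0" "cball ?x r \<subseteq> snd c ` fst c"
    using chart_image_open[OF c] p by (meson image_eqI open_contains_cball)
  define J where "J = {?x - r<..<?x + r}"
  have J: "J \<subseteq> {?x - r..?x + r}" "{?x - r..?x + r} \<subseteq> snd c ` fst c"
    using r by (auto simp: J_def cball_eq_atLeastAtMost)
  have "continuous_on {?x - r..?x + r} (arc_density M c)"
    using smooth_on_imp_continuous_on[OF arc_density_smooth(1)[OF c]] J(2) continuous_on_subset by blast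
  then obtain G where G: "\<And>x. x \<in> {?x - r..?x + r} \<Longrightarrow>
      (G has_vector_derivative arc_density M c x) (at x within {?x - r..?x + r})"
    using antiderivative_continuous by blast
  have G': "(G has_real_derivative arc_density M c x) (at x)" if "x \<in> J" for x
  proof -
    have "x \<in> interior {?x - r..?x + r}" using that by (simp add: J_def)
    then show ?thesis using G[of x] that J(1)
      by (metis at_within_interior has_real_derivative_iff_has_vector_derivative subsetD)
  qed
  have less: "G x < G y" if "x \<in> J" "y \<in> J" "x < y" for x y
  proof (rule DERIV_pos_imp_increasing[OF that(3)])
    fix z assume "x \<le> z" "z \<le> y"
    then have "z \<in> J" using that by (auto simp: J_def)
    then show "\<exists>d. DERIV G z :> d \<and> d > 0" using G' J arc_density_pos[OF c] by blast
  qed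
  then have inj: "inj_on G J" by (metis inj_onI less_irrefl linorder_neqE)
  have "continuous_on J G"
    using G' by (meson DERIV_isCont continuous_at_imp_continuous_on)
  then have "open (G ` J)"
    using inj by (intro injective_into_1d_imp_open_map_UNIV[of J J]) (auto simp: J_def)
  let ?G = "\<lambda>x. G x - G ?x"
  have "?G ` J = (\<lambda>y. y - G ?x) ` G ` J" by auto
  then have "open (?G ` J)" using open_translation_subtract[OF \<open>open (G ` J)\<close>] by metis
  moreover have "(?G has_real_derivative arc_density M c x) (at x)" if "x \<in> J" for x
    using G'[OF that] by (auto intro!: derivative_eq_intros)
  moreover have "open J" "?x \<in> J" "J \<subseteq> snd c ` fst c" "inj_on ?G J"
    using r(1) J inj by (auto simp: inj_on_def) (auto simp: J_def)
  ultimately show ?thesis using that[of J ?G] by simp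
qed

lemma unit_in_chartD:
  assumes "unit_in_chart M c \<sigma> \<gamma> t"
  shows "c \<in> rm_atlas M" "\<bar>\<sigma>\<bar> = 1" "\<gamma> t \<in> fst c"
    "((snd c \<circ> \<gamma>) has_real_derivative \<sigma> / arc_density M c (snd c (\<gamma> t))) (at t)"
    "\<forall>\<^sub>F s in nhds t. \<gamma> s \<in> fst c \<and>
        ((snd c \<circ> \<gamma>) has_real_derivative \<sigma> / arc_density M c (snd c (\<gamma> s))) (at s)"
proof -
  show *: "\<forall>\<^sub>F s in nhds t. \<gamma> s \<in> fst c \<and>
        ((snd c \<circ> \<gamma>) has_real_derivative \<sigma> / arc_density M c (snd c (\<gamma> s))) (at s)"
    and "c \<in> rm_atlas M" "\<bar>\<sigma>\<bar> = 1"
    using assms unfolding unit_in_chart_def by blast+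
  from eventually_nhds_x_imp_x[OF *] show "\<gamma> t \<in> fst c"
    "((snd c \<circ> \<gamma>) has_real_derivative \<sigma> / arc_density M c (snd c (\<gamma> t))) (at t)"
    by blast+
qed

text \<open>
  Continuity for the topology of \<open>M\<close> follows from continuity of the coordinate alone, because charts
  are homeomorphisms and the curve stays in the domain of the chart.
\<close>

lemma unit_in_chart_continuous:
  assumes "unit_in_chart M c \<sigma> \<gamma> t" "openin (rm_top M) V" "\<gamma> t \<in> V"
  shows "\<forall>\<^sub>F s in nhds t. \<gamma> s \<in> V"
proof -
  have c: "c \<in> rm_atlas M" and ev: "\<forall>\<^sub>F s in nhds t. \<gamma> s \<in> fst c \<and>
        ((snd c \<circ> \<gamma>) has_real_derivative \<sigma> / arc_density M c (snd c (\<gamma> s))) (at s)"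
    using assms(1) unfolding unit_in_chart_def by auto
  note now = eventually_nhds_x_imp_x[OF ev]
  have "isCont (snd c \<circ> \<gamma>) t" using now DERIV_isCont by blast
  then have "((snd c \<circ> \<gamma>) \<longlongrightarrow> (snd c \<circ> \<gamma>) t) (nhds t)"
    unfolding isCont_def tendsto_at_iff_tendsto_nhds .
  then have "\<forall>\<^sub>F s in nhds t. (snd c \<circ> \<gamma>) s \<in> snd c ` (fst c \<inter> V)"
    by (rule topological_tendstoD) (use chart_image_of_open[OF c] assms now in auto)
  with ev show ?thesis
  proof eventually_elim
    case (elim s)
    then obtain q where "q \<in> fst c" "q \<in> V" "snd c (\<gamma> s) = snd c q" by auto
    then show ?case using elim chart_inj[OF c] by (metis inj_onD)
  qed
qed

text \<open>
  By the chain rule \<open>G\<close> has derivative \<open>\<surd>g \<sigma>/\<surd>g = \<sigma>\<close> along the curve. Local uniqueness, injectivity and openness of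
  unit-speed curves follow from this formula.
\<close>

lemma unit_in_chart_arc_length:
  assumes u: "unit_in_chart M c \<sigma> \<gamma> t"
    and J: "open J" "snd c (\<gamma> t) \<in> J" "J \<subseteq> snd c ` fst c"
    and G: "\<And>x. x \<in> J \<Longrightarrow> (G has_real_derivative arc_density M c x) (at x)"
  shows "\<forall>\<^sub>F s in nhds t. \<gamma> s \<in> fst c \<and> snd c (\<gamma> s) \<in> J \<and>
           G (snd c (\<gamma> s)) = G (snd c (\<gamma> t)) + \<sigma> * (s - t)"
proof -
  have c: "c \<in> rm_atlas M" and ev: "\<forall>\<^sub>F s in nhds t. \<gamma> s \<in> fst c \<and>
        ((snd c \<circ> \<gamma>) has_real_derivative \<sigma> / arc_density M c (snd c (\<gamma> s))) (at s)"
    using u unfolding unit_in_chart_def by auto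
  have "\<gamma> t \<in> {p \<in> fst c. snd c p \<in> J}" using eventually_nhds_x_imp_x[OF ev] J by auto
  then have "\<forall>\<^sub>F s in nhds t. \<gamma> s \<in> {p \<in> fst c. snd c p \<in> J}"
    by (rule unit_in_chart_continuous[OF u chart_preimage_open[OF c J(1)]])
  with ev have "\<forall>\<^sub>F s in nhds t. \<gamma> s \<in> fst c \<and> snd c (\<gamma> s) \<in> J \<and>
      ((\<lambda>s. G (snd c (\<gamma> s)) - \<sigma> * s) has_real_derivative 0) (at s)"
  proof eventually_elim
    case (elim s)
    have "((G \<circ> (snd c \<circ> \<gamma>)) has_real_derivative
        arc_density M c ((snd c \<circ> \<gamma>) s) * (\<sigma> / arc_density M c (snd c (\<gamma> s)))) (at s)"
      using elim G[of "snd c (\<gamma> s)"] by (intro DERIV_chain) auto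
    moreover have "arc_density M c (snd c (\<gamma> s)) \<noteq> 0" using elim arc_density_pos[OF c] by force
    ultimately have "((\<lambda>s. G (snd c (\<gamma> s))) has_real_derivative \<sigma>) (at s)"
      by (simp add: o_def)
    then show ?case using elim by (auto intro!: derivative_eq_intros)
  qed
  then obtain r where r: "r > 0" "\<And>s. dist s t < r \<Longrightarrow> \<gamma> s \<in> fst c \<and> snd c (\<gamma> s) \<in> J \<and>
      ((\<lambda>s. G (snd c (\<gamma> s)) - \<sigma> * s) has_real_derivative 0) (at s)"
    unfolding eventually_nhds_metric by blast
  have "\<exists>k. \<forall>s\<in>ball t r. G (snd c (\<gamma> s)) - \<sigma> * s = k"
    by (rule has_field_derivative_zero_constant)
      (use r(2) in \<open>auto simp: dist_commute intro: has_field_derivative_at_within\<close>)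
  then obtain k where k: "\<And>s. dist s t < r \<Longrightarrow> G (snd c (\<gamma> s)) - \<sigma> * s = k"
    by (auto simp: dist_commute)
  have "G (snd c (\<gamma> s)) = G (snd c (\<gamma> t)) + \<sigma> * (s - t)" if "dist s t < r" for s
    using k[OF that] k[of t] r(1) by (simp add: algebra_simps)
  then show ?thesis unfolding eventually_nhds_metric using r by blast
qed


lemma unit_in_chart_cong:
  assumes u: "unit_in_chart M c \<sigma> \<gamma> t" and eq: "\<forall>\<^sub>F s in nhds t. \<gamma> s = \<gamma>' s"
  shows "unit_in_chart M c \<sigma> \<gamma>' t"
proof -
  have "\<forall>\<^sub>F s in nhds t. \<gamma> s \<in> fst c \<and>
        ((snd c \<circ> \<gamma>) has_real_derivative \<sigma> / arc_density M c (snd c (\<gamma> s))) (at s)"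
    using u unfolding unit_in_chart_def by auto
  moreover have "\<forall>\<^sub>F s in nhds t. \<forall>\<^sub>F s' in nhds s. \<gamma> s' = \<gamma>' s'"
    using eq by (simp add: eventually_eventually)
  ultimately have "\<forall>\<^sub>F s in nhds t. \<gamma>' s \<in> fst c \<and>
        ((snd c \<circ> \<gamma>') has_real_derivative \<sigma> / arc_density M c (snd c (\<gamma>' s))) (at s)"
    using eq
  proof eventually_elim
    case (elim s)
    have "\<forall>\<^sub>F s' in nhds s. (snd c \<circ> \<gamma>) s' = (snd c \<circ> \<gamma>') s'"
      using elim(2) by eventually_elim simp
    from DERIV_cong_ev[OF refl this refl] show ?case using elim(1,3) by metis
  qed
  then show ?thesis using u unfolding unit_in_chart_def by blast
qed

lemma unit_in_chart_affine:
  assumes u: "unit_in_chart M c \<sigma> \<gamma> (k + \<rho> * t)" and \<rho>: "\<bar>\<rho>\<bar> = 1"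
  shows "unit_in_chart M c (\<sigma> * \<rho>) (\<lambda>s. \<gamma> (k + \<rho> * s)) t"
proof -
  have lim: "filterlim (\<lambda>s. k + \<rho> * s) (nhds (k + \<rho> * t)) (nhds t)"
    by (intro tendsto_intros filterlim_ident)
  have ev: "\<forall>\<^sub>F s in nhds (k + \<rho> * t). \<gamma> s \<in> fst c \<and>
        ((snd c \<circ> \<gamma>) has_real_derivative \<sigma> / arc_density M c (snd c (\<gamma> s))) (at s)"
    using u unfolding unit_in_chart_def by auto
  from eventually_compose_filterlim[OF ev lim]
  have "\<forall>\<^sub>F s in nhds t. \<gamma> (k + \<rho> * s) \<in> fst c \<and> ((snd c \<circ> (\<lambda>s. \<gamma> (k + \<rho> * s)))
          has_real_derivative \<sigma> * \<rho> / arc_density M c (snd c (\<gamma> (k + \<rho> * s)))) (at s)"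
  proof eventually_elim
    case (elim s)
    have "((\<lambda>s. k + \<rho> * s) has_real_derivative \<rho>) (at s)"
      by (auto intro!: derivative_eq_intros)
    with elim have "((\<lambda>s. (snd c \<circ> \<gamma>) (k + \<rho> * s)) has_real_derivative
        \<sigma> / arc_density M c (snd c (\<gamma> (k + \<rho> * s))) * \<rho>) (at s)"
      by (intro DERIV_chain2[of "snd c \<circ> \<gamma>"]) auto
    then show ?case using elim by (simp add: o_def)
  qed
  then show ?thesis using u \<rho> unfolding unit_in_chart_def by (simp add: abs_mult)
qed

text \<open>
  The transformation law of the metric says \<open>\<surd>g\<^sub>c = \<surd>g\<^sub>d |\<tau>'|\<close> for the transition map \<open>\<tau>\<close>. So the
  coordinate in \<open>d\<close> again has velocity \<open>1/\<surd>g\<^sub>d\<close> up to sign, and the sign is locally constant since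
  \<open>\<tau>'\<close> is continuous and never zero.
\<close>

lemma unit_in_chart_change:
  assumes u: "unit_in_chart M c \<sigma> \<gamma> t" and d: "d \<in> rm_atlas M" "\<gamma> t \<in> fst d"
  shows "\<exists>\<sigma>'. unit_in_chart M d \<sigma>' \<gamma> t"
proof -
  have c: "c \<in> rm_atlas M" and \<sigma>: "\<bar>\<sigma>\<bar> = 1" and ev: "\<forall>\<^sub>F s in nhds t. \<gamma> s \<in> fst c \<and>
        ((snd c \<circ> \<gamma>) has_real_derivative \<sigma> / arc_density M c (snd c (\<gamma> s))) (at s)"
    using u unfolding unit_in_chart_def by auto
  note now = eventually_nhds_x_imp_x[OF ev]
  define R where "R = snd c ` (fst c \<inter> fst d)"
  define \<tau> where "\<tau> = snd d \<circ> chart_inv c"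
  have R: "open R" unfolding R_def by (rule chart_image_of_open[OF c chart_domain_open[OF d(1)]])
  note \<tau> = smooth_on_first_derivative[OF R transition_smooth[OF c d(1), folded R_def \<tau>_def]]
  have metric: "rm_metric M c p = rm_metric M d p * (deriv \<tau> (snd c p))\<^sup>2"
    if "p \<in> fst c" "p \<in> fst d" for p
    using metric_transition[OF c d(1) that] by (simp add: \<tau>_def)
  have nz: "deriv \<tau> (snd c p) \<noteq> 0" if "p \<in> fst c" "p \<in> fst d" for p
    using metric[OF that] metric_pos[OF c that(1)] by auto
  define \<kappa> where "\<kappa> = sgn (deriv \<tau> (snd c (\<gamma> t)))"
  have "isCont (deriv \<tau>) (snd c (\<gamma> t))"
    using \<tau>(2) R now d(2) by (auto simp: continuous_on_eq_continuous_at R_def)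
  moreover have "isCont (snd c \<circ> \<gamma>) t" using now DERIV_isCont by blast
  ultimately have "isCont (deriv \<tau> \<circ> (snd c \<circ> \<gamma>)) t" by (intro continuous_at_compose) auto
  then have lim: "((deriv \<tau> \<circ> (snd c \<circ> \<gamma>)) \<longlongrightarrow> (deriv \<tau> \<circ> (snd c \<circ> \<gamma>)) t) (nhds t)"
    unfolding isCont_def tendsto_at_iff_tendsto_nhds .
  have "\<forall>\<^sub>F s in nhds t. sgn (deriv \<tau> (snd c (\<gamma> s))) = \<kappa>"
  proof (cases "deriv \<tau> (snd c (\<gamma> t)) > 0")
    case True
    then show ?thesis
      using order_tendstoD(1)[OF lim, of 0] by (auto simp: \<kappa>_def elim: eventually_mono)
  next
    case False
    then have "deriv \<tau> (snd c (\<gamma> t)) < 0" using nz[of "\<gamma> t"] now d(2) by force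
    then show ?thesis
      using order_tendstoD(2)[OF lim, of 0] by (auto simp: \<kappa>_def elim: eventually_mono)
  qed
  moreover have evd: "\<forall>\<^sub>F s in nhds t. \<gamma> s \<in> fst c \<and> \<gamma> s \<in> fst d"
    using ev unit_in_chart_continuous[OF u chart_domain_open[OF d(1)] d(2)]
    by eventually_elim blast
  moreover have "\<forall>\<^sub>F s in nhds t. \<forall>\<^sub>F s' in nhds s. \<gamma> s' \<in> fst c \<and> \<gamma> s' \<in> fst d"
    using evd by (simp add: eventually_eventually)
  ultimately have "\<forall>\<^sub>F s in nhds t. \<gamma> s \<in> fst d \<and>
        ((snd d \<circ> \<gamma>) has_real_derivative \<sigma> * \<kappa> / arc_density M d (snd d (\<gamma> s))) (at s)"
    using ev
  proof eventually_elim
    case (elim s)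
    let ?x = "snd c (\<gamma> s)"
    have "?x \<in> R" using elim by (auto simp: R_def)
    then have "((\<tau> \<circ> (snd c \<circ> \<gamma>)) has_real_derivative deriv \<tau> ?x * (\<sigma> / arc_density M c ?x)) (at s)"
      using elim \<tau>(1) by (intro DERIV_chain) auto
    moreover have "\<forall>\<^sub>F s' in nhds s. (\<tau> \<circ> (snd c \<circ> \<gamma>)) s' = (snd d \<circ> \<gamma>) s'"
      using elim(3) by eventually_elim (simp add: \<tau>_def c)
    ultimately have "((snd d \<circ> \<gamma>) has_real_derivative deriv \<tau> ?x * (\<sigma> / arc_density M c ?x)) (at s)"
      using DERIV_cong_ev by blast
    moreover have "arc_density M c ?x = arc_density M d (snd d (\<gamma> s)) * \<bar>deriv \<tau> ?x\<bar>"
      using elim metric[of "\<gamma> s"] c d(1) by (simp add: arc_density_def real_sqrt_mult)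
    moreover have "\<kappa> = deriv \<tau> ?x / \<bar>deriv \<tau> ?x\<bar>"
      using elim(1) by (simp add: sgn_real_def split: if_splits)
    then have "deriv \<tau> ?x * (\<sigma> / (D * \<bar>deriv \<tau> ?x\<bar>)) = \<sigma> * \<kappa> / D" for D
      by (simp add: ac_simps)
    ultimately have "((snd d \<circ> \<gamma>) has_real_derivative \<sigma> * \<kappa> / arc_density M d (snd d (\<gamma> s))) (at s)"
      by metis
    then show ?case using elim(2) by blast
  qed
  moreover have "\<bar>\<sigma> * \<kappa>\<bar> = 1"
    using \<sigma> nz[of "\<gamma> t"] now d(2) by (auto simp: \<kappa>_def abs_mult abs_sgn_eq)
  ultimately show ?thesis unfolding unit_in_chart_def using d by blast
qed

text \<open>
  The inverse of a unit-speed curve is arc length: a point \<open>q\<close> near \<open>\<gamma> t\<close> is reached at the time at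
  which arc length takes the value that it has at \<open>q\<close>.
\<close>

lemma unit_in_chart_coordinate:
  assumes u: "unit_in_chart M c \<sigma> \<gamma> t"
    and J: "open J" "snd c (\<gamma> t) \<in> J" "J \<subseteq> snd c ` fst c"
    and G: "\<And>x. x \<in> J \<Longrightarrow> (G has_real_derivative arc_density M c x) (at x)"
    and inj: "inj_on G J" and r: "r > 0"
  obtains W where "openin (rm_top M) W" "\<gamma> t \<in> W" "W \<subseteq> fst c" "snd c ` W \<subseteq> J"
    "\<And>q. q \<in> W \<Longrightarrow> \<bar>G (snd c q) - G (snd c (\<gamma> t))\<bar> < r"
    "\<And>q. q \<in> W \<Longrightarrow> \<gamma> (t + \<sigma> * (G (snd c q) - G (snd c (\<gamma> t)))) = q"
proof -
  let ?a = "G (snd c (\<gamma> t))"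
  have c: "c \<in> rm_atlas M" and \<sigma>: "\<bar>\<sigma>\<bar> = 1" and now: "\<gamma> t \<in> fst c"
    using unit_in_chartD[OF u] by auto
  obtain \<delta> where \<delta>: "\<delta> > 0" "\<And>s. dist s t < \<delta> \<Longrightarrow> \<gamma> s \<in> fst c \<and> snd c (\<gamma> s) \<in> J \<and>
      G (snd c (\<gamma> s)) = ?a + \<sigma> * (s - t)"
    using unit_in_chart_arc_length[OF u J G] unfolding eventually_nhds_metric by blast
  define e where "e = min \<delta> r"
  define Q where "Q = J \<inter> G -` {?a - e<..<?a + e}"
  have "continuous_on J G" using G by (meson DERIV_isCont continuous_at_imp_continuous_on)
  then have Q: "open Q" unfolding Q_def using J(1) by (intro continuous_open_preimage) auto
  show ?thesis
  proof (rule that[of "{p \<in> fst c. snd c p \<in> Q}"])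
    show "openin (rm_top M) {p \<in> fst c. snd c p \<in> Q}" by (rule chart_preimage_open[OF c Q])
    show "\<gamma> t \<in> {p \<in> fst c. snd c p \<in> Q}" using now J(2) \<delta>(1) r by (simp add: Q_def e_def)
    fix q assume "q \<in> {p \<in> fst c. snd c p \<in> Q}"
    then have q: "q \<in> fst c" "snd c q \<in> J" "\<bar>G (snd c q) - ?a\<bar> < e"
      by (auto simp: Q_def abs_less_iff)
    then show "\<bar>G (snd c q) - ?a\<bar> < r" by (simp add: e_def)
    let ?s = "t + \<sigma> * (G (snd c q) - ?a)"
    have "dist ?s t < \<delta>" using q(3) \<sigma> by (simp add: dist_real_def abs_mult e_def)
    note s = \<delta>(2)[OF this]
    have "\<sigma> * \<sigma> = 1" using \<sigma> by (simp add: abs_if split: if_splits)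
    then have "G (snd c (\<gamma> ?s)) = G (snd c q)" using s by (simp flip: mult.assoc)
    then show "\<gamma> ?s = q" using s q inj chart_inj[OF c] by (metis inj_onD)
  qed (auto simp: Q_def)
qed

lemma unit_in_chart_locally_inj:
  assumes u: "unit_in_chart M c \<sigma> \<gamma> t"
  shows "\<exists>r>0. inj_on \<gamma> (ball t r)"
proof -
  have c: "c \<in> rm_atlas M" and \<sigma>: "\<bar>\<sigma>\<bar> = 1" and now: "\<gamma> t \<in> fst c"
    using unit_in_chartD[OF u] by auto
  obtain J G where J: "open J" "snd c (\<gamma> t) \<in> J" "J \<subseteq> snd c ` fst c"
    and G: "\<And>x. x \<in> J \<Longrightarrow> (G has_real_derivative arc_density M c x) (at x)"
    using arc_length_coordinate[OF c now] by metis
  obtain \<delta> where \<delta>: "\<delta> > 0" "\<And>s. dist s t < \<delta> \<Longrightarrow>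
      G (snd c (\<gamma> s)) = G (snd c (\<gamma> t)) + \<sigma> * (s - t)"
    using unit_in_chart_arc_length[OF u J G] unfolding eventually_nhds_metric by blast
  have "inj_on \<gamma> (ball t \<delta>)"
  proof (rule inj_onI)
    fix s s' assume "s \<in> ball t \<delta>" "s' \<in> ball t \<delta>" "\<gamma> s = \<gamma> s'"
    then have "\<sigma> * (s - t) = \<sigma> * (s' - t)"
      using \<delta>(2)[of s] \<delta>(2)[of s'] unfolding mem_ball by (metis add_left_cancel dist_commute)
    moreover have "\<sigma> \<noteq> 0" using \<sigma> by auto
    ultimately show "s = s'" by simp
  qed
  then show ?thesis using \<delta>(1) by blast
qed

lemma unit_in_chart_open:
  assumes u: "unit_in_chart M c \<sigma> \<gamma> t" and r: "r > 0"
  shows "\<exists>W. openin (rm_top M) W \<and> \<gamma> t \<in> W \<and> W \<subseteq> \<gamma> ` ball t r"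
proof -
  have c: "c \<in> rm_atlas M" and \<sigma>: "\<bar>\<sigma>\<bar> = 1" and now: "\<gamma> t \<in> fst c"
    using unit_in_chartD[OF u] by auto
  obtain J G where J: "open J" "snd c (\<gamma> t) \<in> J" "J \<subseteq> snd c ` fst c"
    and G: "\<And>x. x \<in> J \<Longrightarrow> (G has_real_derivative arc_density M c x) (at x)" "inj_on G J"
    using arc_length_coordinate[OF c now] by metis
  obtain W where W: "openin (rm_top M) W" "\<gamma> t \<in> W"
    "\<And>q. q \<in> W \<Longrightarrow> \<bar>G (snd c q) - G (snd c (\<gamma> t))\<bar> < r"
    "\<And>q. q \<in> W \<Longrightarrow> \<gamma> (t + \<sigma> * (G (snd c q) - G (snd c (\<gamma> t)))) = q"
    using unit_in_chart_coordinate[OF u J G r] by metis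
  have "W \<subseteq> \<gamma> ` ball t r"
  proof
    fix q assume q: "q \<in> W"
    let ?s = "t + \<sigma> * (G (snd c q) - G (snd c (\<gamma> t)))"
    have "?s \<in> ball t r" using W(3)[OF q] \<sigma> by (simp add: dist_real_def abs_mult)
    then show "q \<in> \<gamma> ` ball t r" using W(4)[OF q] by force
  qed
  then show ?thesis using W by blast
qed

text \<open>
  In a chart around the common point, both curves have arc length affine in time with slopes \<open>\<sigma>\<close> and
  \<open>\<sigma>''\<close>, and arc length is injective; \<open>\<rho> = \<sigma> \<sigma>''\<close> records whether they run in the same direction.
\<close>

lemma unit_in_chart_local_uniqueness:
  assumes \<alpha>: "unit_in_chart M c \<sigma> \<alpha> s" and \<beta>: "unit_in_chart M d \<sigma>' \<beta> t" and eq: "\<alpha> s = \<beta> t"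
  shows "\<exists>\<rho>. \<bar>\<rho>\<bar> = 1 \<and> (\<forall>\<^sub>F h in nhds 0. \<alpha> (s + h) = \<beta> (t + \<rho> * h))"
proof -
  have c: "c \<in> rm_atlas M" and \<sigma>: "\<bar>\<sigma>\<bar> = 1" and now: "\<alpha> s \<in> fst c"
    using unit_in_chartD[OF \<alpha>] by auto
  obtain \<sigma>'' where \<beta>': "unit_in_chart M c \<sigma>'' \<beta> t"
    using unit_in_chart_change[OF \<beta> c] now eq by auto
  then have \<sigma>'': "\<bar>\<sigma>''\<bar> = 1" unfolding unit_in_chart_def by blast
  obtain J G where J: "open J" "snd c (\<alpha> s) \<in> J" "J \<subseteq> snd c ` fst c"
    and G: "\<And>x. x \<in> J \<Longrightarrow> (G has_real_derivative arc_density M c x) (at x)" "inj_on G J"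
    using arc_length_coordinate[OF c now] by metis
  have near_\<alpha>: "\<forall>\<^sub>F x in nhds s. \<alpha> x \<in> fst c \<and> snd c (\<alpha> x) \<in> J \<and>
      G (snd c (\<alpha> x)) = G (snd c (\<alpha> s)) + \<sigma> * (x - s)"
    by (rule unit_in_chart_arc_length[OF \<alpha> J]) (rule G)
  have near_\<beta>: "\<forall>\<^sub>F x in nhds t. \<beta> x \<in> fst c \<and> snd c (\<beta> x) \<in> J \<and>
      G (snd c (\<beta> x)) = G (snd c (\<beta> t)) + \<sigma>'' * (x - t)"
    by (rule unit_in_chart_arc_length[OF \<beta>' J(1) J(2)[unfolded eq] J(3)]) (rule G)
  define \<rho> where "\<rho> = \<sigma> * \<sigma>''"
  have \<rho>: "\<bar>\<rho>\<bar> = 1" using \<sigma> \<sigma>'' by (simp add: \<rho>_def abs_mult)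
  have "filterlim (\<lambda>h. s + h) (nhds (s + 0)) (nhds 0)"
    "filterlim (\<lambda>h. t + \<rho> * h) (nhds (t + \<rho> * 0)) (nhds 0)"
    by (intro tendsto_intros filterlim_ident)+
  then have lim: "filterlim (\<lambda>h. s + h) (nhds s) (nhds 0)"
    "filterlim (\<lambda>h. t + \<rho> * h) (nhds t) (nhds 0)" by simp_all
  have "\<forall>\<^sub>F h in nhds 0. \<alpha> (s + h) = \<beta> (t + \<rho> * h)"
    using eventually_compose_filterlim[OF near_\<alpha> lim(1)]
      eventually_compose_filterlim[OF near_\<beta> lim(2)]
  proof eventually_elim
    case (elim h)
    have "\<sigma>'' * (\<rho> * h) = \<sigma> * h" using \<sigma>'' by (auto simp: \<rho>_def abs_if split: if_splits)
    with elim have "G (snd c (\<alpha> (s + h))) = G (snd c (\<beta> (t + \<rho> * h)))" by (simp add: eq)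
    with elim show ?case using G(2) chart_inj[OF c] by (metis inj_onD)
  qed
  then show ?thesis using \<rho> by blast
qed

text \<open>
  Invert the arc length in a chart; by the inverse function rule the result has velocity \<open>1/\<surd>g\<close>.
\<close>

lemma local_existence:
  assumes p: "p \<in> rm_points M"
  obtains \<epsilon> \<alpha> where "\<epsilon> > 0" "\<alpha> 0 = p" "unit_speed M {-\<epsilon><..<\<epsilon>} \<alpha>"
proof -
  obtain c where c: "c \<in> rm_atlas M" "p \<in> fst c" using p charts_cover by blast
  obtain J G where J: "open J" "snd c p \<in> J" "J \<subseteq> snd c ` fst c"
    and G: "\<And>x. x \<in> J \<Longrightarrow> (G has_real_derivative arc_density M c x) (at x)" "inj_on G J"
    and G0: "G (snd c p) = 0" "open (G ` J)"
    using arc_length_coordinate[OF c] by metis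
  define H where "H = inv_into J G"
  have cont: "continuous_on J G" using G by (meson DERIV_isCont continuous_at_imp_continuous_on)
  have H: "H (G x) = x" if "x \<in> J" for x using that G(2) by (simp add: H_def)
  have H': "(H has_real_derivative 1 / arc_density M c (H s)) (at s)" if s: "s \<in> G ` J" for s
  proof -
    obtain x where x: "x \<in> J" "s = G x" using s by blast
    then have pos: "arc_density M c x > 0" using arc_density_pos[OF c(1)] J(3) by blast
    have "(H has_derivative (*) (1 / arc_density M c x)) (at (G x))"
      by (rule has_derivative_inverse_strong[OF J(1) x(1) cont H
            G(1)[OF x(1), unfolded has_field_derivative_def]])
        (use pos in \<open>auto simp: fun_eq_iff\<close>)
    then show ?thesis using x H by (simp add: has_field_derivative_def)
  qed
  define \<alpha> where "\<alpha> = chart_inv c \<circ> H"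
  have \<alpha>: "\<alpha> s \<in> fst c" "snd c (\<alpha> s) = H s" if "s \<in> G ` J" for s
    using that H J(3) by (auto simp: \<alpha>_def)
  have u: "unit_in_chart M c 1 \<alpha> t" if t: "t \<in> G ` J" for t
    unfolding unit_in_chart_def
  proof (intro conjI)
    have "\<forall>\<^sub>F s in nhds t. s \<in> G ` J" using G0(2) t eventually_nhds by blast
    moreover from this have "\<forall>\<^sub>F s in nhds t. \<forall>\<^sub>F s' in nhds s. s' \<in> G ` J"
      by (simp add: eventually_eventually)
    ultimately show "\<forall>\<^sub>F s in nhds t. \<alpha> s \<in> fst c \<and>
        ((snd c \<circ> \<alpha>) has_real_derivative 1 / arc_density M c (snd c (\<alpha> s))) (at s)"
    proof eventually_elim
      case (elim s)
      have "\<forall>\<^sub>F s' in nhds s. H s' = (snd c \<circ> \<alpha>) s'"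
        using elim(2) by eventually_elim (simp add: \<alpha>)
      from DERIV_cong_ev[OF refl this refl] show ?case
        using H'[OF elim(1)] \<alpha>[OF elim(1)] by metis
    qed
  qed (use c in auto)
  have "0 \<in> G ` J" using G0 J(2) by force
  then obtain \<epsilon> where \<epsilon>: "\<epsilon> > 0" "ball 0 \<epsilon> \<subseteq> G ` J" using G0(2) open_contains_ball by blast
  have "unit_speed M {-\<epsilon><..<\<epsilon>} \<alpha>"
    unfolding unit_speed_def
  proof
    fix t assume "t \<in> {-\<epsilon><..<\<epsilon>}"
    then have "t \<in> ball 0 \<epsilon>" by (auto simp: dist_real_def)
    then show "\<exists>c \<sigma>. unit_in_chart M c \<sigma> \<alpha> t" using u \<epsilon>(2) by blast
  qed
  moreover have "\<alpha> 0 = p" using H[OF J(2)] G0(1) c by (simp add: \<alpha>_def)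
  ultimately show ?thesis using that \<epsilon>(1) by blast
qed

end

section \<open>Global continuation\<close>

context riemannian_1
begin

lemma unit_speed_subset: "unit_speed M I \<gamma> \<Longrightarrow> I' \<subseteq> I \<Longrightarrow> unit_speed M I' \<gamma>"
  unfolding unit_speed_def by blast

lemma unit_speed_affine:
  assumes "unit_speed M I \<gamma>" "\<bar>\<rho>\<bar> = 1" "\<And>t. t \<in> I' \<Longrightarrow> k + \<rho> * t \<in> I"
  shows "unit_speed M I' (\<lambda>t. \<gamma> (k + \<rho> * t))"
  using assms unit_in_chart_affine unfolding unit_speed_def by blast

lemma unit_speed_cong:
  assumes "unit_speed M I \<gamma>" "t \<in> I" "\<forall>\<^sub>F s in nhds t. \<gamma> s = \<gamma>' s"
  shows "\<exists>c \<sigma>. unit_in_chart M c \<sigma> \<gamma>' t"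
  using assms unit_in_chart_cong unfolding unit_speed_def by blast

lemma unit_speed_in_points:
  assumes "unit_speed M I \<gamma>" "t \<in> I"
  shows "\<gamma> t \<in> rm_points M"
  using assms chart_domain_subset unit_in_chartD(1,3) unfolding unit_speed_def by blast

lemma unit_speed_continuous:
  assumes "unit_speed M I \<gamma>" "t \<in> I" "openin (rm_top M) V" "\<gamma> t \<in> V"
  shows "\<forall>\<^sub>F s in nhds t. \<gamma> s \<in> V"
  using assms unit_in_chart_continuous unfolding unit_speed_def by blast

lemma unit_speed_open:
  assumes "unit_speed M I \<gamma>" "t \<in> I" "r > 0"
  shows "\<exists>W. openin (rm_top M) W \<and> \<gamma> t \<in> W \<and> W \<subseteq> \<gamma> ` ball t r"
proof -
  obtain c \<sigma> where "unit_in_chart M c \<sigma> \<gamma> t" using assms unfolding unit_speed_def by blast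
  then show ?thesis using assms(3) by (rule unit_in_chart_open)
qed

lemma unit_speed_locally_inj:
  assumes "unit_speed M I \<gamma>" "t \<in> I"
  shows "\<exists>r>0. inj_on \<gamma> (ball t r)"
proof -
  obtain c \<sigma> where "unit_in_chart M c \<sigma> \<gamma> t" using assms unfolding unit_speed_def by blast
  then show ?thesis by (rule unit_in_chart_locally_inj)
qed

lemma unit_speed_local_uniqueness:
  assumes "unit_speed M I \<alpha>" "s \<in> I" "unit_speed M I' \<beta>" "t \<in> I'" "\<alpha> s = \<beta> t"
  obtains \<rho> where "\<bar>\<rho>\<bar> = 1" "\<forall>\<^sub>F x in nhds s. \<alpha> x = \<beta> (t - \<rho> * s + \<rho> * x)"
proof -
  obtain \<rho> where \<rho>: "\<bar>\<rho>\<bar> = 1" "\<forall>\<^sub>F h in nhds 0. \<alpha> (s + h) = \<beta> (t + \<rho> * h)"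
    using assms unit_in_chart_local_uniqueness unfolding unit_speed_def by metis
  have "filterlim (\<lambda>x. x - s) (nhds (s - s)) (nhds s)"
    by (intro tendsto_intros filterlim_ident)
  then have "filterlim (\<lambda>x. x - s) (nhds 0) (nhds s)" by simp
  from eventually_compose_filterlim[OF \<rho>(2) this]
  have "\<forall>\<^sub>F x in nhds s. \<alpha> x = \<beta> (t - \<rho> * s + \<rho> * x)" by (simp add: algebra_simps)
  then show ?thesis using that \<rho>(1) by blast
qed

text \<open>
  The set of times near which the curves agree is open, and it is closed: at a limit time \<open>t\<close> the
  curves meet since \<open>M\<close> is Hausdorff, and if \<open>\<beta>\<close> were locally the time reversal of \<open>\<alpha>\<close> about \<open>t\<close>, an
  agreement at a time \<open>s \<noteq> t\<close> would contradict injectivity of \<open>\<beta>\<close> near \<open>t\<close>.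
\<close>

lemma unit_speed_unique:
  assumes \<alpha>: "unit_speed M I \<alpha>" and \<beta>: "unit_speed M I \<beta>"
    and I: "open I" "connected I" and t0: "t0 \<in> I" "\<forall>\<^sub>F s in nhds t0. \<alpha> s = \<beta> s"
    and t: "t \<in> I"
  shows "\<alpha> t = \<beta> t"
proof -
  define A where "A = {t \<in> I. \<forall>\<^sub>F s in nhds t. \<alpha> s = \<beta> s}"
  have A: "\<alpha> s = \<beta> s" if "s \<in> A" for s
    using that eventually_nhds_x_imp_x[of "\<lambda>s. \<alpha> s = \<beta> s"] by (simp add: A_def)
  have "\<forall>\<^sub>F s in nhds t. s \<in> A" if "t \<in> A" for t
  proof -
    have "\<forall>\<^sub>F s in nhds t. s \<in> I" using that I(1) eventually_nhds by (auto simp: A_def)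
    moreover have "\<forall>\<^sub>F s in nhds t. \<forall>\<^sub>F s' in nhds s. \<alpha> s' = \<beta> s'"
      using that by (simp add: A_def eventually_eventually)
    ultimately show ?thesis by eventually_elim (simp add: A_def)
  qed
  then have "\<exists>T. open T \<and> t \<in> T \<and> T \<subseteq> A" if "t \<in> A" for t
    using that unfolding eventually_nhds by (metis subsetI)
  then have op: "open A" by (subst open_subopen) blast
  have "\<forall>\<^sub>F s in nhds t. s \<notin> A" if t: "t \<in> I" "t \<notin> A" for t
  proof (cases "\<alpha> t = \<beta> t")
    case False
    obtain U V where UV: "openin (rm_top M) U" "openin (rm_top M) V" "\<alpha> t \<in> U" "\<beta> t \<in> V"
      "disjnt U V"
      using Hausdorff False unit_speed_in_points[OF \<alpha> t(1)] unit_speed_in_points[OF \<beta> t(1)]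
      unfolding Hausdorff_space_def by metis
    show ?thesis
      using unit_speed_continuous[OF \<alpha> t(1) UV(1,3)] unit_speed_continuous[OF \<beta> t(1) UV(2,4)]
    proof eventually_elim
      case (elim s)
      then show ?case using A[of s] UV(5) by (auto simp: disjnt_iff)
    qed
  next
    case True
    obtain \<rho> where \<rho>: "\<bar>\<rho>\<bar> = 1" "\<forall>\<^sub>F x in nhds t. \<alpha> x = \<beta> (t - \<rho> * t + \<rho> * x)"
      using unit_speed_local_uniqueness[OF \<alpha> t(1) \<beta> t(1) True] by blast
    have "\<rho> = - 1"
    proof (rule ccontr)
      assume "\<rho> \<noteq> - 1"
      then have "\<rho> = 1" using \<rho>(1) by linarith
      then show False using \<rho>(2) t by (simp add: A_def)
    qed
    obtain r where r: "r > 0" "inj_on \<beta> (ball t r)"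
      using unit_speed_locally_inj[OF \<beta> t(1)] by blast
    have "\<forall>\<^sub>F s in nhds t. s \<in> ball t r" using r(1) eventually_nhds_ball by blast
    with \<rho>(2) show ?thesis
    proof eventually_elim
      case (elim s)
      show ?case
      proof
        assume "s \<in> A"
        with A[of s] elim \<open>\<rho> = - 1\<close> have "\<beta> s = \<beta> (t + t - s)" by simp
        moreover have "t + t - s \<in> ball t r" using elim by (simp add: dist_real_def)
        ultimately have "s = t + t - s" using r(2) elim by (metis inj_onD)
        then have "s = t" by simp
        with t \<open>s \<in> A\<close> show False by simp
      qed
    qed
  qed
  then have "\<exists>T. open T \<and> t \<in> T \<and> T \<subseteq> I - A" if "t \<in> I - A" for t
    using that I(1) unfolding eventually_nhds
    by (metis (no_types, lifting) Diff_iff IntD1 IntD2 IntI open_Int subsetI)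
  then have "open (I - A)" by (subst open_subopen) blast
  then have "closedin (top_of_set I) A"
    unfolding closedin_def using I(1) by (auto simp: A_def openin_open_eq)
  moreover have "openin (top_of_set I) A"
    using op I(1) by (auto simp: A_def openin_open_eq)
  moreover have "t0 \<in> A" using t0 by (simp add: A_def)
  ultimately have "A = I" using I(2) unfolding connected_clopen by blast
  then show ?thesis using A t by blast
qed

end

locale compact_riemannian_1 = riemannian_1 +
  assumes compact: "compact_space (rm_top M)"
    and connected: "connected_space (rm_top M)"
    and nonempty: "rm_points M \<noteq> {}"
begin

text \<open>
  Each point \<open>p\<close> has a curve on \<open>(-\<epsilon>\<^sub>p, \<epsilon>\<^sub>p)\<close>, whose middle half covers a neighbourhood of \<open>p\<close>. Around
  every point of the middle half the same curve can still be followed for a time \<open>\<epsilon>\<^sub>p/2\<close> in both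
  directions, and finitely many middle halves cover \<open>M\<close>.
\<close>

lemma uniform_local_existence:
  "\<exists>\<epsilon>>0. \<forall>q\<in>rm_points M. \<exists>\<beta>. \<beta> 0 = q \<and> unit_speed M {-\<epsilon><..<\<epsilon>} \<beta>"
proof -
  have "\<forall>p\<in>rm_points M. \<exists>\<epsilon> \<alpha> W. \<epsilon> > 0 \<and> unit_speed M {-\<epsilon><..<\<epsilon>} \<alpha> \<and>
      openin (rm_top M) W \<and> p \<in> W \<and> W \<subseteq> \<alpha> ` ball 0 (\<epsilon>/2)"
  proof
    fix p assume "p \<in> rm_points M"
    then obtain \<epsilon> \<alpha> where \<alpha>: "\<epsilon> > 0" "\<alpha> 0 = p" "unit_speed M {-\<epsilon><..<\<epsilon>} \<alpha>"
      using local_existence by metis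
    then obtain W where "openin (rm_top M) W" "p \<in> W" "W \<subseteq> \<alpha> ` ball 0 (\<epsilon>/2)"
      using unit_speed_open[OF \<alpha>(3), of 0 "\<epsilon>/2"] by auto
    with \<alpha> show "\<exists>\<epsilon> \<alpha> W. \<epsilon> > 0 \<and> unit_speed M {-\<epsilon><..<\<epsilon>} \<alpha> \<and>
      openin (rm_top M) W \<and> p \<in> W \<and> W \<subseteq> \<alpha> ` ball 0 (\<epsilon>/2)" by blast
  qed
  then obtain \<epsilon> \<alpha> W where \<alpha>: "\<And>p. p \<in> rm_points M \<Longrightarrow> \<epsilon> p > 0 \<and>
      unit_speed M {- \<epsilon> p<..<\<epsilon> p} (\<alpha> p) \<and>
      openin (rm_top M) (W p) \<and> p \<in> W p \<and> W p \<subseteq> \<alpha> p ` ball 0 (\<epsilon> p/2)"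
    by metis
  have "\<exists>\<F>. finite \<F> \<and> \<F> \<subseteq> W ` rm_points M \<and> rm_points M \<subseteq> \<Union>\<F>"
    by (rule compact[unfolded compact_space_alt, rule_format]) (use \<alpha> in blast)
  then obtain F where F: "finite F" "F \<subseteq> rm_points M" "rm_points M \<subseteq> \<Union>(W ` F)"
    by (metis finite_subset_image)
  define \<epsilon>0 where "\<epsilon>0 = Min (insert 1 ((\<lambda>p. \<epsilon> p/2) ` F))"
  have "\<epsilon>0 > 0" using F \<alpha> by (auto simp: \<epsilon>0_def)
  moreover have "\<exists>\<beta>. \<beta> 0 = q \<and> unit_speed M {-\<epsilon>0<..<\<epsilon>0} \<beta>" if q: "q \<in> rm_points M" for q
  proof -
    obtain p where p: "p \<in> F" "q \<in> W p" using F(3) q by blast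
    then have pM: "p \<in> rm_points M" using F(2) by blast
    then obtain s where s: "\<bar>s\<bar> < \<epsilon> p/2" "\<alpha> p s = q"
      using \<alpha>[OF pM] p(2) by (auto simp: dist_real_def)
    have "\<epsilon>0 \<le> \<epsilon> p/2" unfolding \<epsilon>0_def using F(1) p(1) by (intro Min_le) auto
    then have "unit_speed M {-\<epsilon>0<..<\<epsilon>0} (\<lambda>t. \<alpha> p (s + 1 * t))"
      using \<alpha>[OF pM] s(1) by (intro unit_speed_affine[of "{-\<epsilon> p<..<\<epsilon> p}"]) auto
    then show ?thesis using s(2) by (intro exI[of _ "\<lambda>t. \<alpha> p (s + 1 * t)"]) simp
  qed
  ultimately show ?thesis by blast
qed

text \<open>
  Start a curve of lifetime \<open>\<epsilon>\<close> at a time within \<open>\<epsilon>/2\<close> of the right end; after a reversal of time if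
  necessary it continues the given curve beyond that end by at least \<open>\<epsilon>/2\<close>.
\<close>

lemma unit_speed_extend_right:
  assumes \<epsilon>: "\<epsilon> > 0" "\<And>q. q \<in> rm_points M \<Longrightarrow> \<exists>\<beta>. \<beta> 0 = q \<and> unit_speed M {-\<epsilon><..<\<epsilon>} \<beta>"
    and \<gamma>: "unit_speed M {a<..<b} \<gamma>" and ab: "a < b"
  shows "\<exists>\<gamma>'. unit_speed M {a<..<b + \<epsilon>/2} \<gamma>' \<and> (\<forall>t\<in>{a<..<b}. \<gamma>' t = \<gamma> t)"
proof -
  define t1 where "t1 = max ((a + b)/2) (b - \<epsilon>/2)"
  have t1: "a < t1" "t1 < b" "b - \<epsilon>/2 \<le> t1"
    using ab \<epsilon>(1) by (auto simp: t1_def max_def field_simps)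
  then have t1': "t1 \<in> {a<..<b}" by simp
  obtain \<beta> where \<beta>: "\<beta> 0 = \<gamma> t1" "unit_speed M {-\<epsilon><..<\<epsilon>} \<beta>"
    using \<epsilon>(2) unit_speed_in_points[OF \<gamma> t1'] by blast
  obtain \<rho> where \<rho>: "\<bar>\<rho>\<bar> = 1" "\<forall>\<^sub>F x in nhds t1. \<gamma> x = \<beta> (0 - \<rho> * t1 + \<rho> * x)"
    using unit_speed_local_uniqueness[OF \<gamma> t1' \<beta>(2), of 0] \<epsilon>(1) \<beta>(1) by auto
  define \<delta> where "\<delta> x = \<beta> (0 - \<rho> * t1 + \<rho> * x)" for x
  have \<rho>': "\<rho> = 1 \<or> \<rho> = - 1" using \<rho>(1) by linarith
  have \<delta>: "unit_speed M {t1 - \<epsilon><..<t1 + \<epsilon>} \<delta>"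
    unfolding \<delta>_def using \<rho>' by (intro unit_speed_affine[OF \<beta>(2) \<rho>(1)]) auto
  have eq: "\<gamma> t = \<delta> t" if t: "t1 - \<epsilon> < t" "a < t" "t < b" for t
  proof (rule unit_speed_unique[where \<alpha> = \<gamma> and \<beta> = \<delta> and I = "{max a (t1 - \<epsilon>)<..<b}" and ?t0.0 = t1])
    show "unit_speed M {max a (t1 - \<epsilon>)<..<b} \<gamma>" by (rule unit_speed_subset[OF \<gamma>]) auto
    show "unit_speed M {max a (t1 - \<epsilon>)<..<b} \<delta>"
      by (rule unit_speed_subset[OF \<delta>]) (use t1 \<epsilon>(1) in auto)
  qed (use t t1 \<epsilon>(1) \<rho>(2) in \<open>auto simp: \<delta>_def\<close>)
  define \<gamma>' where "\<gamma>' t = (if t < b then \<gamma> t else \<delta> t)" for t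
  have "\<exists>c \<sigma>. unit_in_chart M c \<sigma> \<gamma>' t" if t: "t \<in> {a<..<b + \<epsilon>/2}" for t
  proof (cases "t < b")
    case True
    have "\<forall>\<^sub>F s in nhds t. s \<in> {..<b}" using True by (intro eventually_nhds_in_open) auto
    then have "\<forall>\<^sub>F s in nhds t. \<gamma> s = \<gamma>' s" by eventually_elim (simp add: \<gamma>'_def)
    then show ?thesis using unit_speed_cong[OF \<gamma>] t True by simp
  next
    case False
    have "\<forall>\<^sub>F s in nhds t. s \<in> {t1<..}" using False t1 by (intro eventually_nhds_in_open) auto
    then have "\<forall>\<^sub>F s in nhds t. \<delta> s = \<gamma>' s"
      by eventually_elim (use eq t1 \<epsilon>(1) in \<open>simp add: \<gamma>'_def\<close>)
    then show ?thesis using unit_speed_cong[OF \<delta>] t False t1 \<epsilon>(1) by simp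
  qed
  then show ?thesis unfolding unit_speed_def by (intro exI[of _ \<gamma>']) (auto simp: \<gamma>'_def)
qed

lemma unit_speed_extend_left:
  assumes \<epsilon>: "\<epsilon> > 0" "\<And>q. q \<in> rm_points M \<Longrightarrow> \<exists>\<beta>. \<beta> 0 = q \<and> unit_speed M {-\<epsilon><..<\<epsilon>} \<beta>"
    and \<gamma>: "unit_speed M {a<..<b} \<gamma>" and ab: "a < b"
  shows "\<exists>\<gamma>'. unit_speed M {a - \<epsilon>/2<..<b} \<gamma>' \<and> (\<forall>t\<in>{a<..<b}. \<gamma>' t = \<gamma> t)"
proof -
  have "unit_speed M {-b<..<-a} (\<lambda>t. \<gamma> (0 + -1 * t))"
    by (rule unit_speed_affine[OF \<gamma>]) auto
  from unit_speed_extend_right[OF \<epsilon> this] obtain \<delta> where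
    \<delta>: "unit_speed M {-b<..<-a + \<epsilon>/2} \<delta>" "\<forall>t\<in>{-b<..<-a}. \<delta> t = \<gamma> (0 + -1 * t)"
    using ab by auto
  have "unit_speed M {a - \<epsilon>/2<..<b} (\<lambda>t. \<delta> (0 + -1 * t))"
    by (rule unit_speed_affine[OF \<delta>(1)]) auto
  then show ?thesis using \<delta>(2) by (intro exI[of _ "\<lambda>t. \<delta> (0 + -1 * t)"]) auto
qed

text \<open>
  The prolongations to larger and larger intervals all agree with \<open>\<beta>\<close> near \<open>0\<close>, so by uniqueness they
  agree wherever two of them are defined and can be glued.
\<close>

lemma unit_speed_line: "\<exists>\<gamma>. unit_speed M UNIV \<gamma>"
proof -
  obtain \<epsilon> where \<epsilon>: "\<epsilon> > 0"
    "\<And>q. q \<in> rm_points M \<Longrightarrow> \<exists>\<beta>. \<beta> 0 = q \<and> unit_speed M {-\<epsilon><..<\<epsilon>} \<beta>"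
    using uniform_local_existence by blast
  obtain q where q: "q \<in> rm_points M" using nonempty by blast
  obtain \<beta> where \<beta>: "unit_speed M {-\<epsilon><..<\<epsilon>} \<beta>" using \<epsilon>(2)[OF q] by blast
  define T where "T n = \<epsilon> + real n * (\<epsilon>/2)" for n
  have T: "\<epsilon> \<le> T n" for n using \<epsilon>(1) by (simp add: T_def)
  have "\<exists>\<gamma>. unit_speed M {- T n<..<T n} \<gamma> \<and> (\<forall>t\<in>{-\<epsilon><..<\<epsilon>}. \<gamma> t = \<beta> t)" for n
  proof (induction n)
    case 0
    show ?case using \<beta> by (auto simp: T_def)
  next
    case (Suc n)
    then obtain \<gamma> where \<gamma>: "unit_speed M {- T n<..<T n} \<gamma>" "\<forall>t\<in>{-\<epsilon><..<\<epsilon>}. \<gamma> t = \<beta> t" by blast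
    obtain \<gamma>1 where \<gamma>1: "unit_speed M {- T n<..<T n + \<epsilon>/2} \<gamma>1" "\<forall>t\<in>{- T n<..<T n}. \<gamma>1 t = \<gamma> t"
      using unit_speed_extend_right[OF \<epsilon> \<gamma>(1)] T[of n] \<epsilon>(1) by auto
    obtain \<gamma>2 where \<gamma>2: "unit_speed M {- T n - \<epsilon>/2<..<T n + \<epsilon>/2} \<gamma>2"
      "\<forall>t\<in>{- T n<..<T n + \<epsilon>/2}. \<gamma>2 t = \<gamma>1 t"
      using unit_speed_extend_left[OF \<epsilon> \<gamma>1(1)] T[of n] \<epsilon>(1) by auto
    have "\<gamma>2 t = \<beta> t" if "t \<in> {-\<epsilon><..<\<epsilon>}" for t
      using that \<gamma>(2) \<gamma>1(2) \<gamma>2(2) T[of n] \<epsilon>(1) by auto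
    moreover have "T n + \<epsilon>/2 = T (Suc n)" by (simp add: T_def field_simps)
    then have "unit_speed M {- T (Suc n)<..<T (Suc n)} \<gamma>2"
      using \<gamma>2(1) by (metis minus_add_distrib uminus_add_conv_diff add.commute)
    ultimately show ?case by blast
  qed
  then obtain g where g: "\<And>n. unit_speed M {- T n<..<T n} (g n)"
    "\<And>n t. t \<in> {-\<epsilon><..<\<epsilon>} \<Longrightarrow> g n t = \<beta> t"
    by metis
  have mono: "T m \<le> T n" if "m \<le> n" for m n
    using that \<epsilon>(1) by (simp add: T_def)
  have agree: "g m t = g n t" if "\<bar>t\<bar> < T m" "\<bar>t\<bar> < T n" for m n t
  proof (rule unit_speed_unique[where \<alpha> = "g m" and \<beta> = "g n"
        and I = "{- min (T m) (T n)<..<min (T m) (T n)}" and ?t0.0 = 0])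
    show "unit_speed M {- min (T m) (T n)<..<min (T m) (T n)} (g m)"
      "unit_speed M {- min (T m) (T n)<..<min (T m) (T n)} (g n)"
      by (rule unit_speed_subset[OF g(1)]; auto)+
    have "\<forall>\<^sub>F s in nhds 0. s \<in> {-\<epsilon><..<\<epsilon>}" using \<epsilon>(1) by (intro eventually_nhds_in_open) auto
    then show "\<forall>\<^sub>F s in nhds 0. g m s = g n s" by eventually_elim (simp add: g(2))
    show "0 \<in> {- min (T m) (T n)<..<min (T m) (T n)}" using T[of m] T[of n] \<epsilon>(1) by auto
  qed (use that in auto)
  have "\<exists>n. \<bar>t\<bar> < T n" for t
  proof -
    obtain n where "real n * (\<epsilon>/2) > \<bar>t\<bar>" using reals_Archimedean3[of "\<epsilon>/2"] \<epsilon>(1) by auto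
    then show ?thesis using \<epsilon>(1) by (intro exI[of _ n]) (simp add: T_def)
  qed
  then obtain N where N: "\<And>t. \<bar>t\<bar> < T (N t)" by metis
  have "\<exists>c \<sigma>. unit_in_chart M c \<sigma> (\<lambda>t. g (N t) t) t" for t
  proof (rule unit_speed_cong[OF g(1)[of "N t"]])
    show "t \<in> {- T (N t)<..<T (N t)}" using N[of t] by (simp add: abs_less_iff)
    then have "\<forall>\<^sub>F s in nhds t. s \<in> {- T (N t)<..<T (N t)}" by (intro eventually_nhds_in_open) auto
    then show "\<forall>\<^sub>F s in nhds t. g (N t) s = g (N s) s"
      by eventually_elim (rule agree, use N in \<open>auto simp: abs_less_iff\<close>)
  qed
  then show ?thesis unfolding unit_speed_def by blast
qed

end

section \<open>Periodicity of the unit-speed line\<close>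

locale unit_speed_line = compact_riemannian_1 +
  fixes \<gamma> :: "real \<Rightarrow> 'a"
  assumes unit: "unit_speed M UNIV \<gamma>"
begin

lemma line_in_points [simp]: "\<gamma> t \<in> rm_points M"
  by (rule unit_speed_in_points[OF unit]) simp

lemma line_continuous: "continuous_map euclidean (rm_top M) \<gamma>"
proof -
  have "open {x. \<gamma> x \<in> V}" if V: "openin (rm_top M) V" for V
  proof (subst open_subopen, intro ballI)
    fix t assume "t \<in> {x. \<gamma> x \<in> V}"
    then have "\<forall>\<^sub>F s in nhds t. \<gamma> s \<in> V" using unit_speed_continuous[OF unit _ V] by simp
    then show "\<exists>T. open T \<and> t \<in> T \<and> T \<subseteq> {x. \<gamma> x \<in> V}"
      unfolding eventually_nhds by (metis mem_Collect_eq subsetI)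
  qed
  then show ?thesis by (simp add: continuous_map_def)
qed

lemma line_open: "open S \<Longrightarrow> openin (rm_top M) (\<gamma> ` S)"
proof (subst openin_subopen, intro ballI)
  fix p assume S: "open S" and "p \<in> \<gamma> ` S"
  then obtain t r where t: "t \<in> S" "p = \<gamma> t" and r: "r > 0" "ball t r \<subseteq> S"
    using open_contains_ball by (metis imageE)
  then obtain W where "openin (rm_top M) W" "p \<in> W" "W \<subseteq> \<gamma> ` ball t r"
    using unit_speed_open[OF unit _ r(1), of t] by auto
  then show "\<exists>T. openin (rm_top M) T \<and> p \<in> T \<and> T \<subseteq> \<gamma> ` S" using r(2) by blast
qed

text \<open>
  The local agreement of the two branches of \<open>\<gamma>\<close> is global by uniqueness.
\<close>

lemma line_symmetry:
  assumes "\<gamma> s = \<gamma> t"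
  obtains \<rho> where "\<bar>\<rho>\<bar> = 1" "\<And>x. \<gamma> x = \<gamma> (t - \<rho> * s + \<rho> * x)"
proof -
  obtain \<rho> where \<rho>: "\<bar>\<rho>\<bar> = 1" "\<forall>\<^sub>F x in nhds s. \<gamma> x = \<gamma> (t - \<rho> * s + \<rho> * x)"
    using unit_speed_local_uniqueness[OF unit _ unit _ assms] by auto
  have "\<gamma> x = \<gamma> (t - \<rho> * s + \<rho> * x)" for x
    by (rule unit_speed_unique[OF unit unit_speed_affine[OF unit \<rho>(1)] _ _ _ \<rho>(2)]) auto
  then show ?thesis using that \<rho>(1) by blast
qed

text \<open>
  If the branches at \<open>s\<close> and \<open>t\<close> ran in opposite directions, \<open>\<gamma>\<close> would be symmetric about the time
  \<open>(s + t)/2\<close> and so not injective near it.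
\<close>

lemma line_period:
  assumes "\<gamma> s = \<gamma> t"
  shows "\<gamma> (x + (t - s)) = \<gamma> x"
proof -
  obtain \<rho> where \<rho>: "\<bar>\<rho>\<bar> = 1" "\<And>x. \<gamma> x = \<gamma> (t - \<rho> * s + \<rho> * x)"
    using line_symmetry[OF assms] by blast
  have "\<rho> \<noteq> - 1"
  proof
    assume "\<rho> = - 1"
    then have refl: "\<gamma> x = \<gamma> (t + s - x)" for x using \<rho>(2)[of x] by simp
    define m where "m = (s + t)/2"
    obtain r where r: "r > 0" "inj_on \<gamma> (ball m r)" using unit_speed_locally_inj[OF unit] by blast
    have "t + s - (m + r/2) = m - r/2" by (simp add: m_def field_simps)
    then have "\<gamma> (m + r/2) = \<gamma> (m - r/2)" using refl[of "m + r/2"] by simp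
    then have "m + r/2 = m - r/2" by (rule inj_onD[OF r(2)]) (use r(1) in \<open>auto simp: dist_real_def\<close>)
    then show False using r(1) by simp
  qed
  then have "\<rho> = 1" using \<rho>(1) by linarith
  then show ?thesis using \<rho>(2)[of x] by (simp add: algebra_simps)
qed

text \<open>
  A curve through a point outside the range that came close enough to the range to meet it would
  be a piece of \<open>\<gamma>\<close> itself; so the range is closed, and it is open.
\<close>

lemma line_surj: "range \<gamma> = rm_points M"
proof -
  have "openin (rm_top M) (rm_points M - range \<gamma>)"
  proof (subst openin_subopen, intro ballI)
    fix q assume q: "q \<in> rm_points M - range \<gamma>"
    then obtain \<epsilon> \<beta> where \<beta>: "\<epsilon> > 0" "\<beta> 0 = q" "unit_speed M {-\<epsilon><..<\<epsilon>} \<beta>"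
      using local_existence[of q] by auto
    then obtain W where W: "openin (rm_top M) W" "q \<in> W" "W \<subseteq> \<beta> ` ball 0 \<epsilon>"
      using unit_speed_open[OF \<beta>(3), of 0 \<epsilon>] by auto
    have "\<gamma> t \<notin> W" for t
    proof
      assume "\<gamma> t \<in> W"
      then obtain s where "s \<in> ball 0 \<epsilon>" "\<gamma> t = \<beta> s" using W(3) by blast
      then have s: "s \<in> {-\<epsilon><..<\<epsilon>}" "\<beta> s = \<gamma> t" by (auto simp: dist_real_def)
      obtain \<rho> where \<rho>: "\<bar>\<rho>\<bar> = 1" "\<forall>\<^sub>F x in nhds s. \<beta> x = \<gamma> (t - \<rho> * s + \<rho> * x)"
        using unit_speed_local_uniqueness[OF \<beta>(3) s(1) unit _ s(2)] by auto
      have "\<beta> 0 = \<gamma> (t - \<rho> * s + \<rho> * 0)"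
        by (rule unit_speed_unique[OF \<beta>(3) unit_speed_affine[OF unit \<rho>(1)] _ _ s(1) \<rho>(2)])
          (use \<beta>(1) in auto)
      then show False using q \<beta>(2) by auto
    qed
    then have "W \<subseteq> rm_points M - range \<gamma>" using openin_subset[OF W(1)] by blast
    then show "\<exists>T. openin (rm_top M) T \<and> q \<in> T \<and> T \<subseteq> rm_points M - range \<gamma>" using W by blast
  qed
  moreover have "openin (rm_top M) (range \<gamma>)" using line_open[of UNIV] by simp
  moreover have "range \<gamma> \<subseteq> rm_points M" by auto
  ultimately have "rm_points M - range \<gamma> = {} \<or> range \<gamma> = {}"
    using connected unfolding connected_space_def by blast
  then show ?thesis by auto
qed

text \<open>
  By compactness \<open>\<gamma>\<close> covers \<open>M\<close> already on some \<open>(-m, m)\<close>, and \<open>\<gamma> m\<close> is one of the points covered.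
\<close>

lemma line_not_inj: "\<exists>s t. s < t \<and> \<gamma> s = \<gamma> t"
proof -
  let ?I = "\<lambda>n::nat. {- real n<..<real n}"
  have "\<exists>\<F>. finite \<F> \<and> \<F> \<subseteq> range (\<lambda>n. \<gamma> ` ?I n) \<and> rm_points M \<subseteq> \<Union>\<F>"
  proof (rule compact[unfolded compact_space_alt, rule_format], intro conjI)
    show "\<forall>U\<in>range (\<lambda>n. \<gamma> ` ?I n). openin (rm_top M) U" using line_open by auto
    show "rm_points M \<subseteq> \<Union>(range (\<lambda>n. \<gamma> ` ?I n))"
    proof
      fix p assume "p \<in> rm_points M"
      then obtain t where "p = \<gamma> t" using line_surj by blast
      moreover obtain n where "\<bar>t\<bar> < real n" using reals_Archimedean2 by blast
      then have "t \<in> ?I n" by auto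
      ultimately have "p \<in> \<gamma> ` ?I n" by (rule image_eqI)
      then show "p \<in> \<Union>(range (\<lambda>n. \<gamma> ` ?I n))" by (rule UN_I[OF UNIV_I])
    qed
  qed
  then obtain \<F> where \<F>: "finite \<F>" "\<F> \<subseteq> range (\<lambda>n. \<gamma> ` ?I n)" "rm_points M \<subseteq> \<Union>\<F>"
    by blast
  obtain N where "finite N" "\<F> = (\<lambda>n. \<gamma> ` ?I n) ` N"
    using finite_subset_image[OF \<F>(1,2)] by blast
  then have N: "finite N" "rm_points M \<subseteq> \<Union>((\<lambda>n. \<gamma> ` ?I n) ` N)" using \<F>(3) by simp_all
  define m where "m = Max (insert 0 N)"
  have "\<gamma> (real m) \<in> \<Union>((\<lambda>n. \<gamma> ` ?I n) ` N)" using N(2) line_in_points by blast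
  then obtain n s where n: "n \<in> N" "s \<in> ?I n" "\<gamma> (real m) = \<gamma> s" by blast
  have "n \<le> m" using N(1) n(1) by (simp add: m_def)
  then have "s < real m" using n(2) by auto
  then show ?thesis using n(3) by metis
qed

text \<open>
  Local injectivity at \<open>0\<close> keeps positive periods above some \<open>r\<close>, so two distinct periods differ by at
  least \<open>r\<close> and the infimum of the positive periods is attained.
\<close>

lemma least_period:
  obtains l where "l > 0" "\<And>s t. \<gamma> s = \<gamma> t \<longleftrightarrow> (\<exists>k::int. t = s + of_int k * l)"
proof -
  define P where "P = {p. p > 0 \<and> (\<forall>x. \<gamma> (x + p) = \<gamma> x)}"
  obtain r where r: "r > 0" "inj_on \<gamma> (ball 0 r)" using unit_speed_locally_inj[OF unit] by blast
  have ge: "r \<le> p" if "p \<in> P" for p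
  proof (rule ccontr)
    assume "\<not> r \<le> p"
    moreover have "p > 0" "\<gamma> (0 + p) = \<gamma> 0" using that unfolding P_def by blast+
    ultimately show False using inj_onD[OF r(2), of p 0] by (auto simp: dist_real_def)
  qed
  have diff: "p - q \<in> P" if "p \<in> P" "q \<in> P" "q < p" for p q
  proof -
    have q: "\<gamma> (x + q) = \<gamma> x" for x using that(2) by (simp add: P_def)
    have "\<gamma> (x + (p - q)) = \<gamma> x" for x
    proof -
      have "\<gamma> (x + (p - q)) = \<gamma> (x + (p - q) + q)" by (rule q[symmetric])
      also have "\<dots> = \<gamma> (x + p)" by simp
      also have "\<dots> = \<gamma> x" using that(1) by (simp add: P_def)
      finally show ?thesis .
    qed
    then show ?thesis using that(3) by (simp add: P_def)
  qed
  have period: "t - s \<in> P" if "\<gamma> s = \<gamma> t" "s < t" for s t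
    using line_period[OF that(1)] that(2) by (simp add: P_def)
  have "P \<noteq> {}" using line_not_inj period by blast
  have bdd: "bdd_below P" using ge by (meson bdd_belowI)
  define l where "l = Inf P"
  have le: "l \<le> p" if "p \<in> P" for p unfolding l_def by (rule cInf_lower[OF that bdd])
  have "l \<in> P"
  proof -
    obtain p where p: "p \<in> P" "p < l + r"
      using cInf_lessD[OF \<open>P \<noteq> {}\<close>, of "l + r"] r(1) by (auto simp: l_def)
    have "p = l"
    proof (rule ccontr)
      assume "p \<noteq> l"
      then obtain q where q: "q \<in> P" "q < p"
        using cInf_lessD[OF \<open>P \<noteq> {}\<close>, of p] le[OF p(1)] by (auto simp: l_def)
      show False using ge[OF diff[OF p(1) q]] le[OF q(1)] p(2) by linarith
    qed
    then show ?thesis using p by simp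
  qed
  have l: "l > 0" and shift: "\<gamma> (x + l) = \<gamma> x" for x using \<open>l \<in> P\<close> by (auto simp: P_def)
  have nat: "\<gamma> (x + real n * l) = \<gamma> x" for n x
  proof (induction n)
    case (Suc n)
    have "\<gamma> (x + real (Suc n) * l) = \<gamma> (x + real n * l + l)" by (simp add: algebra_simps)
    then show ?case using Suc shift by simp
  qed simp
  have int: "\<gamma> (x + of_int k * l) = \<gamma> x" for k :: int and x
  proof (cases "k \<ge> 0")
    case True
    then show ?thesis using nat[of x "nat k"] by simp
  next
    case False
    then show ?thesis using nat[of "x + of_int k * l" "nat (- k)"] by simp
  qed
  have "\<exists>k::int. t = s + of_int k * l" if "\<gamma> s = \<gamma> t" for s t
  proof -
    define k where "k = \<lfloor>(t - s)/l\<rfloor>"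
    have "of_int k \<le> (t - s)/l" "(t - s)/l < of_int k + 1" unfolding k_def by linarith+
    then have k: "s + of_int k * l \<le> t" "t - (s + of_int k * l) < l"
      using l by (simp_all add: field_simps)
    have "\<gamma> (s + of_int k * l) = \<gamma> t" using int that by simp
    then have "\<not> s + of_int k * l < t" using period le k(2) by force
    then show ?thesis using k(1) by force
  qed
  then show ?thesis using that[of l] l int by metis
qed

end

lemma (in compact_riemannian_1) unit_speed_circle:
  obtains \<gamma> l where "unit_speed M UNIV \<gamma>" "l > 0"
    "\<And>s t. \<gamma> s = \<gamma> t \<longleftrightarrow> (\<exists>k::int. t = s + of_int k * l)"
proof -
  obtain \<gamma> where \<gamma>: "unit_speed M UNIV \<gamma>" using unit_speed_line by blast
  interpret unit_speed_line M \<gamma> by unfold_locales (rule \<gamma>)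
  show ?thesis using least_period that \<gamma> by metis
qed

section \<open>The circle and the isometry\<close>

lemma circle_proj_eq_iff:
  "circle_proj l s = circle_proj l t \<longleftrightarrow> (\<exists>k::int. t = s + of_int k * l)"
proof
  assume "circle_proj l s = circle_proj l t"
  moreover have "t \<in> circle_proj l t" unfolding circle_proj_def by (auto intro!: exI[of _ 0])
  ultimately show "\<exists>k::int. t = s + of_int k * l" unfolding circle_proj_def by auto
next
  assume "\<exists>k::int. t = s + of_int k * l"
  then obtain k :: int where k: "t = s + of_int k * l" by blast
  have "\<exists>k'::int. s + of_int j * l = t + of_int k' * l" for j
    by (rule exI[of _ "j - k"]) (simp add: k algebra_simps)
  moreover have "\<exists>k'::int. t + of_int j * l = s + of_int k' * l" for j
    by (rule exI[of _ "j + k"]) (simp add: k algebra_simps)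
  ultimately show "circle_proj l s = circle_proj l t" unfolding circle_proj_def by blast
qed

lemma openin_circle:
  "openin (rm_top (circle l)) V \<longleftrightarrow> V \<subseteq> range (circle_proj l) \<and> open (circle_proj l -` V)"
proof -
  have "istopology (\<lambda>V. V \<subseteq> range (circle_proj l) \<and> open (circle_proj l -` V))"
    unfolding istopology_def by (auto simp: vimage_Int vimage_Union)
  then show ?thesis by (simp add: circle_def topology_inverse')
qed

lemma topspace_circle: "rm_points (circle l) = range (circle_proj l)"
proof
  show "rm_points (circle l) \<subseteq> range (circle_proj l)"
    using openin_circle[of l "rm_points (circle l)"] by simp
  show "range (circle_proj l) \<subseteq> rm_points (circle l)"
  proof (rule openin_subset)
    have "circle_proj l -` range (circle_proj l) = UNIV" by auto
    then show "openin (rm_top (circle l)) (range (circle_proj l))" by (simp add: openin_circle)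
  qed
qed

lemma inj_on_circle_proj:
  assumes l: "l > 0"
  shows "inj_on (circle_proj l) {a<..<a + l}"
proof (rule inj_onI)
  fix s t assume st: "s \<in> {a<..<a + l}" "t \<in> {a<..<a + l}" "circle_proj l s = circle_proj l t"
  then obtain k :: int where k: "t = s + of_int k * l" using circle_proj_eq_iff by blast
  have "a < s" "s < a + l" "a < t" "t < a + l" using st(1,2) by auto
  with k have "- 1 * l < of_int k * l" "of_int k * l < 1 * l" by linarith+
  then have "- 1 < (of_int k :: real)" "(of_int k :: real) < 1"
    using l by (simp_all only: mult_less_cancel_right_pos)
  then have "k = 0" by linarith
  then show "s = t" using k by simp
qed

context
  fixes l :: real
  assumes l: "l > 0"
begin

lemma circle_chart_proj [simp]:
  "t \<in> {a<..<a + l} \<Longrightarrow> snd (circle_chart l a) (circle_proj l t) = t"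
  using inj_on_circle_proj[OF l, of a] by (simp add: circle_chart_def)

lemma circle_chart_inv [simp]:
  assumes t: "t \<in> {a<..<a + l}"
  shows "chart_inv (circle_chart l a) t = circle_proj l t"
proof -
  have "inj_on (snd (circle_chart l a)) (fst (circle_chart l a))"
    by (auto simp: inj_on_def circle_chart_def inv_into_f_f[OF inj_on_circle_proj[OF l]])
  then have "inv_into (fst (circle_chart l a)) (snd (circle_chart l a))
      (snd (circle_chart l a) (circle_proj l t)) = circle_proj l t"
    by (rule inv_into_f_f) (use t in \<open>auto simp: circle_chart_def\<close>)
  then show ?thesis using t by (simp add: chart_inv_def)
qed

lemma openin_circle_chart: "openin (rm_top (circle l)) (fst (circle_chart l a))"
proof -
  have "circle_proj l -` circle_proj l ` {a<..<a + l} =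
      (\<Union>k::int. (\<lambda>t. t - of_int k * l) ` {a<..<a + l})" (is "?L = ?R")
  proof (intro equalityI subsetI)
    fix s assume "s \<in> ?L"
    then obtain t where t: "t \<in> {a<..<a + l}" "circle_proj l s = circle_proj l t" by auto
    then obtain k :: int where "t = s + of_int k * l" using circle_proj_eq_iff by blast
    then have "s = t - of_int k * l" by simp
    then show "s \<in> ?R" using t(1) by blast
  next
    fix s assume "s \<in> ?R"
    then obtain t and k :: int where t: "t \<in> {a<..<a + l}" "s = t - of_int k * l" by auto
    then have "t = s + of_int k * l" by simp
    then have "circle_proj l s = circle_proj l t" using circle_proj_eq_iff by blast
    then show "s \<in> ?L" using t(1) by auto
  qed
  also have "open \<dots>" by (auto intro!: open_translation_subtract)
  finally show ?thesis by (auto simp: openin_circle circle_chart_def)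
qed

end

locale unit_speed_circle = unit_speed_line +
  fixes l :: real
  assumes l_pos: "l > 0"
    and fibre: "\<And>s t. \<gamma> s = \<gamma> t \<longleftrightarrow> (\<exists>k::int. t = s + of_int k * l)"
begin

lemma fibre_proj: "\<gamma> s = \<gamma> t \<longleftrightarrow> circle_proj l s = circle_proj l t"
  by (simp add: fibre circle_proj_eq_iff)

definition to_circle :: "'a \<Rightarrow> real set" where
  "to_circle p = circle_proj l (SOME t. \<gamma> t = p)"

lemma to_circle_line [simp]: "to_circle (\<gamma> t) = circle_proj l t"
  unfolding to_circle_def fibre_proj[symmetric] by (rule someI[of "\<lambda>s. \<gamma> s = \<gamma> t"]) simp

lemma to_circle_bij: "bij_betw to_circle (rm_points M) (rm_points (circle l))"
  unfolding line_surj[symmetric] topspace_circle bij_betw_def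
  by (auto simp: inj_on_def fibre_proj image_image)

lemma from_circle [simp]: "inv_into (rm_points M) to_circle (circle_proj l t) = \<gamma> t"
  using to_circle_bij inv_into_f_f[of to_circle "rm_points M" "\<gamma> t"]
  by (simp add: bij_betw_def)

lemma to_circle_continuous: "continuous_map (rm_top M) (rm_top (circle l)) to_circle"
  unfolding continuous_map_def
proof (intro conjI allI impI)
  show "to_circle \<in> rm_points M \<rightarrow> rm_points (circle l)"
    using to_circle_bij by (auto simp: bij_betw_def)
  fix V assume V: "openin (rm_top (circle l)) V"
  have "{p \<in> rm_points M. to_circle p \<in> V} = \<gamma> ` (circle_proj l -` V)"
    unfolding line_surj[symmetric] by auto
  then show "openin (rm_top M) {p \<in> rm_points M. to_circle p \<in> V}"
    using V line_open by (simp add: openin_circle)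
qed

lemma from_circle_continuous:
  "continuous_map (rm_top (circle l)) (rm_top M) (inv_into (rm_points M) to_circle)"
  unfolding continuous_map_def
proof (intro conjI allI impI)
  show "inv_into (rm_points M) to_circle \<in> rm_points (circle l) \<rightarrow> rm_points M"
    by (auto simp: topspace_circle)
  fix V assume V: "openin (rm_top M) V"
  have "circle_proj l -` {P \<in> rm_points (circle l). inv_into (rm_points M) to_circle P \<in> V}
      = {t. \<gamma> t \<in> V}"
    by (auto simp: topspace_circle)
  moreover have "open {t. \<gamma> t \<in> V}" using line_continuous V by (simp add: continuous_map_def)
  ultimately show "openin (rm_top (circle l))
      {P \<in> rm_points (circle l). inv_into (rm_points M) to_circle P \<in> V}"
    by (auto simp: openin_circle topspace_circle)
qed

text \<open>
  Near \<open>p\<close> the coordinate on the circle is the time at which \<open>\<gamma>\<close> passes, which is arc length up to a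
  sign and a constant. This gives both the smoothness of \<open>to_circle\<close> and the isometry condition. The
  bound \<open>r\<close> keeps these times inside the interval \<open>(a, a + l)\<close> on which the chart is defined.
\<close>

lemma circle_coordinate_derivative:
  assumes c: "c \<in> rm_atlas M" and p: "p \<in> fst c" "to_circle p \<in> fst (circle_chart l a)"
  shows "\<exists>\<sigma>. \<bar>\<sigma>\<bar> = 1 \<and> (\<forall>\<^sub>F x in nhds (snd c p).
     ((snd (circle_chart l a) \<circ> to_circle \<circ> chart_inv c) has_real_derivative
        \<sigma> * arc_density M c x) (at x))"
proof -
  let ?T = "snd (circle_chart l a) \<circ> to_circle \<circ> chart_inv c"
  obtain t where t: "t \<in> {a<..<a + l}" "to_circle p = circle_proj l t"
    using p(2) by (auto simp: circle_chart_def)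
  then have "to_circle p = to_circle (\<gamma> t)" by simp
  then have pt: "p = \<gamma> t"
    using to_circle_bij chart_domain_subset[OF c] p(1) unfolding bij_betw_def
    by (metis inj_onD line_in_points subsetD)
  obtain d \<sigma>' where "unit_in_chart M d \<sigma>' \<gamma> t" using unit unfolding unit_speed_def by blast
  then obtain \<sigma> where \<sigma>: "unit_in_chart M c \<sigma> \<gamma> t"
    using unit_in_chart_change c p(1) pt by blast
  obtain J G where J: "open J" "snd c p \<in> J" "J \<subseteq> snd c ` fst c"
    and G: "\<And>x. x \<in> J \<Longrightarrow> (G has_real_derivative arc_density M c x) (at x)" "inj_on G J"
    using arc_length_coordinate[OF c p(1)] by metis
  define r where "r = min (t - a) (a + l - t)"
  have r: "r > 0" using t(1) by (auto simp: r_def)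
  obtain W where W: "openin (rm_top M) W" "\<gamma> t \<in> W" "W \<subseteq> fst c" "snd c ` W \<subseteq> J"
    "\<And>q. q \<in> W \<Longrightarrow> \<bar>G (snd c q) - G (snd c (\<gamma> t))\<bar> < r"
    "\<And>q. q \<in> W \<Longrightarrow> \<gamma> (t + \<sigma> * (G (snd c q) - G (snd c (\<gamma> t)))) = q"
    using unit_in_chart_coordinate[OF \<sigma> J(1) _ J(3) G r] J(2) pt by metis
  have ab: "\<bar>\<sigma>\<bar> = 1" using \<sigma> unit_in_chartD(2) by blast
  have T: "?T x = t + \<sigma> * (G x - G (snd c p))" if x: "x \<in> snd c ` W" for x
  proof -
    obtain q where q: "q \<in> W" "x = snd c q" using x by blast
    then have "chart_inv c x = q" using W(3) c by auto
    also have "q = \<gamma> (t + \<sigma> * (G x - G (snd c p)))" using W(6)[OF q(1)] q(2) pt by simp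
    finally have "?T x = snd (circle_chart l a) (circle_proj l (t + \<sigma> * (G x - G (snd c p))))"
      by simp
    moreover have "\<bar>\<sigma> * (G x - G (snd c p))\<bar> < r" using W(5)[OF q(1)] q(2) pt ab by (simp add: abs_mult)
    then have "t + \<sigma> * (G x - G (snd c p)) \<in> {a<..<a + l}" by (auto simp: r_def abs_less_iff)
    ultimately show ?thesis using circle_chart_proj[OF l_pos] by simp
  qed
  have op: "open (snd c ` W)" using chart_image_of_open[OF c W(1)] W(3) by (simp add: Int_absorb1)
  moreover have "snd c p \<in> snd c ` W" using W(2) pt by blast
  ultimately have "\<forall>\<^sub>F x in nhds (snd c p). x \<in> snd c ` W" by (rule eventually_nhds_in_open)
  then have "\<forall>\<^sub>F x in nhds (snd c p). (?T has_real_derivative \<sigma> * arc_density M c x) (at x)"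
  proof eventually_elim
    case (elim x)
    have "((\<lambda>x. t + \<sigma> * (G x - G (snd c p))) has_real_derivative \<sigma> * arc_density M c x) (at x)"
      using G(1)[of x] elim W(4) by (auto intro!: derivative_eq_intros)
    then show ?case
      by (rule has_field_derivative_transform_within_open[OF _ op elim]) (use T in auto)
  qed
  then show ?thesis using ab by blast
qed

theorem isometric_circle: "isometric M (circle l)"
  unfolding isometric_def riem_isometry_def
proof (intro exI[of _ to_circle] conjI ballI impI)
  show "bij_betw to_circle (rm_points M) (rm_points (circle l))" by (rule to_circle_bij)
  show "smooth_map M (circle l) to_circle"
    unfolding smooth_map_def
  proof (intro conjI ballI)
    show "continuous_map (rm_top M) (rm_top (circle l)) to_circle" by (rule to_circle_continuous)
    fix c d assume c: "c \<in> rm_atlas M" and "d \<in> rm_atlas (circle l)"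
    then obtain a where d: "d = circle_chart l a" by (auto simp: circle_def)
    let ?D = "{p \<in> fst c. to_circle p \<in> fst d}"
    have "openin (rm_top M) {p \<in> rm_points M. to_circle p \<in> fst d}"
      using to_circle_continuous openin_circle_chart[OF l_pos] d by (simp add: continuous_map_def)
    from chart_image_of_open[OF c this]
    have "open (snd c ` (fst c \<inter> {p \<in> rm_points M. to_circle p \<in> fst d}))" .
    moreover have "fst c \<inter> {p \<in> rm_points M. to_circle p \<in> fst d} = ?D"
      using chart_domain_subset[OF c] by auto
    ultimately have op: "open (snd c ` ?D)" by simp
    show "smooth_on (snd c ` ?D) (snd d \<circ> to_circle \<circ> chart_inv c)"
    proof (rule smooth_on_locally_primitive[OF op])
      obtain D where "\<forall>t\<in>snd c ` fst c. D 0 t = arc_density M c t"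
        "\<forall>n. \<forall>t\<in>snd c ` fst c. (D n has_vector_derivative D (Suc n) t) (at t)"
        using arc_density_smooth(1)[OF c] unfolding smooth_on_def by blast
      then show "smooth_on (snd c ` ?D) (arc_density M c)"
        unfolding smooth_on_def by (intro exI[of _ D]) auto
      fix x assume "x \<in> snd c ` ?D"
      then show "\<exists>\<sigma>. \<forall>\<^sub>F y in nhds x. ((snd d \<circ> to_circle \<circ> chart_inv c) has_real_derivative
          \<sigma> * arc_density M c y) (at y)"
        using circle_coordinate_derivative[OF c] d by blast
    qed
  qed
  show "smooth_map (circle l) M (inv_into (rm_points M) to_circle)"
    unfolding smooth_map_def
  proof (intro conjI ballI)
    show "continuous_map (rm_top (circle l)) (rm_top M) (inv_into (rm_points M) to_circle)"
      by (rule from_circle_continuous)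
    fix d c assume "d \<in> rm_atlas (circle l)" and c: "c \<in> rm_atlas M"
    then obtain a where d: "d = circle_chart l a" by (auto simp: circle_def)
    let ?D = "{P \<in> fst d. inv_into (rm_points M) to_circle P \<in> fst c}"
    define S where "S = {a<..<a + l} \<inter> {t. \<gamma> t \<in> fst c}"
    have "snd d ` ?D = snd d ` circle_proj l ` S"
      unfolding S_def d by (auto simp: circle_chart_def)
    also have "\<dots> = id ` S"
      unfolding image_image by (rule image_cong) (use l_pos in \<open>auto simp: S_def d\<close>)
    finally have S: "snd d ` ?D = S" by simp
    have op: "open S"
      using line_continuous chart_domain_open[OF c] by (auto simp: S_def continuous_map_def)
    have "smooth_on S (snd c \<circ> \<gamma>)"
    proof (rule smooth_on_autonomous_ode[OF op chart_image_open[OF c] arc_density_smooth(2)[OF c]])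
      show "(snd c \<circ> \<gamma>) ` S \<subseteq> snd c ` fst c" by (auto simp: S_def)
      fix t assume t: "t \<in> S"
      obtain e \<sigma>' where "unit_in_chart M e \<sigma>' \<gamma> t" using unit unfolding unit_speed_def by blast
      then obtain \<sigma> where "unit_in_chart M c \<sigma> \<gamma> t"
        using unit_in_chart_change[OF _ c, of e \<sigma>' \<gamma> t] t unfolding S_def by blast
      from unit_in_chartD(5)[OF this]
      have "\<forall>\<^sub>F s in nhds t. ((snd c \<circ> \<gamma>) has_real_derivative
          \<sigma> * (1 / arc_density M c ((snd c \<circ> \<gamma>) s))) (at s)"
        by eventually_elim simp
      then show "\<exists>\<sigma>. \<forall>\<^sub>F s in nhds t. ((snd c \<circ> \<gamma>) has_real_derivative
          \<sigma> * (1 / arc_density M c ((snd c \<circ> \<gamma>) s))) (at s)" by blast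
    qed
    then show "smooth_on (snd d ` ?D) (snd c \<circ> inv_into (rm_points M) to_circle \<circ> chart_inv d)"
      unfolding S by (rule smooth_on_cong) (auto simp: S_def d l_pos)
  qed
  fix c d p
  assume c: "c \<in> rm_atlas M" and "d \<in> rm_atlas (circle l)" and p: "p \<in> fst c" "to_circle p \<in> fst d"
  then obtain a where d: "d = circle_chart l a" by (auto simp: circle_def)
  obtain \<sigma> where \<sigma>: "\<bar>\<sigma>\<bar> = 1" "\<forall>\<^sub>F x in nhds (snd c p).
     ((snd d \<circ> to_circle \<circ> chart_inv c) has_real_derivative \<sigma> * arc_density M c x) (at x)"
    using circle_coordinate_derivative[OF c p(1)] p(2) d by blast
  have "deriv (snd d \<circ> to_circle \<circ> chart_inv c) (snd c p) = \<sigma> * arc_density M c (snd c p)"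
    using eventually_nhds_x_imp_x[OF \<sigma>(2)] by (rule DERIV_imp_deriv)
  moreover have "\<sigma>\<^sup>2 = 1" using \<sigma>(1) by (metis one_power2 power2_abs)
  moreover have "(arc_density M c (snd c p))\<^sup>2 = rm_metric M c p"
    using metric_pos[OF c p(1)] c p(1) by (simp add: arc_density_def)
  ultimately show "rm_metric M c p = rm_metric (circle l) d (to_circle p) *
      (deriv (snd d \<circ> to_circle \<circ> chart_inv c) (snd c p))\<^sup>2"
    by (simp add: power_mult_distrib circle_def)
qed

end

section \<open>The Riemannian volume\<close>

lemma cis_has_vector_derivative:
  "((\<lambda>t. cis (\<kappa> * t)) has_vector_derivative \<i> * of_real \<kappa> * cis (\<kappa> * t)) (at t within S)"
  unfolding has_vector_derivative_def
  by (auto intro!: derivative_eq_intros simp: scaleR_conv_of_real)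

context unit_speed_circle
begin

definition borel_points :: "'a measure" where
  "borel_points = sigma (rm_points M) {U. openin (rm_top M) U}"

definition line_volume :: "'a measure" where
  "line_volume = distr (restrict_space lborel {0..l}) borel_points \<gamma>"

lemma open_sets_subset: "{U. openin (rm_top M) U} \<subseteq> Pow (rm_points M)"
  using openin_subset by blast

lemma space_borel_points [simp]: "space borel_points = rm_points M"
  by (simp add: borel_points_def space_measure_of[OF open_sets_subset])

lemma sets_borel_points: "sets borel_points = sigma_sets (rm_points M) {U. openin (rm_top M) U}"
  by (simp add: borel_points_def sets_measure_of[OF open_sets_subset])

lemma open_in_borel_points: "openin (rm_top M) U \<Longrightarrow> U \<in> sets borel_points"
  by (auto simp: sets_borel_points)

lemma line_measurable: "\<gamma> \<in> borel \<rightarrow>\<^sub>M borel_points"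
  unfolding borel_points_def
proof (rule measurable_measure_of[OF open_sets_subset])
  fix U assume "U \<in> {U. openin (rm_top M) U}"
  then have "open {t. \<gamma> t \<in> U}" using line_continuous by (simp add: continuous_map_def)
  then show "\<gamma> -` U \<inter> space borel \<in> sets borel" by (simp add: vimage_def)
qed simp

lemma line_measurable_restrict: "\<gamma> \<in> restrict_space lborel {0..l} \<rightarrow>\<^sub>M borel_points"
  using line_measurable by (intro measurable_restrict_space1) simp

lemma space_line_volume [simp]: "space line_volume = rm_points M"
  and sets_line_volume [simp]: "sets line_volume = sets borel_points"
  by (simp_all add: line_volume_def)

lemma emeasure_line_volume:
  assumes B: "B \<in> sets borel_points"
  shows "emeasure line_volume B = emeasure lborel {t \<in> {0<..<l}. \<gamma> t \<in> B}"
proof -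
  have mes: "{t. \<gamma> t \<in> B} \<in> sets borel"
    using measurable_sets[OF line_measurable B] by (simp add: vimage_def)
  have "emeasure line_volume B = emeasure (restrict_space lborel {0..l}) (\<gamma> -` B \<inter> {0..l})"
    unfolding line_volume_def
    by (subst emeasure_distr[OF line_measurable_restrict]) (use B in \<open>auto simp: space_restrict_space\<close>)
  also have "\<dots> = emeasure lborel (\<gamma> -` B \<inter> {0..l})"
    by (rule emeasure_restrict_space) auto
  also have "\<dots> = emeasure lborel {t \<in> {0<..<l}. \<gamma> t \<in> B}"
  proof (rule emeasure_eq_AE)
    show "AE t in lborel. (t \<in> \<gamma> -` B \<inter> {0..l}) = (t \<in> {t \<in> {0<..<l}. \<gamma> t \<in> B})"
      using AE_lborel_singleton[of 0] AE_lborel_singleton[of l] by eventually_elim auto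
    have "\<gamma> -` B \<inter> {0..l} = {t. \<gamma> t \<in> B} \<inter> {0..l}"
      "{t \<in> {0<..<l}. \<gamma> t \<in> B} = {t. \<gamma> t \<in> B} \<inter> {0<..<l}" by auto
    then show "\<gamma> -` B \<inter> {0..l} \<in> sets lborel" "{t \<in> {0<..<l}. \<gamma> t \<in> B} \<in> sets lborel"
      using mes by (simp_all only: sets_lborel) auto
  qed
  finally show ?thesis .
qed

text \<open>
  Away from the single point \<open>\<gamma> 0\<close>, which is a null set on both sides, the coordinate \<open>x = \<phi> \<circ> \<gamma>\<close> maps
  the times in \<open>(0, l)\<close> at which \<open>\<gamma>\<close> is in \<open>B\<close> injectively onto \<open>\<phi> B\<close>. Since \<open>|x'| \<surd>g = 1\<close>, the change of
  variables formula turns the integral of \<open>\<surd>g\<close> over \<open>\<phi> B\<close> into the length of that set of times.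
\<close>

lemma line_volume_in_chart:
  assumes c: "c \<in> rm_atlas M" and B: "B \<in> sets borel_points" "B \<subseteq> fst c"
  shows "emeasure line_volume B =
    (\<integral>\<^sup>+t\<in>snd c ` B. ennreal (sqrt (rm_metric M c (chart_inv c t))) \<partial>lborel)"
proof -
  define S where "S = {t \<in> {0<..<l}. \<gamma> t \<in> B}"
  define x where "x = snd c \<circ> \<gamma>"
  let ?\<rho> = "arc_density M c"
  have "{t. \<gamma> t \<in> B} \<in> sets borel"
    using measurable_sets[OF line_measurable B(1)] by (simp add: vimage_def)
  moreover have "S = {t. \<gamma> t \<in> B} \<inter> {0<..<l}" by (auto simp: S_def)
  ultimately have S: "S \<in> sets borel" by simp
  have "S \<subseteq> {0..l}" by (auto simp: S_def)
  then have Sfin: "emeasure lborel S \<le> ennreal l"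
    using emeasure_mono[of S "{0..l}" lborel] l_pos by simp
  then have Slm: "S \<in> lmeasurable"
    using S by (intro fmeasurableI) (auto intro: le_less_trans)
  have "\<exists>v. (x has_real_derivative v) (at t within S) \<and> \<bar>v\<bar> * ?\<rho> (x t) = 1" if t: "t \<in> S" for t
  proof -
    have t': "\<gamma> t \<in> fst c" using t B(2) by (auto simp: S_def)
    obtain e \<sigma>' where "unit_in_chart M e \<sigma>' \<gamma> t" using unit unfolding unit_speed_def by blast
    then obtain \<sigma> where "unit_in_chart M c \<sigma> \<gamma> t" using unit_in_chart_change c t' by blast
    note \<sigma> = unit_in_chartD[OF this]
    have "?\<rho> (x t) > 0" using arc_density_pos[OF c] t' by (simp add: x_def)
    then have "\<bar>\<sigma> / ?\<rho> (x t)\<bar> * ?\<rho> (x t) = 1" using \<sigma>(2) by simp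
    moreover have "(x has_real_derivative \<sigma> / ?\<rho> (x t)) (at t within S)"
      using \<sigma>(4) unfolding x_def by (auto intro: has_field_derivative_at_within)
    ultimately show ?thesis by blast
  qed
  then obtain v where v: "\<And>t. t \<in> S \<Longrightarrow> (x has_real_derivative v t) (at t within S)"
    "\<And>t. t \<in> S \<Longrightarrow> \<bar>v t\<bar> * ?\<rho> (x t) = 1" by metis
  have inj: "inj_on x S"
  proof (rule inj_onI)
    fix s t assume st: "s \<in> S" "t \<in> S" "x s = x t"
    then have "\<gamma> s = \<gamma> t" using chart_inj[OF c] B(2) by (auto simp: S_def x_def inj_on_def)
    then have "circle_proj l s = circle_proj l t" by (simp add: fibre_proj)
    then show "s = t" using inj_onD[OF inj_on_circle_proj[OF l_pos, of 0]] st by (simp add: S_def)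
  qed
  have "(\<lambda>t. \<bar>v t\<bar> *\<^sub>R ?\<rho> (x t)) absolutely_integrable_on S \<longleftrightarrow>
      (\<lambda>t. 1 :: real) absolutely_integrable_on S"
    by (rule set_integrable_cong) (use v in auto)
  moreover have "(\<lambda>t. 1 :: real) absolutely_integrable_on S"
    using Slm by (intro absolutely_integrable_on_const)
  moreover have "integral S (\<lambda>t. \<bar>v t\<bar> *\<^sub>R ?\<rho> (x t)) = integral S (\<lambda>t. 1)"
    by (rule integral_cong) (use v in auto)
  moreover have "integral S (\<lambda>t. 1 :: real) = measure lebesgue S"
    using lmeasure_integral[OF Slm] by simp
  ultimately have cov: "?\<rho> absolutely_integrable_on x ` S" "integral (x ` S) ?\<rho> = measure lebesgue S"
    using has_absolute_integral_change_of_variables_real[of S x v ?\<rho> "measure lebesgue S"] S v(1) inj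
    by auto
  \<comment> \<open>every point other than \<open>\<gamma> 0\<close> is passed at a time in \<open>(0, l)\<close>\<close>
  have xS: "y \<in> x ` S \<longleftrightarrow> y \<in> snd c ` B" if "y \<noteq> snd c (\<gamma> 0)" for y
  proof
    assume "y \<in> snd c ` B"
    then obtain p where p: "p \<in> B" "y = snd c p" by blast
    then obtain s where s: "p = \<gamma> s" using line_surj B(2) chart_domain_subset[OF c] by blast
    define k where "k = \<lfloor>s / l\<rfloor>"
    have "of_int k \<le> s / l" "s / l < of_int k + 1" unfolding k_def by linarith+
    then have k: "0 \<le> s - of_int k * l" "s - of_int k * l < l"
      using l_pos by (simp_all add: field_simps)
    have "\<gamma> (s - of_int k * l) = \<gamma> s" unfolding fibre by (intro exI[of _ k]) simp
    moreover from this have "s - of_int k * l \<noteq> 0" using that p(2) s by auto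
    ultimately show "y \<in> x ` S"
      using k p s by (intro image_eqI[of _ _ "s - of_int k * l"]) (auto simp: x_def S_def)
  qed (auto simp: S_def x_def)
  have "(\<integral>\<^sup>+y\<in>snd c ` B. ennreal (sqrt (rm_metric M c (chart_inv c y))) \<partial>lborel)
      = (\<integral>\<^sup>+y. ennreal (indicator (x ` S) y *\<^sub>R ?\<rho> y) \<partial>lborel)"
  proof (rule nn_integral_cong_AE)
    show "AE y in lborel. ennreal (sqrt (rm_metric M c (chart_inv c y))) * indicator (snd c ` B) y
        = ennreal (indicator (x ` S) y *\<^sub>R ?\<rho> y)"
      using AE_lborel_singleton[of "snd c (\<gamma> 0)"]
    proof eventually_elim
      case (elim y)
      show ?case using xS[OF elim] by (simp add: arc_density_def indicator_def)
    qed
  qed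
  also have "\<dots> = (\<integral>\<^sup>+y. ennreal (indicator (x ` S) y *\<^sub>R ?\<rho> y) \<partial>lebesgue)"
    by (simp add: nn_integral_completion)
  also have "\<dots> = ennreal (LINT y|lebesgue. indicator (x ` S) y *\<^sub>R ?\<rho> y)"
  proof (rule nn_integral_eq_integral)
    show "integrable lebesgue (\<lambda>y. indicator (x ` S) y *\<^sub>R ?\<rho> y)"
      using cov(1) by (simp add: set_integrable_def)
    have "?\<rho> y > 0" if "y \<in> x ` S" for y
      using that B(2) arc_density_pos[OF c] by (auto simp: x_def S_def)
    then show "AE y in lebesgue. 0 \<le> indicator (x ` S) y *\<^sub>R ?\<rho> y"
      by (intro always_eventually) (auto simp: indicator_def less_imp_le)
  qed
  also have "\<dots> = ennreal (measure lebesgue S)"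
    using set_lebesgue_integral_eq_integral(2)[OF cov(1)] cov(2)
    by (simp add: set_lebesgue_integral_def)
  also have "\<dots> = emeasure lborel S"
    using Slm S emeasure_eq_measure2[of S lebesgue] by (simp add: fmeasurable_def)
  also have "\<dots> = emeasure line_volume B" using emeasure_line_volume[OF B(1)] by (simp add: S_def)
  finally show ?thesis by simp
qed

lemma finite_chart_cover: "\<exists>C. finite C \<and> C \<subseteq> rm_atlas M \<and> rm_points M \<subseteq> \<Union>(fst ` C)"
proof -
  have "\<exists>\<F>. finite \<F> \<and> \<F> \<subseteq> fst ` rm_atlas M \<and> rm_points M \<subseteq> \<Union>\<F>"
    by (rule compact[unfolded compact_space_alt, rule_format])
      (use chart_domain_open charts_cover in auto)
  then obtain \<F> where \<F>: "finite \<F>" "\<F> \<subseteq> fst ` rm_atlas M" "rm_points M \<subseteq> \<Union>\<F>" by blast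
  then obtain C where "finite C" "C \<subseteq> rm_atlas M" "\<F> = fst ` C"
    using finite_subset_image[OF \<F>(1,2)] by blast
  then show ?thesis using \<F>(3) by blast
qed

text \<open>
  A measure is determined by its values on the Borel subsets of chart domains: cut a Borel set along a
  finite cover by such domains.
\<close>

lemma riem_borel_volume_eq: "riem_borel_volume M = line_volume"
  unfolding riem_borel_volume_def
proof (rule the_equality)
  show "space line_volume = rm_points M \<and>
    sets line_volume = sigma_sets (rm_points M) {U. openin (rm_top M) U} \<and>
    (\<forall>c\<in>rm_atlas M. \<forall>B\<in>sets line_volume. B \<subseteq> fst c \<longrightarrow> emeasure line_volume B =
      (\<integral>\<^sup>+t\<in>snd c ` B. ennreal (sqrt (rm_metric M c (chart_inv c t))) \<partial>lborel))"
    using line_volume_in_chart by (simp add: sets_borel_points)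
next
  fix \<nu> assume \<nu>: "space \<nu> = rm_points M \<and>
    sets \<nu> = sigma_sets (rm_points M) {U. openin (rm_top M) U} \<and>
    (\<forall>c\<in>rm_atlas M. \<forall>B\<in>sets \<nu>. B \<subseteq> fst c \<longrightarrow> emeasure \<nu> B =
      (\<integral>\<^sup>+t\<in>snd c ` B. ennreal (sqrt (rm_metric M c (chart_inv c t))) \<partial>lborel))"
  then have sets: "sets \<nu> = sets borel_points" by (simp add: sets_borel_points)
  have eq: "emeasure \<nu> B = emeasure line_volume B"
    if "finite C" "C \<subseteq> rm_atlas M" "B \<in> sets borel_points" "B \<subseteq> \<Union>(fst ` C)" for C B
    using that
  proof (induction C arbitrary: B rule: finite_induct)
    case (insert c C)
    have c: "c \<in> rm_atlas M" using insert.prems by blast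
    then have fc: "fst c \<in> sets borel_points" using open_in_borel_points chart_domain_open by blast
    have B: "B \<inter> fst c \<in> sets borel_points" "B - fst c \<in> sets borel_points"
      using insert.prems(2) fc by auto
    have split: "B = (B \<inter> fst c) \<union> (B - fst c)" by blast
    have "emeasure \<nu> B = emeasure \<nu> (B \<inter> fst c) + emeasure \<nu> (B - fst c)"
      by (subst split, rule plus_emeasure[symmetric]) (use B sets in auto)
    also have "emeasure \<nu> (B \<inter> fst c) = emeasure line_volume (B \<inter> fst c)"
    proof -
      have "B \<inter> fst c \<in> sets \<nu>" "B \<inter> fst c \<subseteq> fst c" using B(1) sets by auto
      then show ?thesis using \<nu> c line_volume_in_chart[OF c B(1)] by simp
    qed
    also have "emeasure \<nu> (B - fst c) = emeasure line_volume (B - fst c)"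
      by (rule insert.IH) (use insert.prems B in auto)
    also have "emeasure line_volume (B \<inter> fst c) + emeasure line_volume (B - fst c)
        = emeasure line_volume B"
      by (subst (3) split, rule plus_emeasure) (use B in auto)
    finally show ?case .
  qed simp
  show "\<nu> = line_volume"
  proof (rule measure_eqI)
    show "sets \<nu> = sets line_volume" using sets by simp
    fix B assume "B \<in> sets \<nu>"
    then have B: "B \<in> sets borel_points" using sets by simp
    obtain C where C: "finite C" "C \<subseteq> rm_atlas M" "rm_points M \<subseteq> \<Union>(fst ` C)"
      using finite_chart_cover by metis
    have "B \<subseteq> rm_points M" using sets.sets_into_space[OF B] by simp
    then have "B \<subseteq> \<Union>(fst ` C)" using C(3) by (rule subset_trans)
    then show "emeasure \<nu> B = emeasure line_volume B" by (rule eq[OF C(1,2) B])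
  qed
qed

lemma emeasure_line_volume_space: "emeasure line_volume (rm_points M) = ennreal l"
proof -
  have "rm_points M \<in> sets borel_points" using sets.top[of borel_points] by simp
  moreover have "{t \<in> {0<..<l}. \<gamma> t \<in> rm_points M} = {0<..<l}" by auto
  ultimately show ?thesis using emeasure_line_volume l_pos by simp
qed

lemma riem_volume_eq: "riem_volume M = completion line_volume"
  by (simp add: riem_volume_def riem_borel_volume_eq)

lemma space_riem_volume [simp]: "space (riem_volume M) = rm_points M"
  by (simp add: riem_volume_eq)

lemma finite_measure_riem_volume: "finite_measure (riem_volume M)"
proof (rule finite_measureI)
  have "rm_points M \<in> sets line_volume" using sets.top[of line_volume] by simp
  then show "emeasure (riem_volume M) (space (riem_volume M)) \<noteq> \<infinity>"
    by (simp add: riem_volume_eq emeasure_line_volume_space)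
qed

lemma measure_riem_volume: "measure (riem_volume M) (rm_points M) = l"
proof -
  have "rm_points M \<in> sets line_volume" using sets.top[of line_volume] by simp
  then show ?thesis
    using l_pos by (simp add: riem_volume_eq measure_def emeasure_line_volume_space)
qed

section \<open>Waves on the circle\<close>

text \<open>
  The wave \<open>e\<^sup>i\<^sup>\<kappa>\<^sup>t\<close> carried over to \<open>M\<close>. The time is chosen arbitrarily in the fibre of \<open>\<gamma>\<close>, so
  that the multiplicative laws hold for all \<open>\<kappa>\<close>; the choice does not matter when \<open>e\<^sup>i\<^sup>\<kappa>\<^sup>l = 1\<close>.
\<close>

definition wave :: "real \<Rightarrow> 'a \<Rightarrow> complex" where
  "wave \<kappa> p = cis (\<kappa> * (SOME t. \<gamma> t = p))"

lemma cis_of_int_period: "cis (\<kappa> * l) = 1 \<Longrightarrow> cis (\<kappa> * (of_int k * l)) = 1"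
proof -
  assume "cis (\<kappa> * l) = 1"
  then have "cis (\<kappa> * l) powi k = 1" by simp
  then show ?thesis by (simp add: cis_power_int algebra_simps)
qed

lemma wave_line:
  assumes "cis (\<kappa> * l) = 1"
  shows "wave \<kappa> (\<gamma> t) = cis (\<kappa> * t)"
proof -
  have "\<gamma> (SOME s. \<gamma> s = \<gamma> t) = \<gamma> t" by (rule someI) simp
  then obtain k :: int where "t = (SOME s. \<gamma> s = \<gamma> t) + of_int k * l" using fibre by blast
  then have "cis (\<kappa> * t) = cis (\<kappa> * (SOME s. \<gamma> s = \<gamma> t)) * cis (\<kappa> * (of_int k * l))"
    unfolding cis_mult by (simp flip: distrib_left)
  then show ?thesis using cis_of_int_period[OF assms] by (simp add: wave_def)
qed

lemma wave_mult: "wave \<kappa> p * wave \<kappa>' p = wave (\<kappa> + \<kappa>') p"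
  by (simp add: wave_def cis_mult algebra_simps)

lemma cnj_wave: "cnj (wave \<kappa> p) = wave (- \<kappa>) p"
  by (simp add: wave_def cis_cnj)

lemma norm_wave [simp]: "cmod (wave \<kappa> p) = 1"
  by (simp add: wave_def)

lemma wave_measurable_line:
  assumes "cis (\<kappa> * l) = 1"
  shows "wave \<kappa> \<in> borel_measurable line_volume"
proof (rule borel_measurableI)
  fix S :: "complex set" assume S: "open S"
  have "open ((\<lambda>t. cis (\<kappa> * t)) -` S)"
    by (intro open_vimage S continuous_intros)
  then have "openin (rm_top M) (\<gamma> ` ((\<lambda>t. cis (\<kappa> * t)) -` S))" by (rule line_open)
  moreover have "wave \<kappa> -` S \<inter> space line_volume = \<gamma> ` ((\<lambda>t. cis (\<kappa> * t)) -` S)"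
    unfolding space_line_volume line_surj[symmetric] using wave_line[OF assms] by auto
  ultimately show "wave \<kappa> -` S \<inter> space line_volume \<in> sets line_volume"
    using open_in_borel_points by simp
qed

lemma wave_measurable:
  "cis (\<kappa> * l) = 1 \<Longrightarrow> wave \<kappa> \<in> borel_measurable (riem_volume M)"
  unfolding riem_volume_eq by (intro measurable_completion wave_measurable_line)

lemma wave_integral:
  assumes "cis (\<kappa> * l) = 1"
  shows "(LINT p|riem_volume M. wave \<kappa> p) = (if \<kappa> = 0 then of_real l else 0)"
proof -
  have "(LINT p|riem_volume M. wave \<kappa> p) = (LINT p|line_volume. wave \<kappa> p)"
    unfolding riem_volume_eq using wave_measurable_line[OF assms] by (rule integral_completion)
  also have "\<dots> = (LINT t|restrict_space lborel {0..l}. wave \<kappa> (\<gamma> t))"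
    using wave_measurable_line[OF assms] unfolding line_volume_def
    by (intro integral_distr line_measurable_restrict) simp
  also have "\<dots> = (LINT t|restrict_space lborel {0..l}. cis (\<kappa> * t))"
    by (simp add: wave_line[OF assms])
  also have "\<dots> = (LINT t|lborel. indicator {0..l} t *\<^sub>R cis (\<kappa> * t))"
    by (subst integral_restrict_space) (auto simp: set_lebesgue_integral_def)
  also have "\<dots> = (if \<kappa> = 0 then of_real l else 0)"
  proof (cases "\<kappa> = 0")
    case True
    then show ?thesis using l_pos by (simp add: scaleR_conv_of_real)
  next
    case False
    let ?F = "\<lambda>t. cis (\<kappa> * t) / (\<i> * of_real \<kappa>)"
    have "has_bochner_integral lborel (\<lambda>t. indicator {0..l} t *\<^sub>R cis (\<kappa> * t)) (?F l - ?F 0)"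
    proof (rule has_bochner_integral_FTC_Icc)
      fix t
      show "(?F has_vector_derivative cis (\<kappa> * t)) (at t within {0..l})"
        using has_vector_derivative_divide[OF cis_has_vector_derivative[of \<kappa> t "{0..l}"],
            of "\<i> * of_real \<kappa>"] False
        by simp
    qed (use l_pos in \<open>auto intro!: continuous_intros\<close>)
    then show ?thesis using False assms by (simp add: has_bochner_integral_iff)
  qed
  finally show ?thesis .
qed

end

section \<open>Eigenfunctions along the line\<close>

lemma constant_of_zero_vector_derivative:
  fixes f :: "real \<Rightarrow> 'b::real_normed_vector"
  assumes "\<And>t. (f has_vector_derivative 0) (at t)"
  shows "f s = f t"
proof -
  have "\<exists>c. \<forall>t\<in>UNIV. f t = c"
    by (rule has_vector_derivative_zero_constant[OF convex_UNIV]) (use assms in auto)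
  then show ?thesis by auto
qed

text \<open>
  For \<open>\<kappa> = \<mu>\<close> and \<open>\<kappa> = -\<mu>\<close> the factorization \<open>d\<^sup>2/dt\<^sup>2 + \<mu>\<^sup>2 = (d/dt - i \<kappa>) (d/dt + i \<kappa>)\<close> shows that
  \<open>w' + i \<kappa> w\<close> is a multiple of \<open>e\<^sup>i\<^sup>\<kappa>\<^sup>t\<close>; the two multiples determine \<open>w\<close>.
\<close>

lemma harmonic_oscillator_solution:
  fixes w w' :: "real \<Rightarrow> complex"
  assumes w: "\<And>t. (w has_vector_derivative w' t) (at t)"
    and w': "\<And>t. (w' has_vector_derivative - (of_real \<mu>)\<^sup>2 * w t) (at t)"
    and \<mu>: "\<mu> \<noteq> 0"
  shows "\<exists>a b. \<forall>t. w t = a * cis (\<mu> * t) + b * cis (- \<mu> * t)"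
proof -
  have const: "(w' t + \<i> * of_real \<kappa> * w t) * cis (- \<kappa> * t) = w' 0 + \<i> * of_real \<kappa> * w 0"
    if \<kappa>: "\<kappa>\<^sup>2 = \<mu>\<^sup>2" for \<kappa> t
  proof -
    have sq: "(of_real \<mu> :: complex)\<^sup>2 = of_real \<kappa> * of_real \<kappa>"
      using \<kappa> by (metis of_real_mult of_real_power power2_eq_square)
    have "((\<lambda>t. (w' t + \<i> * of_real \<kappa> * w t) * cis (- \<kappa> * t)) has_vector_derivative
        (w' t + \<i> * of_real \<kappa> * w t) * (\<i> * of_real (- \<kappa>) * cis (- \<kappa> * t)) +
        (- (of_real \<mu>)\<^sup>2 * w t + \<i> * of_real \<kappa> * w' t) * cis (- \<kappa> * t)) (at t)" for t
      by (intro has_vector_derivative_mult has_vector_derivative_add w w'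
          has_vector_derivative_mult_right cis_has_vector_derivative)
    moreover have "(w' t + \<i> * of_real \<kappa> * w t) * (\<i> * of_real (- \<kappa>) * cis (- \<kappa> * t)) +
        (- (of_real \<mu>)\<^sup>2 * w t + \<i> * of_real \<kappa> * w' t) * cis (- \<kappa> * t) = 0" for t
      unfolding sq by (simp add: algebra_simps)
    ultimately have "((\<lambda>t. (w' t + \<i> * of_real \<kappa> * w t) * cis (- \<kappa> * t)) has_vector_derivative 0) (at t)"
      for t by metis
    from constant_of_zero_vector_derivative[OF this, of t 0] show ?thesis by simp
  qed
  define A B where "A = w' 0 + \<i> * of_real \<mu> * w 0" and "B = w' 0 + \<i> * of_real (- \<mu>) * w 0"
  have "w t = (A / (2 * \<i> * of_real \<mu>)) * cis (\<mu> * t) + (- B / (2 * \<i> * of_real \<mu>)) * cis (- \<mu> * t)"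
    for t
  proof -
    have cancel: "z = k * cis (\<kappa> * t)" if "z * cis (- \<kappa> * t) = k" for z k \<kappa>
      unfolding that[symmetric] mult.assoc by (simp add: cis_mult)
    have 1: "w' t + \<i> * of_real \<mu> * w t = A * cis (\<mu> * t)"
      using cancel[OF const[of \<mu> t]] by (simp add: A_def)
    have 2: "w' t + \<i> * of_real (- \<mu>) * w t = B * cis (- \<mu> * t)"
      using cancel[OF const[of "- \<mu>" t]] by (simp add: B_def)
    have "2 * \<i> * of_real \<mu> * w t = A * cis (\<mu> * t) - B * cis (- \<mu> * t)"
      unfolding 1[symmetric] 2[symmetric] by (simp add: algebra_simps)
    then show ?thesis using \<mu> by (simp add: field_simps)
  qed
  then show ?thesis by blast
qed

context unit_speed_circle
begin

text \<open>
  Since time is arc length, \<open>d/dt = \<sigma> g\<^sup>-\<^sup>1\<^sup>/\<^sup>2 d/dx\<close> along \<open>\<gamma>\<close>. Applying it twice gives the coordinate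
  formula of the Laplace-Beltrami operator, with the factor \<open>\<sigma>\<^sup>2 = 1\<close>. The chart has to be the one
  singled out in the definition of \<open>laplace_beltrami\<close>.
\<close>

lemma eigenfunction_along_line:
  assumes u: "laplace_eigenfunction M \<mu> u"
  defines "w' \<equiv> \<lambda>t. vector_derivative (u \<circ> \<gamma>) (at t)"
  shows "((u \<circ> \<gamma>) has_vector_derivative w' t) (at t)"
    and "(w' has_vector_derivative - (of_real \<mu>)\<^sup>2 * (u \<circ> \<gamma>) t) (at t)"
proof -
  define c where "c = (SOME c. c \<in> rm_atlas M \<and> \<gamma> t \<in> fst c)"
  have "\<exists>c. c \<in> rm_atlas M \<and> \<gamma> t \<in> fst c" using charts_cover line_in_points[of t] by blast
  then have c: "c \<in> rm_atlas M" "\<gamma> t \<in> fst c" unfolding c_def by (metis (mono_tags, lifting) someI_ex)+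
  obtain e \<sigma>' where "unit_in_chart M e \<sigma>' \<gamma> t" using unit unfolding unit_speed_def by blast
  then obtain \<sigma> where "unit_in_chart M c \<sigma> \<gamma> t" using unit_in_chart_change c by blast
  note \<sigma> = unit_in_chartD[OF this]
  define R x \<rho> U where "R = snd c ` fst c" and "x = snd c \<circ> \<gamma>" and "\<rho> = arc_density M c"
    and "U = u \<circ> chart_inv c"
  have R: "open R" using chart_image_open[OF c(1)] by (simp add: R_def)
  have x0: "x t \<in> R" using c by (simp add: R_def x_def)
  have "smooth_on R U" using u c(1) by (auto simp: laplace_eigenfunction_def smooth_function_def R_def U_def)
  then obtain D where D: "\<And>y. y \<in> R \<Longrightarrow> D 0 y = U y"
    "\<And>n y. y \<in> R \<Longrightarrow> (D n has_vector_derivative D (Suc n) y) (at y)"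
    unfolding smooth_on_def by blast
  have U: "(U has_vector_derivative D 1 y) (at y)" if "y \<in> R" for y
    using D(2)[OF that, of 0] has_vector_derivative_cong_on_open[OF R that D(1)] by simp
  have pos: "\<rho> y > 0" if "y \<in> R" for y using that arc_density_pos[OF c(1)] by (simp add: R_def \<rho>_def)
  \<comment> \<open>the expression \<open>g\<^sup>1\<^sup>/\<^sup>2 g\<^sup>-\<^sup>1 du/dx = g\<^sup>-\<^sup>1\<^sup>/\<^sup>2 du/dx\<close> inside the coordinate formula\<close>
  define K where "K y = (1 / \<rho> y) *\<^sub>R D 1 y" for y
  obtain r where r: "((\<lambda>y. 1 / \<rho> y) has_real_derivative r) (at (x t))"
    using smooth_on_first_derivative(1)[OF R, of "\<lambda>y. 1 / \<rho> y" "x t"] arc_density_smooth(2)[OF c(1)] x0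
    by (auto simp: R_def \<rho>_def)
  define Kd where "Kd = (1 / \<rho> (x t)) *\<^sub>R D 2 (x t) + r *\<^sub>R D 1 (x t)"
  have K: "(K has_vector_derivative Kd) (at (x t))"
    unfolding K_def Kd_def
    using has_vector_derivative_scaleR[OF r D(2)[OF x0, of 1]] by (simp add: numeral_2_eq_2)
  have lap: "laplace_beltrami M u (\<gamma> t) = (1 / \<rho> (x t)) *\<^sub>R Kd"
  proof -
    let ?G = "rm_metric M c \<circ> chart_inv c"
    have "(sqrt (?G y) * (1 / ?G y)) *\<^sub>R vector_derivative U (at y) = K y" if y: "y \<in> R" for y
    proof -
      have "?G y = \<rho> y * \<rho> y"
        using metric_pos[OF c(1)] y c(1) by (auto simp: \<rho>_def arc_density_def R_def less_imp_le)
      moreover have "sqrt (?G y) = \<rho> y" by (simp add: \<rho>_def arc_density_def)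
      ultimately show ?thesis using pos[OF y] vector_derivative_at[OF U[OF y]] by (simp add: K_def)
    qed
    then have "vector_derivative (\<lambda>y. (sqrt (?G y) * (1 / ?G y)) *\<^sub>R vector_derivative U (at y)) (at (x t))
        = vector_derivative K (at (x t))"
      by (rule vector_derivative_cong_on_open[OF R x0])
    also have "\<dots> = Kd" by (rule vector_derivative_at[OF K])
    finally show ?thesis
      unfolding laplace_beltrami_def c_def[symmetric] laplace_in_chart_def Let_def
      by (simp add: U_def[symmetric] x_def \<rho>_def arc_density_def)
  qed
  have ev: "\<forall>\<^sub>F s in nhds t. x s \<in> R \<and> ((u \<circ> \<gamma>) has_vector_derivative \<sigma> *\<^sub>R K (x s)) (at s)"
  proof -
    have "\<forall>\<^sub>F s in nhds t. \<forall>\<^sub>F s' in nhds s. \<gamma> s' \<in> fst c"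
      using eventually_mono[OF \<sigma>(5)] by (simp add: eventually_eventually)
    with \<sigma>(5) show ?thesis
    proof eventually_elim
      case (elim s)
      then have xs: "x s \<in> R" by (simp add: R_def x_def)
      have "(x has_vector_derivative \<sigma> / \<rho> (x s)) (at s)"
        using elim(1) by (simp add: x_def \<rho>_def has_real_derivative_iff_has_vector_derivative)
      from vector_diff_chain_at[OF this U[OF xs]]
      have "((U \<circ> x) has_vector_derivative \<sigma> *\<^sub>R K (x s)) (at s)" by (simp add: K_def)
      moreover have "\<forall>\<^sub>F s' in nhds s. s' \<in> UNIV \<longrightarrow> (U \<circ> x) s' = (u \<circ> \<gamma>) s'"
        using elim(2) by eventually_elim (simp add: U_def x_def c(1))
      moreover have "(U \<circ> x) s = (u \<circ> \<gamma>) s" using elim(1) by (simp add: U_def x_def c(1))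
      ultimately show ?case using xs has_vector_derivative_cong_ev by metis
    qed
  qed
  then have w': "\<forall>\<^sub>F s in nhds t. \<sigma> *\<^sub>R K (x s) = w' s"
    unfolding w'_def by eventually_elim (metis vector_derivative_at)
  show "((u \<circ> \<gamma>) has_vector_derivative w' t) (at t)"
    using eventually_nhds_x_imp_x[OF ev] eventually_nhds_x_imp_x[OF w'] by simp
  have "(x has_vector_derivative \<sigma> / \<rho> (x t)) (at t)"
    using \<sigma>(4) by (simp add: x_def \<rho>_def has_real_derivative_iff_has_vector_derivative)
  from bounded_linear.has_vector_derivative[OF bounded_linear_scaleR_right vector_diff_chain_at[OF this K]]
  have "((\<lambda>s. \<sigma> *\<^sub>R (K \<circ> x) s) has_vector_derivative \<sigma> *\<^sub>R (\<sigma> / \<rho> (x t)) *\<^sub>R Kd) (at t)" .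
  moreover have "\<sigma> * \<sigma> = 1" using \<sigma>(2) by (metis abs_mult_self_eq mult_1)
  then have "\<sigma> *\<^sub>R (\<sigma> / \<rho> (x t)) *\<^sub>R Kd = (1 / \<rho> (x t)) *\<^sub>R Kd" by simp
  moreover have "(1 / \<rho> (x t)) *\<^sub>R Kd = - (of_real \<mu>)\<^sup>2 * (u \<circ> \<gamma>) t"
    using u line_in_points[of t] unfolding laplace_eigenfunction_def lap[symmetric]
    by (metis (no_types, lifting) comp_apply minus_minus mult_minus_left)
  ultimately have "((\<lambda>s. \<sigma> *\<^sub>R (K \<circ> x) s) has_vector_derivative - (of_real \<mu>)\<^sup>2 * (u \<circ> \<gamma>) t) (at t)"
    by simp
  moreover have "\<forall>\<^sub>F s in nhds t. s \<in> UNIV \<longrightarrow> \<sigma> *\<^sub>R (K \<circ> x) s = w' s"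
    using w' by eventually_elim simp
  moreover have "\<sigma> *\<^sub>R (K \<circ> x) t = w' t" using eventually_nhds_x_imp_x[OF w'] by simp
  ultimately show "(w' has_vector_derivative - (of_real \<mu>)\<^sup>2 * (u \<circ> \<gamma>) t) (at t)"
    using has_vector_derivative_cong_ev by metis
qed

lemma line_periodic: "\<gamma> (t + l) = \<gamma> t"
proof -
  have "\<gamma> t = \<gamma> (t + l)" unfolding fibre by (rule exI[of _ 1]) simp
  then show ?thesis by simp
qed

text \<open>
  Periodicity forces \<open>a (e\<^sup>i\<^sup>\<mu>\<^sup>l - 1) = b (e\<^sup>-\<^sup>i\<^sup>\<mu>\<^sup>l - 1) = 0\<close> by linear independence of the two waves. For
  \<open>\<mu> = 0\<close> the solution is affine, and a periodic affine function is constant; the clause \<open>b = 0\<close>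
  makes the two coefficients unique also when the two waves coincide.
\<close>

lemma eigenfunction_eq_waves:
  assumes u: "laplace_eigenfunction M \<mu> u" and nz: "p0 \<in> rm_points M" "u p0 \<noteq> 0"
  shows "cis (\<mu> * l) = 1"
    and "\<exists>a b. (\<mu> = 0 \<longrightarrow> b = 0) \<and> (\<forall>p\<in>rm_points M. u p = a * wave \<mu> p + b * wave (- \<mu>) p)"
proof -
  define w where "w = u \<circ> \<gamma>"
  define w' where "w' t = vector_derivative w (at t)" for t
  have w: "(w has_vector_derivative w' t) (at t)"
    "(w' has_vector_derivative - (of_real \<mu>)\<^sup>2 * w t) (at t)" for t
    using eigenfunction_along_line[OF u, of t] unfolding w_def w'_def by simp_all
  have per: "w (t + l) = w t" for t by (simp add: w_def line_periodic)
  have "cis (\<mu> * l) = 1 \<and> (\<exists>a b. (\<mu> = 0 \<longrightarrow> b = 0) \<and>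
      (\<forall>t. w t = a * cis (\<mu> * t) + b * cis (- \<mu> * t)))"
  proof (cases "\<mu> = 0")
    case True
    have const: "w' t = w' 0" for t
      by (rule constant_of_zero_vector_derivative) (use w(2) True in simp)
    have "(w has_vector_derivative w' 0) (at t)" for t
      using w(1)[of t] unfolding const[of t] .
    then have "((\<lambda>t. w t - of_real t * w' 0) has_vector_derivative w' 0 - of_real 1 * w' 0) (at t)" for t
      by (intro has_vector_derivative_diff has_vector_derivative_mult_left
          has_vector_derivative_of_real DERIV_ident) auto
    then have "((\<lambda>t. w t - of_real t * w' 0) has_vector_derivative 0) (at t)" for t by simp
    note const' = constant_of_zero_vector_derivative[OF this]
    have lin: "w t = w 0 + of_real t * w' 0" for t
      using const'[of t 0] by (simp add: diff_eq_eq)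
    have "w' 0 = 0" using lin[of l] per[of 0] l_pos by simp
    then have "w t = w 0" for t using lin[of t] by simp
    then show ?thesis using True by (intro conjI exI[of _ "w 0"] exI[of _ 0]) auto
  next
    case False
    obtain a b where ab: "\<And>t. w t = a * cis (\<mu> * t) + b * cis (- \<mu> * t)"
      using harmonic_oscillator_solution[OF w False] by blast
    define A B where "A = a * (cis (\<mu> * l) - 1)" and "B = b * (cis (- \<mu> * l) - 1)"
    have AB: "A * cis (\<mu> * t) + B * cis (- \<mu> * t) = 0" for t
    proof -
      have shift: "cis (\<kappa> * (t + l)) = cis (\<kappa> * l) * cis (\<kappa> * t)" for \<kappa>
        by (simp add: cis_mult algebra_simps)
      have "A * cis (\<mu> * t) + B * cis (- \<mu> * t) = w (t + l) - w t"
        unfolding ab A_def B_def shift by (simp add: algebra_simps)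
      then show ?thesis using per by simp
    qed
    have "A + B = 0" using AB[of 0] by simp
    \<comment> \<open>at \<open>t = \<pi>/(2\<mu>)\<close> the two waves take the values \<open>i\<close> and \<open>-i\<close>\<close>
    moreover have "A * \<i> - B * \<i> = 0" using AB[of "pi / (2 * \<mu>)"] False by simp
    ultimately have "A = 0" "B = 0" by (auto simp: algebra_simps eq_neg_iff_add_eq_0[symmetric])
    moreover have "a \<noteq> 0 \<or> b \<noteq> 0"
    proof (rule ccontr)
      assume "\<not> (a \<noteq> 0 \<or> b \<noteq> 0)"
      then have "w t = 0" for t using ab by simp
      moreover obtain t where "p0 = \<gamma> t" using nz(1) line_surj by blast
      ultimately show False using nz(2) by (simp add: w_def)
    qed
    ultimately have "cis (\<mu> * l) = 1 \<or> cis (- \<mu> * l) = 1" by (auto simp: A_def B_def)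
    moreover have "cis (- \<mu> * l) = cnj (cis (\<mu> * l))" by (simp add: cis_cnj)
    ultimately have "cis (\<mu> * l) = 1" by (metis complex_cnj_cnj complex_cnj_one)
    then show ?thesis using ab False by blast
  qed
  then obtain a b where per1: "cis (\<mu> * l) = 1" and ab: "\<mu> = 0 \<longrightarrow> b = 0"
    "\<And>t. w t = a * cis (\<mu> * t) + b * cis (- \<mu> * t)" by blast
  show "cis (\<mu> * l) = 1" by (rule per1)
  have per2: "cis (- \<mu> * l) = 1" using per1 by (simp add: cis_cnj[symmetric])
  have "u p = a * wave \<mu> p + b * wave (- \<mu>) p" if p: "p \<in> rm_points M" for p
  proof -
    obtain t where "p = \<gamma> t" using p line_surj by blast
    then show ?thesis using ab(2)[of t] wave_line[OF per1] wave_line[OF per2] by (simp add: w_def)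
  qed
  with ab(1) show "\<exists>a b. (\<mu> = 0 \<longrightarrow> b = 0) \<and> (\<forall>p\<in>rm_points M. u p = a * wave \<mu> p + b * wave (- \<mu>) p)"
    by blast
qed

end

section \<open>The algebra of square-integrable functions\<close>

lemma L2_measurable: "f \<in> L2 M \<Longrightarrow> f \<in> borel_measurable (riem_volume M)"
  by (simp add: L2_def)

lemma L2_product_integrable:
  assumes "f \<in> L2 M" "g \<in> L2 M"
  shows "integrable (riem_volume M) (\<lambda>x. f x * cnj (g x))"
proof (rule Bochner_Integration.integrable_bound)
  show "integrable (riem_volume M) (\<lambda>x. (cmod (f x))\<^sup>2 + (cmod (g x))\<^sup>2)"
    using assms by (simp add: L2_def)
  show "(\<lambda>x. f x * cnj (g x)) \<in> borel_measurable (riem_volume M)"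
    using L2_measurable[OF assms(1)] measurable_compose[OF L2_measurable[OF assms(2)]
        borel_measurable_continuous_onI[of cnj, OF continuous_on_cnj[OF continuous_on_id]]]
    by (intro borel_measurable_times) auto
  have "a * b \<le> a\<^sup>2 + b\<^sup>2" if "a \<ge> 0" "b \<ge> 0" for a b :: real
    using sum_squares_bound[of a b] that mult_nonneg_nonneg[of a b] by linarith
  then show "AE x in riem_volume M. norm (f x * cnj (g x)) \<le> norm ((cmod (f x))\<^sup>2 + (cmod (g x))\<^sup>2)"
    by (intro always_eventually) (auto simp: norm_mult)
qed

lemma L2_cmult: "f \<in> L2 M \<Longrightarrow> (\<lambda>x. c * f x) \<in> L2 M"
  by (auto simp: L2_def norm_mult power_mult_distrib)

lemma L2_add:
  assumes "f \<in> L2 M" "g \<in> L2 M"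
  shows "(\<lambda>x. f x + g x) \<in> L2 M"
proof -
  have "integrable (riem_volume M) (\<lambda>x. (cmod (f x + g x))\<^sup>2)"
  proof (rule Bochner_Integration.integrable_bound)
    show "integrable (riem_volume M) (\<lambda>x. 2 * (cmod (f x))\<^sup>2 + 2 * (cmod (g x))\<^sup>2)"
      using assms by (simp add: L2_def)
    show "(\<lambda>x. (cmod (f x + g x))\<^sup>2) \<in> borel_measurable (riem_volume M)"
      using assms[THEN L2_measurable] by measurable
    have "(cmod (f x + g x))\<^sup>2 \<le> 2 * (cmod (f x))\<^sup>2 + 2 * (cmod (g x))\<^sup>2" for x
    proof -
      have "(cmod (f x + g x))\<^sup>2 \<le> (cmod (f x) + cmod (g x))\<^sup>2"
        by (intro power_mono norm_triangle_ineq) simp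
      also have "\<dots> \<le> 2 * (cmod (f x))\<^sup>2 + 2 * (cmod (g x))\<^sup>2"
        using sum_squares_bound[of "cmod (f x)" "cmod (g x)"] by (simp add: power2_sum)
      finally show ?thesis .
    qed
    then show "AE x in riem_volume M. norm ((cmod (f x + g x))\<^sup>2)
        \<le> norm (2 * (cmod (f x))\<^sup>2 + 2 * (cmod (g x))\<^sup>2)"
      by (intro always_eventually) auto
  qed
  then show ?thesis using borel_measurable_add[OF assms[THEN L2_measurable]] by (simp add: L2_def)
qed

lemma L2_diff: "f \<in> L2 M \<Longrightarrow> g \<in> L2 M \<Longrightarrow> (\<lambda>x. f x - g x) \<in> L2 M"
  using L2_add[OF _ L2_cmult[where c = "- 1"], of f M g] by simp

lemma L2_sum: "(\<And>j. j \<in> F \<Longrightarrow> f j \<in> L2 M) \<Longrightarrow> (\<lambda>x. \<Sum>j\<in>F. f j x) \<in> L2 M"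
proof (induction F rule: infinite_finite_induct)
  case (insert j F)
  then show ?case using L2_add[of "f j" M "\<lambda>x. \<Sum>j\<in>F. f j x"] by simp
qed (auto simp: L2_def)

lemma L2_inner_add_left:
  "f \<in> L2 M \<Longrightarrow> g \<in> L2 M \<Longrightarrow> h \<in> L2 M \<Longrightarrow>
    L2_inner M (\<lambda>x. f x + g x) h = L2_inner M f h + L2_inner M g h"
  unfolding L2_inner_def distrib_right
  by (intro Bochner_Integration.integral_add L2_product_integrable)

lemma L2_inner_cmult_left: "L2_inner M (\<lambda>x. c * f x) h = c * L2_inner M f h"
  unfolding L2_inner_def mult.assoc by simp

lemma L2_inner_diff_left:
  "f \<in> L2 M \<Longrightarrow> g \<in> L2 M \<Longrightarrow> h \<in> L2 M \<Longrightarrow>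
    L2_inner M (\<lambda>x. f x - g x) h = L2_inner M f h - L2_inner M g h"
  unfolding L2_inner_def left_diff_distrib
  by (intro Bochner_Integration.integral_diff L2_product_integrable)

lemma L2_inner_sum_left:
  "(\<And>j. j \<in> F \<Longrightarrow> f j \<in> L2 M) \<Longrightarrow> h \<in> L2 M \<Longrightarrow>
    L2_inner M (\<lambda>x. \<Sum>j\<in>F. f j x) h = (\<Sum>j\<in>F. L2_inner M (f j) h)"
  unfolding L2_inner_def sum_distrib_right
  by (intro Bochner_Integration.integral_sum L2_product_integrable)

lemma L2_inner_commute: "L2_inner M g f = cnj (L2_inner M f g)"
  using integral_bounded_linear'[OF bounded_linear_cnj bounded_linear_cnj,
      of "riem_volume M" "\<lambda>x. f x * cnj (g x)"]
  by (simp add: L2_inner_def mult.commute)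

lemma L2_inner_diff_right:
  "f \<in> L2 M \<Longrightarrow> g \<in> L2 M \<Longrightarrow> h \<in> L2 M \<Longrightarrow>
    L2_inner M h (\<lambda>x. f x - g x) = L2_inner M h f - L2_inner M h g"
  by (subst (1 2 3) L2_inner_commute) (simp add: L2_inner_diff_left)

lemma L2_inner_cmult_right: "L2_inner M h (\<lambda>x. c * f x) = cnj c * L2_inner M h f"
  by (subst (1 2) L2_inner_commute) (simp add: L2_inner_cmult_left)

lemma L2_inner_sum_right:
  "(\<And>j. j \<in> F \<Longrightarrow> f j \<in> L2 M) \<Longrightarrow> h \<in> L2 M \<Longrightarrow>
    L2_inner M h (\<lambda>x. \<Sum>j\<in>F. f j x) = (\<Sum>j\<in>F. L2_inner M h (f j))"
  by (subst (1 2) L2_inner_commute) (simp add: L2_inner_sum_left)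

lemma L2_norm_square: "(L2_norm M f)\<^sup>2 = (LINT x|riem_volume M. (cmod (f x))\<^sup>2)"
  unfolding L2_norm_def by (rule real_sqrt_pow2) (auto intro: integral_nonneg_AE)

lemma L2_inner_self: "L2_inner M f f = of_real ((L2_norm M f)\<^sup>2)"
  unfolding L2_norm_square L2_inner_def
  by (simp add: complex_norm_square[symmetric] integral_complex_of_real del: of_real_power)

lemma L2_norm_nonneg: "L2_norm M f \<ge> 0"
  unfolding L2_norm_def by (auto intro: integral_nonneg_AE)

lemma L2_norm_diff_square:
  assumes "f \<in> L2 M" "g \<in> L2 M"
  shows "(L2_norm M (\<lambda>x. f x - g x))\<^sup>2
    = (L2_norm M f)\<^sup>2 - 2 * Re (L2_inner M f g) + (L2_norm M g)\<^sup>2"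
proof -
  have "L2_inner M (\<lambda>x. f x - g x) (\<lambda>x. f x - g x)
      = L2_inner M f f - L2_inner M f g - (L2_inner M g f - L2_inner M g g)"
    using assms by (simp add: L2_inner_diff_left L2_inner_diff_right L2_diff)
  then have "Re (L2_inner M (\<lambda>x. f x - g x) (\<lambda>x. f x - g x))
      = Re (L2_inner M f f - L2_inner M f g - (cnj (L2_inner M f g) - L2_inner M g g))"
    by (simp add: L2_inner_commute[of M g f])
  then show ?thesis unfolding L2_inner_self by simp
qed

text \<open>
  Subtract from \<open>f\<close> its projection to the line spanned by \<open>g\<close>; the square of the norm of the rest is
  nonnegative.
\<close>

lemma L2_Cauchy_Schwarz:
  assumes f: "f \<in> L2 M" and g: "g \<in> L2 M" and nz: "L2_norm M g \<noteq> 0"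
  shows "cmod (L2_inner M f g) \<le> L2_norm M f * L2_norm M g"
proof -
  let ?z = "L2_inner M f g" and ?G = "(L2_norm M g)\<^sup>2"
  define c where "c = ?z / of_real ?G"
  have "0 \<le> (L2_norm M (\<lambda>x. f x - c * g x))\<^sup>2" by simp
  also have "\<dots> = (L2_norm M f)\<^sup>2 - 2 * Re (cnj c * ?z) + (L2_norm M (\<lambda>x. c * g x))\<^sup>2"
    using L2_norm_diff_square[OF f L2_cmult[OF g]] by (simp add: L2_inner_cmult_right)
  also have "(L2_norm M (\<lambda>x. c * g x))\<^sup>2 = (cmod c)\<^sup>2 * ?G"
    by (simp add: L2_norm_square norm_mult power_mult_distrib)
  also have "Re (cnj c * ?z) = (cmod ?z)\<^sup>2 / ?G"
  proof -
    have "cnj c * ?z = of_real ((cmod ?z)\<^sup>2 / ?G)"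
      unfolding of_real_divide complex_norm_square c_def by (simp add: mult.commute)
    then show ?thesis by (metis Re_complex_of_real)
  qed
  also have "(cmod c)\<^sup>2 * ?G = (cmod ?z)\<^sup>2 / ?G"
  proof -
    have "cmod c = cmod ?z / ?G" unfolding c_def norm_divide norm_of_real by simp
    then show ?thesis using nz by (simp add: power2_eq_square)
  qed
  finally have "(cmod ?z)\<^sup>2 / ?G \<le> (L2_norm M f)\<^sup>2" by simp
  then have "(cmod ?z)\<^sup>2 \<le> (L2_norm M f * L2_norm M g)\<^sup>2"
    using nz by (simp add: divide_le_eq power_mult_distrib)
  then show ?thesis by (rule power2_le_imp_le) (simp add: L2_norm_nonneg)
qed

locale L2_orthonormal =
  fixes M :: "'a riem1" and e :: "nat \<Rightarrow> 'a \<Rightarrow> complex"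
  assumes e_L2 [simp]: "e j \<in> L2 M"
    and e_inner: "L2_inner M (e i) (e j) = (if i = j then 1 else 0)"
begin

definition proj :: "nat set \<Rightarrow> ('a \<Rightarrow> complex) \<Rightarrow> 'a \<Rightarrow> complex" where
  "proj F f x = (\<Sum>j\<in>F. L2_inner M f (e j) * e j x)"

lemma proj_L2 [simp]: "proj F f \<in> L2 M"
  unfolding proj_def by (intro L2_sum L2_cmult e_L2)

lemma inner_proj:
  assumes f: "f \<in> L2 M"
  shows "L2_inner M f (proj F f) = of_real (\<Sum>j\<in>F. (cmod (L2_inner M f (e j)))\<^sup>2)"
proof -
  have "L2_inner M f (proj F f) = (\<Sum>j\<in>F. L2_inner M f (\<lambda>x. L2_inner M f (e j) * e j x))"
    unfolding proj_def by (intro L2_inner_sum_right L2_cmult e_L2 f)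
  also have "\<dots> = (\<Sum>j\<in>F. L2_inner M f (e j) * cnj (L2_inner M f (e j)))"
    by (simp only: L2_inner_cmult_right mult.commute[of "cnj z" z for z])
  also have "\<dots> = of_real (\<Sum>j\<in>F. (cmod (L2_inner M f (e j)))\<^sup>2)"
    unfolding of_real_sum complex_norm_square ..
  finally show ?thesis .
qed

lemma norm_proj:
  assumes F: "finite F"
  shows "(L2_norm M (proj F f))\<^sup>2 = (\<Sum>j\<in>F. (cmod (L2_inner M f (e j)))\<^sup>2)"
proof -
  have "L2_inner M (proj F f) (e i) = L2_inner M f (e i)" if "i \<in> F" for i
  proof -
    have "L2_inner M (proj F f) (e i) = (\<Sum>j\<in>F. L2_inner M (\<lambda>x. L2_inner M f (e j) * e j x) (e i))"
      unfolding proj_def by (intro L2_inner_sum_left L2_cmult e_L2)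
    also have "\<dots> = L2_inner M f (e i)"
      using F that by (simp add: L2_inner_cmult_left e_inner if_distrib cong: if_cong)
    finally show ?thesis .
  qed
  moreover have "L2_inner M (proj F f) (proj F f)
      = (\<Sum>i\<in>F. L2_inner M (proj F f) (\<lambda>x. L2_inner M f (e i) * e i x))"
    by (subst (2) proj_def[abs_def]) (intro L2_inner_sum_right L2_cmult e_L2 proj_L2)
  ultimately have "L2_inner M (proj F f) (proj F f)
      = (\<Sum>i\<in>F. cnj (L2_inner M f (e i)) * L2_inner M f (e i))"
    by (simp add: L2_inner_cmult_right)
  also have "\<dots> = of_real (\<Sum>j\<in>F. (cmod (L2_inner M f (e j)))\<^sup>2)"
    unfolding of_real_sum complex_norm_square by (simp add: mult.commute)
  finally show ?thesis unfolding L2_inner_self of_real_eq_iff .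
qed

lemma Bessel:
  assumes F: "finite F" and f: "f \<in> L2 M"
  shows "(\<Sum>j\<in>F. (cmod (L2_inner M f (e j)))\<^sup>2) \<le> (L2_norm M f)\<^sup>2"
  using L2_norm_diff_square[OF f proj_L2[of F f]] inner_proj[OF f, of F] norm_proj[OF F, of f]
    zero_le_power2[of "L2_norm M (\<lambda>x. f x - proj F f x)"]
  by simp

end

section \<open>Eigenbases\<close>

context unit_speed_circle
begin

lemma wave_L2:
  assumes "cis (\<kappa> * l) = 1"
  shows "wave \<kappa> \<in> L2 M"
  using wave_measurable[OF assms] finite_measure.integrable_const[OF finite_measure_riem_volume]
  by (simp add: L2_def)

lemma wave_inner:
  assumes "cis (\<kappa> * l) = 1" "cis (\<kappa>' * l) = 1"
  shows "L2_inner M (wave \<kappa>) (wave \<kappa>') = (if \<kappa> = \<kappa>' then of_real l else 0)"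
proof -
  have "cis (- \<kappa>' * l) = 1" using assms(2) by (simp add: cis_cnj[symmetric])
  then have "cis ((\<kappa> + - \<kappa>') * l) = 1"
    using assms(1) by (simp only: distrib_right cis_mult[symmetric] mult_1)
  from wave_integral[OF this] show ?thesis by (simp add: L2_inner_def cnj_wave wave_mult)
qed

lemma L2_inner_cong:
  assumes "\<And>p. p \<in> rm_points M \<Longrightarrow> f p = f' p" "\<And>p. p \<in> rm_points M \<Longrightarrow> h p = h' p"
  shows "L2_inner M f h = L2_inner M f' h'"
  unfolding L2_inner_def by (rule Bochner_Integration.integral_cong) (use assms in auto)

end

locale circle_eigenbasis = unit_speed_circle +
  fixes e :: "nat \<Rightarrow> 'a \<Rightarrow> complex" and lam :: "nat \<Rightarrow> real"
  assumes eigenbasis: "laplace_eigenbasis M e lam"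
begin

sublocale L2_orthonormal M e
  using eigenbasis by unfold_locales (auto simp: laplace_eigenbasis_def L2_orthonormal_basis_def)

lemma lam_nonneg: "0 \<le> lam j"
proof -
  have "incseq lam" "lam 0 = 0" using eigenbasis by (auto simp: laplace_eigenbasis_def)
  then show ?thesis using incseqD[of lam 0 j] by simp
qed

lemma basis_eq_waves:
  "cis (lam j * l) = 1 \<and> (\<exists>a b. (lam j = 0 \<longrightarrow> b = 0) \<and>
     (\<forall>p\<in>rm_points M. e j p = a * wave (lam j) p + b * wave (- lam j) p))"
proof -
  have "\<exists>p\<in>rm_points M. e j p \<noteq> 0"
  proof (rule ccontr)
    assume "\<not> ?thesis"
    then have "L2_inner M (e j) (e j) = L2_inner M (\<lambda>x. 0) (\<lambda>x. 0)"
      by (intro L2_inner_cong) auto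
    then show False using e_inner[of j j] by (simp add: L2_inner_def)
  qed
  then obtain p where p: "p \<in> rm_points M" "e j p \<noteq> 0" by blast
  have "laplace_eigenfunction M (lam j) (e j)" using eigenbasis by (simp add: laplace_eigenbasis_def)
  from eigenfunction_eq_waves[OF this p] show ?thesis by blast
qed

lemma lam_period: "cis (lam j * l) = 1" "cis (- lam j * l) = 1"
  using basis_eq_waves[of j] by (auto simp: cis_cnj[symmetric])

lemma lam_wave_L2: "wave (lam j) \<in> L2 M" "wave (- lam j) \<in> L2 M"
  by (intro wave_L2 lam_period)+

definition coeffs :: "nat \<Rightarrow> complex \<times> complex" where
  "coeffs j = (SOME ab. (lam j = 0 \<longrightarrow> snd ab = 0) \<and>
     (\<forall>p\<in>rm_points M. e j p = fst ab * wave (lam j) p + snd ab * wave (- lam j) p))"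

definition "forw j = fst (coeffs j)"
definition "backw j = snd (coeffs j)"

lemma
  shows backw_0: "lam j = 0 \<Longrightarrow> backw j = 0"
    and basis_waves: "p \<in> rm_points M \<Longrightarrow> e j p = forw j * wave (lam j) p + backw j * wave (- lam j) p"
proof -
  let ?P = "\<lambda>ab. (lam j = 0 \<longrightarrow> snd ab = 0) \<and>
     (\<forall>p\<in>rm_points M. e j p = fst ab * wave (lam j) p + snd ab * wave (- lam j) p)"
  have "\<exists>ab. ?P ab" using basis_eq_waves[of j] by auto
  then have "?P (coeffs j)" unfolding coeffs_def by (rule someI_ex)
  then show "lam j = 0 \<Longrightarrow> backw j = 0"
    "p \<in> rm_points M \<Longrightarrow> e j p = forw j * wave (lam j) p + backw j * wave (- lam j) p"
    by (auto simp: forw_def backw_def)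
qed

lemma basis_wave_inner:
  assumes "cis (\<kappa> * l) = 1"
  shows "L2_inner M (e j) (wave \<kappa>) =
    forw j * (if lam j = \<kappa> then of_real l else 0) + backw j * (if - lam j = \<kappa> then of_real l else 0)"
proof -
  have "L2_inner M (e j) (wave \<kappa>)
      = L2_inner M (\<lambda>p. forw j * wave (lam j) p + backw j * wave (- lam j) p) (wave \<kappa>)"
    by (rule L2_inner_cong) (auto simp: basis_waves)
  also have "\<dots> = forw j * L2_inner M (wave (lam j)) (wave \<kappa>)
      + backw j * L2_inner M (wave (- lam j)) (wave \<kappa>)"
    by (simp add: L2_inner_add_left L2_inner_cmult_left L2_cmult lam_wave_L2 wave_L2[OF assms])
  finally show ?thesis by (simp only: wave_inner lam_period assms)
qed

lemma basis_coeff_norm: "l * ((cmod (forw j))\<^sup>2 + (cmod (backw j))\<^sup>2) = 1"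
proof -
  let ?a = "forw j" and ?b = "backw j"
  have "1 = L2_inner M (e j) (e j)" by (simp add: e_inner)
  also have "\<dots> = L2_inner M (\<lambda>p. ?a * wave (lam j) p + ?b * wave (- lam j) p) (e j)"
    by (rule L2_inner_cong) (auto simp: basis_waves)
  also have "\<dots> = ?a * L2_inner M (wave (lam j)) (e j) + ?b * L2_inner M (wave (- lam j)) (e j)"
    by (simp add: L2_inner_add_left L2_inner_cmult_left L2_cmult lam_wave_L2)
  also have "\<dots> = ?a * cnj (L2_inner M (e j) (wave (lam j))) + ?b * cnj (L2_inner M (e j) (wave (- lam j)))"
    by (simp only: L2_inner_commute[of M _ "e j"])
  also have "\<dots> = of_real l * (?a * cnj ?a + ?b * cnj ?b)"
    unfolding basis_wave_inner[OF lam_period(1)] basis_wave_inner[OF lam_period(2)]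
    using backw_0[of j] by (cases "lam j = 0") (auto simp: algebra_simps)
  also have "\<dots> = of_real (l * ((cmod ?a)\<^sup>2 + (cmod ?b)\<^sup>2))"
    unfolding of_real_mult of_real_add complex_norm_square ..
  finally show ?thesis by (metis of_real_eq_1_iff)
qed

lemma norm_wave_L2: "(L2_norm M (wave \<kappa>))\<^sup>2 = l"
  using measure_riem_volume by (simp add: L2_norm_square)

text \<open>
  Bessel's inequality for the two waves bounds the sums of \<open>l |a\<^sub>j|\<^sup>2\<close> and of \<open>l |b\<^sub>j|\<^sup>2\<close> over the
  eigenspace by \<open>1\<close> each, while every \<open>j\<close> contributes \<open>l (|a\<^sub>j|\<^sup>2 + |b\<^sub>j|\<^sup>2) = 1\<close>: at most two basis
  functions share an eigenvalue.
\<close>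

lemma multiplicity_finite: "finite {j. lam j = \<mu>}"
proof -
  have "card F \<le> 2" if F: "F \<subseteq> {j. lam j = \<mu>}" "finite F" for F
  proof (cases "F = {}")
    case False
    then obtain j0 where "lam j0 = \<mu>" using F(1) by blast
    then have per: "cis (\<mu> * l) = 1" "cis (- \<mu> * l) = 1" using lam_period by blast+
    have "l * (cmod (forw j))\<^sup>2 = (cmod (L2_inner M (wave \<mu>) (e j)))\<^sup>2 / l"
      and "l * (cmod (backw j))\<^sup>2 = (cmod (L2_inner M (wave (- \<mu>)) (e j)))\<^sup>2 / l
        \<or> backw j = 0"
      if "j \<in> F" for j
    proof -
      have j: "lam j = \<mu>" using F(1) that by blast
      have "cmod (L2_inner M (wave \<mu>) (e j)) = l * cmod (forw j)"
        unfolding L2_inner_commute[of M _ "e j"] complex_mod_cnj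
        using basis_wave_inner[OF per(1), of j] backw_0[of j] j l_pos by (simp add: norm_mult)
      then show "l * (cmod (forw j))\<^sup>2 = (cmod (L2_inner M (wave \<mu>) (e j)))\<^sup>2 / l"
        using l_pos by (simp add: power2_eq_square)
      have "cmod (L2_inner M (wave (- \<mu>)) (e j)) = l * cmod (backw j)" if "\<mu> \<noteq> 0"
        unfolding L2_inner_commute[of M _ "e j"] complex_mod_cnj
        using basis_wave_inner[OF per(2), of j] that j l_pos by (simp add: norm_mult)
      then show "l * (cmod (backw j))\<^sup>2 = (cmod (L2_inner M (wave (- \<mu>)) (e j)))\<^sup>2 / l
          \<or> backw j = 0"
        using l_pos backw_0[of j] j by (cases "\<mu> = 0") (auto simp: power2_eq_square)
    qed
    note coeff = this
    have "(\<Sum>j\<in>F. (cmod (L2_inner M (wave \<kappa>) (e j)))\<^sup>2 / l) \<le> 1" if "cis (\<kappa> * l) = 1" for \<kappa>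
    proof -
      have "(\<Sum>j\<in>F. (cmod (L2_inner M (wave \<kappa>) (e j)))\<^sup>2 / l) \<le> l / l"
        unfolding sum_divide_distrib[symmetric] using Bessel[OF F(2) wave_L2[OF that]] l_pos
        by (intro divide_right_mono) (simp_all add: norm_wave_L2)
      then show ?thesis using l_pos by simp
    qed
    note bessel = this[OF per(1)] this[OF per(2)]
    have "real (card F) = (\<Sum>j\<in>F. l * (cmod (forw j))\<^sup>2 + l * (cmod (backw j))\<^sup>2)"
      using basis_coeff_norm by (simp add: distrib_left[symmetric])
    also have "\<dots> \<le> (\<Sum>j\<in>F. (cmod (L2_inner M (wave \<mu>) (e j)))\<^sup>2 / l
        + (cmod (L2_inner M (wave (- \<mu>)) (e j)))\<^sup>2 / l)"
      using coeff l_pos by (intro sum_mono add_mono) (fastforce simp: divide_nonneg_pos)+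
    also have "\<dots> \<le> 2" using bessel by (simp add: sum.distrib)
    finally show ?thesis by linarith
  qed simp
  then show ?thesis using finite_if_finite_subsets_card_bdd by blast
qed

lemma basis_complete:
  "f \<in> L2 M \<Longrightarrow> (\<lambda>N. L2_norm M (\<lambda>x. f x - proj {..<N} f x)) \<longlonglongrightarrow> 0"
  using eigenbasis by (simp add: laplace_eigenbasis_def L2_orthonormal_basis_def proj_def)

lemma Parseval:
  assumes f: "f \<in> L2 M" and g: "g \<in> L2 M" "L2_norm M g \<noteq> 0"
  shows "(\<lambda>N. \<Sum>j<N. L2_inner M f (e j) * L2_inner M (e j) g) \<longlonglongrightarrow> L2_inner M f g"
proof -
  have eq: "L2_inner M (\<lambda>x. f x - proj {..<N} f x) g
      = L2_inner M f g - (\<Sum>j<N. L2_inner M f (e j) * L2_inner M (e j) g)" for N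
  proof -
    have "L2_inner M (proj {..<N} f) g = (\<Sum>j<N. L2_inner M (\<lambda>x. L2_inner M f (e j) * e j x) g)"
      unfolding proj_def by (intro L2_inner_sum_left L2_cmult e_L2 g)
    then show ?thesis
      using L2_inner_diff_left[OF f proj_L2 g(1)] by (simp add: L2_inner_cmult_left)
  qed
  have "(\<lambda>N. L2_inner M (\<lambda>x. f x - proj {..<N} f x) g) \<longlonglongrightarrow> 0"
  proof (rule Lim_null_comparison)
    show "\<forall>\<^sub>F N in sequentially. norm (L2_inner M (\<lambda>x. f x - proj {..<N} f x) g)
        \<le> L2_norm M (\<lambda>x. f x - proj {..<N} f x) * L2_norm M g"
      by (intro always_eventually allI L2_Cauchy_Schwarz L2_diff f g proj_L2)
    show "(\<lambda>N. L2_norm M (\<lambda>x. f x - proj {..<N} f x) * L2_norm M g) \<longlonglongrightarrow> 0"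
      by (rule tendsto_mult_left_zero[OF basis_complete[OF f]])
  qed
  from tendsto_diff[OF tendsto_const[of "L2_inner M f g"] this] show ?thesis unfolding eq by simp
qed

text \<open>
  This is Parseval's identity for the two waves of frequency \<open>\<mu>\<close>, which are orthogonal to each other
  and to all \<open>e\<^sub>j\<close> with a different eigenvalue. For \<open>\<mu> = 0\<close> all \<open>b\<^sub>j\<close> vanish.
\<close>

lemma cross_terms_cancel: "(\<Sum>j\<in>{j. lam j = \<mu>}. forw j * cnj (backw j)) = 0"
proof (cases "\<mu> = 0 \<or> {j. lam j = \<mu>} = {}")
  case True
  then show ?thesis using backw_0 by (elim disjE) auto
next
  case False
  then obtain j0 where "lam j0 = \<mu>" by blast
  then have per: "cis (\<mu> * l) = 1" "cis (- \<mu> * l) = 1" and pos: "\<mu> > 0"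
    using lam_period lam_nonneg[of j0] False by auto
  define J where "J = {j. lam j = \<mu>}"
  have J: "finite J" unfolding J_def by (rule multiplicity_finite)
  let ?t = "\<lambda>j. L2_inner M (wave \<mu>) (e j) * L2_inner M (e j) (wave (- \<mu>))"
  have t: "?t j = (if j \<in> J then (of_real l)\<^sup>2 * (cnj (forw j) * backw j) else 0)" for j
    unfolding L2_inner_commute[of M "wave \<mu>"] basis_wave_inner[OF per(1)] basis_wave_inner[OF per(2)]
    using pos lam_nonneg[of j] by (auto simp: J_def power2_eq_square)
  have "(\<lambda>N. \<Sum>j<N. ?t j) \<longlonglongrightarrow> L2_inner M (wave \<mu>) (wave (- \<mu>))"
  proof (rule Parseval[OF wave_L2[OF per(1)] wave_L2[OF per(2)]])
    show "L2_norm M (wave (- \<mu>)) \<noteq> 0" using norm_wave_L2[of "- \<mu>"] l_pos by auto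
  qed
  then have lim: "(\<lambda>N. \<Sum>j<N. ?t j) \<longlonglongrightarrow> 0" using wave_inner[OF per] pos by simp
  have "(\<Sum>j<N. ?t j) = (of_real l)\<^sup>2 * (\<Sum>j\<in>J. cnj (forw j) * backw j)" if N: "J \<subseteq> {..<N}" for N
  proof -
    have "(\<Sum>j<N. ?t j) = (\<Sum>j\<in>{..<N} \<inter> J. (of_real l)\<^sup>2 * (cnj (forw j) * backw j))"
      unfolding t by (simp add: sum.inter_restrict)
    then show ?thesis using N by (simp add: Int_absorb1 sum_distrib_left)
  qed
  note stable = this
  obtain N0 where N0: "J \<subseteq> {..<N0}" using J finite_nat_bounded by blast
  have "\<forall>\<^sub>F N in sequentially.
      (\<Sum>j<N. ?t j) = (of_real l)\<^sup>2 * (\<Sum>j\<in>J. cnj (forw j) * backw j)"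
  proof (rule eventually_sequentiallyI)
    fix N assume "N0 \<le> N"
    then have "J \<subseteq> {..<N}" using N0 by auto
    then show "(\<Sum>j<N. ?t j) = (of_real l)\<^sup>2 * (\<Sum>j\<in>J. cnj (forw j) * backw j)" by (rule stable)
  qed
  then have "(\<lambda>N. \<Sum>j<N. ?t j) \<longlonglongrightarrow> (of_real l)\<^sup>2 * (\<Sum>j\<in>J. cnj (forw j) * backw j)"
    by (rule tendsto_eventually)
  with lim have "(of_real l)\<^sup>2 * (\<Sum>j\<in>J. cnj (forw j) * backw j) = 0"
    using LIMSEQ_unique by blast
  then have "cnj (\<Sum>j\<in>J. cnj (forw j) * backw j) = 0" using l_pos by simp
  then show ?thesis by (simp add: J_def)
qed

lemma eigenspace_kernel:
  assumes x: "x \<in> rm_points M"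
  shows "(\<Sum>j\<in>{j. lam j = \<mu>}. (cmod (e j x))\<^sup>2) = real (card {j. lam j = \<mu>}) / l"
proof -
  have sq: "(cmod (e j x))\<^sup>2 = 1 / l + 2 * Re (forw j * cnj (backw j) * wave (2 * \<mu>) x)"
    if j: "lam j = \<mu>" for j
  proof -
    let ?u = "forw j * wave \<mu> x" and ?v = "backw j * wave (- \<mu>) x"
    have expand: "(cmod (?u + ?v))\<^sup>2 = (cmod ?u)\<^sup>2 + (cmod ?v)\<^sup>2 + 2 * Re (?u * cnj ?v)"
      unfolding cmod_power2 by (simp add: power2_eq_square algebra_simps)
    have "?u * cnj ?v = forw j * cnj (backw j) * (wave \<mu> x * wave \<mu> x)"
      by (simp add: cnj_wave mult_ac)
    then have cross: "?u * cnj ?v = forw j * cnj (backw j) * wave (2 * \<mu>) x"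
      by (simp add: wave_mult)
    have diag: "(cmod ?u)\<^sup>2 + (cmod ?v)\<^sup>2 = 1 / l"
      using basis_coeff_norm[of j] l_pos by (simp add: norm_mult field_simps)
    have "e j x = ?u + ?v" using basis_waves[OF x, of j] j by simp
    then show ?thesis using expand unfolding cross diag by simp
  qed
  have "(\<Sum>j\<in>{j. lam j = \<mu>}. (cmod (e j x))\<^sup>2)
      = (\<Sum>j\<in>{j. lam j = \<mu>}. 1 / l) + 2 * Re ((\<Sum>j\<in>{j. lam j = \<mu>}. forw j * cnj (backw j)) * wave (2 * \<mu>) x)"
    using sq by (simp add: sum.distrib sum_distrib_left sum_distrib_right)
  then show ?thesis using cross_terms_cancel[of \<mu>] by simp
qed

lemma spectral_kernel:
  assumes S: "finite S" and x: "x \<in> rm_points M"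
  shows "finite {j. lam j \<in> S}"
    and "(\<Sum>j\<in>{j. lam j \<in> S}. (cmod (e j x))\<^sup>2) = real (card {j. lam j \<in> S}) / l"
proof -
  have U: "{j. lam j \<in> S} = (\<Union>\<mu>\<in>S. {j. lam j = \<mu>})" by auto
  show "finite {j. lam j \<in> S}" unfolding U using S multiplicity_finite by blast
  have "(\<Sum>j\<in>{j. lam j \<in> S}. (cmod (e j x))\<^sup>2) = (\<Sum>\<mu>\<in>S. \<Sum>j\<in>{j. lam j = \<mu>}. (cmod (e j x))\<^sup>2)"
    unfolding U using S multiplicity_finite by (intro sum.UNION_disjoint) auto
  also have "\<dots> = (\<Sum>\<mu>\<in>S. real (card {j. lam j = \<mu>})) / l"
    by (simp add: eigenspace_kernel[OF x] sum_divide_distrib)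
  also have "(\<Sum>\<mu>\<in>S. real (card {j. lam j = \<mu>})) = real (card {j. lam j \<in> S})"
    unfolding U using S multiplicity_finite by (subst card_UN_disjoint) auto
  finally show "(\<Sum>j\<in>{j. lam j \<in> S}. (cmod (e j x))\<^sup>2) = real (card {j. lam j \<in> S}) / l" .
qed

section \<open>The uncertainty principle\<close>

text \<open>
  Writing \<open>A = \<parallel>1\<^sub>E f\<parallel>\<^sup>2\<close>, \<open>P = \<parallel>h\<parallel>\<^sup>2\<close> for the projection \<open>h\<close> of \<open>f\<close>, and \<open>g = 1\<^sub>E f\<close>, one has
  \<open>\<langle>f, g\<rangle> = A\<close> and \<open>\<langle>f, h\<rangle> = P\<close>, and \<open>Re \<langle>g, h\<rangle> \<le> c (A + P)/2\<close> because \<open>h\<close> has mass at most \<open>c\<^sup>2 P\<close> on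
  \<open>E\<close>. Expanding \<open>\<parallel>f - k (g + h)\<parallel>\<^sup>2 \<ge> 0\<close> and choosing \<open>k = 1/(1 + c)\<close>, which minimizes the resulting bound,
  leaves \<open>k (A + P) \<le> \<parallel>f\<parallel>\<^sup>2\<close>.
\<close>

lemma concentration_sum_bound:
  assumes E: "E \<in> sets (riem_volume M)" and S: "finite S" and f: "f \<in> L2 M"
    and c: "c > 0" "c\<^sup>2 \<ge> measure (riem_volume M) E / l * real (card {j. lam j \<in> S})"
  shows "(LINT x:E|riem_volume M. (cmod (f x))\<^sup>2) + (\<Sum>j\<in>{j. lam j \<in> S}. (cmod (L2_inner M f (e j)))\<^sup>2)
    \<le> (1 + c) * (L2_norm M f)\<^sup>2"
proof -
  let ?V = "riem_volume M"
  define X where "X = {j. lam j \<in> S}"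
  obtain p where "p \<in> rm_points M" using nonempty by blast
  then have X: "finite X" unfolding X_def using spectral_kernel(1)[OF S] by blast
  define F where "F = (L2_norm M f)\<^sup>2"
  define P where "P = (\<Sum>j\<in>X. (cmod (L2_inner M f (e j)))\<^sup>2)"
  define h where "h = proj X f"
  define g where "g x = indicator E x * f x" for x
  define A where "A = (LINT x:E|?V. (cmod (f x))\<^sup>2)"
  have h: "h \<in> L2 M" by (simp add: h_def)
  have g: "g \<in> L2 M"
  proof -
    have gm: "g \<in> borel_measurable ?V" unfolding g_def using E L2_measurable[OF f] by measurable
    have "integrable ?V (\<lambda>x. (cmod (g x))\<^sup>2)"
    proof (rule Bochner_Integration.integrable_bound)
      show "integrable ?V (\<lambda>x. (cmod (f x))\<^sup>2)" using f by (simp add: L2_def)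
      show "(\<lambda>x. (cmod (g x))\<^sup>2) \<in> borel_measurable ?V" using gm by measurable
      show "AE x in ?V. norm ((cmod (g x))\<^sup>2) \<le> norm ((cmod (f x))\<^sup>2)"
        by (intro always_eventually) (auto simp: g_def indicator_def)
    qed
    then show ?thesis using gm by (simp add: L2_def)
  qed
  have gg: "(L2_norm M g)\<^sup>2 = A"
    unfolding L2_norm_square A_def set_lebesgue_integral_def
    by (intro Bochner_Integration.integral_cong) (auto simp: g_def indicator_def)
  have "L2_inner M f g = of_real A"
  proof -
    have "L2_inner M f g = L2_inner M g g"
      unfolding L2_inner_def by (intro Bochner_Integration.integral_cong) (auto simp: g_def indicator_def)
    then show ?thesis unfolding L2_inner_self gg .
  qed
  have "L2_inner M f h = of_real P" unfolding h_def P_def by (rule inner_proj[OF f])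
  have hh: "(L2_norm M h)\<^sup>2 = P" unfolding h_def P_def by (rule norm_proj[OF X])
  have A0: "A \<ge> 0" and P0: "P \<ge> 0" using gg hh by (metis zero_le_power2)+
  have int_hE: "integrable ?V (\<lambda>x. indicator E x * (cmod (h x))\<^sup>2)"
    using integrable_mult_indicator[OF E, of "\<lambda>x. (cmod (h x))\<^sup>2"] h by (simp add: L2_def)
  have mass_on_E: "(LINT x|?V. indicator E x * (cmod (h x))\<^sup>2) \<le> c\<^sup>2 * P"
  proof -
    have pointwise: "(cmod (h x))\<^sup>2 \<le> P * (real (card X) / l)" if x: "x \<in> rm_points M" for x
    proof -
      \<comment> \<open>Cauchy-Schwarz over \<open>X\<close> brings in the kernel, which is constant on \<open>M\<close>\<close>
      have "cmod (h x) \<le> (\<Sum>j\<in>X. cmod (L2_inner M f (e j)) * cmod (e j x))"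
        unfolding h_def proj_def by (rule order.trans[OF norm_sum]) (simp add: norm_mult)
      then have "(cmod (h x))\<^sup>2 \<le> (\<Sum>j\<in>X. cmod (L2_inner M f (e j)) * cmod (e j x))\<^sup>2"
        by (intro power_mono) auto
      also have "\<dots> \<le> P * (\<Sum>j\<in>X. (cmod (e j x))\<^sup>2)"
        unfolding P_def by (rule Cauchy_Schwarz_ineq_sum)
      finally show ?thesis using spectral_kernel(2)[OF S x] by (simp add: X_def)
    qed
    have Eint: "integrable ?V (\<lambda>x. indicator E x * (P * (real (card X) / l)))"
      using integrable_mult_indicator[OF E, of "\<lambda>x. P * (real (card X) / l)",
          OF finite_measure.integrable_const[OF finite_measure_riem_volume]]
      by (simp only: real_scaleR_def)
    have "(LINT x|?V. indicator E x * (cmod (h x))\<^sup>2)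
        \<le> (LINT x|?V. indicator E x * (P * (real (card X) / l)))"
      using pointwise by (intro integral_mono[OF int_hE Eint]) (auto simp: indicator_def)
    also have "\<dots> = measure ?V E * (P * (real (card X) / l))"
      using E sets.sets_into_space[OF E] by (simp add: Int_absorb2)
    also have "\<dots> = (measure ?V E / l * real (card X)) * P" by simp
    also have "\<dots> \<le> c\<^sup>2 * P" using c(2) P0 by (intro mult_right_mono) (simp_all add: X_def)
    finally show ?thesis .
  qed
  have cross: "Re (L2_inner M g h) \<le> c / 2 * (A + P)"
  proof -
    have int_gh: "integrable ?V (\<lambda>x. Re (g x * cnj (h x)))"
      by (rule integrable_Re[OF L2_product_integrable[OF g h]])
    have int_gg: "integrable ?V (\<lambda>x. (cmod (g x))\<^sup>2)" using g by (simp add: L2_def)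
    have "Re (L2_inner M g h) = (LINT x|?V. Re (g x * cnj (h x)))"
      unfolding L2_inner_def by (rule integral_Re[symmetric, OF L2_product_integrable[OF g h]])
    also have "\<dots> \<le> (LINT x|?V. c / 2 * (cmod (g x))\<^sup>2 + 1 / (2 * c) * (indicator E x * (cmod (h x))\<^sup>2))"
    proof (rule integral_mono[OF int_gh])
      show "integrable ?V (\<lambda>x. c / 2 * (cmod (g x))\<^sup>2 + 1 / (2 * c) * (indicator E x * (cmod (h x))\<^sup>2))"
        using int_gg int_hE by simp
      fix x
      show "Re (g x * cnj (h x)) \<le> c / 2 * (cmod (g x))\<^sup>2 + 1 / (2 * c) * (indicator E x * (cmod (h x))\<^sup>2)"
      proof (cases "x \<in> E")
        case True
        have "Re (g x * cnj (h x)) \<le> cmod (g x) * cmod (h x)"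
          using complex_Re_le_cmod[of "g x * cnj (h x)"] by (simp add: norm_mult)
        also have "\<dots> \<le> c / 2 * (cmod (g x))\<^sup>2 + 1 / (2 * c) * (cmod (h x))\<^sup>2"
        proof -
          have "0 \<le> (c * cmod (g x) - cmod (h x))\<^sup>2 / (2 * c)" using c(1) by simp
          also have "\<dots> = c / 2 * (cmod (g x))\<^sup>2 + 1 / (2 * c) * (cmod (h x))\<^sup>2 - cmod (g x) * cmod (h x)"
            using c(1) by (simp add: field_simps power2_eq_square)
          finally show ?thesis by simp
        qed
        finally show ?thesis using True by simp
      qed (simp add: g_def)
    qed
    also have "\<dots> = c / 2 * (LINT x|?V. (cmod (g x))\<^sup>2)
        + 1 / (2 * c) * (LINT x|?V. indicator E x * (cmod (h x))\<^sup>2)"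
      using int_gg int_hE by (subst Bochner_Integration.integral_add) simp_all
    also have "\<dots> \<le> c / 2 * A + 1 / (2 * c) * (c\<^sup>2 * P)"
      using mass_on_E gg c(1) unfolding L2_norm_square by (intro add_mono mult_left_mono) auto
    also have "\<dots> = c / 2 * (A + P)" using c(1) by (simp add: field_simps power2_eq_square)
    finally show ?thesis .
  qed
  define k where "k = 1 / (1 + c)"
  have k: "k > 0" "k * (1 + c) = 1" using c(1) by (auto simp: k_def)
  define v where "v x = complex_of_real k * (g x + h x)" for x
  have gh: "(\<lambda>x. g x + h x) \<in> L2 M" by (rule L2_add[OF g h])
  have v: "v \<in> L2 M" unfolding v_def by (rule L2_cmult[OF gh])
  have add_right: "L2_inner M u (\<lambda>x. g x + h x) = L2_inner M u g + L2_inner M u h" if "u \<in> L2 M" for u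
    by (subst (1 2 3) L2_inner_commute) (simp add: L2_inner_add_left g h that)
  have "Re (L2_inner M f v) = k * (A + P)"
    unfolding v_def L2_inner_cmult_right add_right[OF f]
    by (simp add: \<open>L2_inner M f g = of_real A\<close> \<open>L2_inner M f h = of_real P\<close>)
  moreover have "(L2_norm M v)\<^sup>2 = k\<^sup>2 * (A + P + 2 * Re (L2_inner M g h))"
  proof -
    have "of_real ((L2_norm M v)\<^sup>2) = of_real k * of_real k *
        (L2_inner M g g + L2_inner M g h + (L2_inner M h g + L2_inner M h h))"
      unfolding L2_inner_self[symmetric] v_def L2_inner_cmult_right L2_inner_cmult_left
        L2_inner_add_left[OF g h gh] add_right[OF g] add_right[OF h] by simp
    then have "Re (of_real ((L2_norm M v)\<^sup>2)) = Re (of_real k * of_real k *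
        (of_real A + L2_inner M g h + (cnj (L2_inner M g h) + of_real P)))"
      unfolding L2_inner_commute[of M h g] L2_inner_self gg hh by (rule arg_cong)
    then show ?thesis by (simp add: power2_eq_square algebra_simps)
  qed
  ultimately have "0 \<le> F - 2 * (k * (A + P)) + k\<^sup>2 * (A + P + 2 * Re (L2_inner M g h))"
    using L2_norm_diff_square[OF f v] zero_le_power2[of "L2_norm M (\<lambda>x. f x - v x)"]
    by (simp add: F_def)
  also have "\<dots> \<le> F - 2 * (k * (A + P)) + k\<^sup>2 * ((A + P) * (1 + c))"
    using cross by (intro add_left_mono mult_left_mono) (simp_all add: algebra_simps)
  also have "k\<^sup>2 * ((A + P) * (1 + c)) = k * (k * (1 + c)) * (A + P)"
    by (simp add: power2_eq_square algebra_simps)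
  also have "F - 2 * (k * (A + P)) + k * (k * (1 + c)) * (A + P) = F - k * (A + P)"
    unfolding k(2) by simp
  finally have "(1 + c) * (k * (A + P)) \<le> (1 + c) * F" using c(1) by (intro mult_left_mono) auto
  then have "k * (1 + c) * (A + P) \<le> (1 + c) * F" by (simp add: algebra_simps)
  then show ?thesis unfolding k(2) by (simp add: A_def P_def F_def X_def)
qed

text \<open>
  The bound above needs \<open>c > 0\<close>, whereas \<open>|E| #X\<^sub>S / |M|\<close> may vanish; so \<open>c\<close> is taken strictly between
  its square root and \<open>1 - \<epsilon> - \<epsilon>'\<close>, assuming that the claim fails.
\<close>

lemma uncertainty_principle:
  assumes E: "E \<in> sets (riem_volume M)" and S: "finite S"
    and f: "f \<in> L2 M" "\<not> (AE x in riem_volume M. f x = 0)"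
    and eps: "0 < 1 - \<epsilon> - \<epsilon>'"
    and space: "(LINT x:E|riem_volume M. (cmod (f x))\<^sup>2) \<ge> (1 - \<epsilon>) * (L2_norm M f)\<^sup>2"
    and freq: "(\<Sum>j\<in>{j. lam j \<in> S}. (cmod (L2_inner M f (e j)))\<^sup>2) \<ge> (1 - \<epsilon>') * (L2_norm M f)\<^sup>2"
  shows "(1 - \<epsilon> - \<epsilon>')\<^sup>2 \<le> measure (riem_volume M) E / l * real (card {j. lam j \<in> S})"
proof (rule ccontr)
  let ?K = "measure (riem_volume M) E / l * real (card {j. lam j \<in> S})" and ?d = "1 - \<epsilon> - \<epsilon>'"
  assume "\<not> ?d\<^sup>2 \<le> ?K"
  then have "?K < ?d\<^sup>2" by simp
  have "?K \<ge> 0" using l_pos by simp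
  have "sqrt ?K < ?d"
    using \<open>?K < ?d\<^sup>2\<close> eps by (simp add: real_less_lsqrt)
  then obtain c where c: "sqrt ?K < c" "c < ?d" using dense by blast
  have "c > 0" using c(1) \<open>?K \<ge> 0\<close> real_sqrt_ge_zero by (metis le_less_trans)
  moreover have "c\<^sup>2 \<ge> ?K" using c(1) \<open>?K \<ge> 0\<close> by (simp add: sqrt_le_D)
  ultimately have "(1 - \<epsilon>) * (L2_norm M f)\<^sup>2 + (1 - \<epsilon>') * (L2_norm M f)\<^sup>2 \<le> (1 + c) * (L2_norm M f)\<^sup>2"
    using concentration_sum_bound[OF E S f(1), of c] space freq by linarith
  then have "(?d - c) * (L2_norm M f)\<^sup>2 \<le> 0" by (simp add: algebra_simps)
  then have "(L2_norm M f)\<^sup>2 = 0" using c(2) by (simp add: mult_le_0_iff)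
  then have "AE x in riem_volume M. (cmod (f x))\<^sup>2 = 0"
    using f(1) unfolding L2_norm_square
    by (subst (asm) integral_nonneg_eq_0_iff_AE) (auto simp: L2_def)
  then show False using f(2) by simp
qed

end

theorem theorem1p5:
  fixes M :: "'a riem1"
  assumes "riemannian_1_manifold M"
    and "compact_space (rm_top M)"
    and "connected_space (rm_top M)"
    and "rm_points M \<noteq> {}"
  shows "(\<exists>l>0. isometric M (circle l)) \<and>
    (\<forall>e lam. laplace_eigenbasis M e lam \<longrightarrow>
      (\<forall>\<mu>. sqrt_laplace_eigenvalue M \<mu> \<longrightarrow>
         finite {j. lam j = \<mu>} \<and>
         (\<forall>x\<in>rm_points M.
            (\<Sum>j\<in>{j. lam j = \<mu>}. (cmod (e j x))\<^sup>2) =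
              real (card {j. lam j = \<mu>}) / measure (riem_volume M) (rm_points M))) \<and>
      (\<forall>E S (\<epsilon>::real) (\<epsilon>'::real) f.
         E \<in> sets (riem_volume M) \<and> finite S \<and> S \<subseteq> range lam \<and>
         0 \<le> \<epsilon> \<and> \<epsilon> < 1 \<and> 0 \<le> \<epsilon>' \<and> \<epsilon>' < 1 \<and>
         0 < 1 - \<epsilon> - \<epsilon>' \<and> 1 - \<epsilon> - \<epsilon>' \<le> 1 \<and>
         f \<in> L2 M \<and> \<not> (AE x in riem_volume M. f x = 0) \<and>
         (LINT x:E|riem_volume M. (cmod (f x))\<^sup>2) \<ge> (1 - \<epsilon>) * (L2_norm M f)\<^sup>2 \<and>
         (\<Sum>j\<in>{j. lam j \<in> S}. (cmod (L2_inner M f (e j)))\<^sup>2) \<ge> (1 - \<epsilon>') * (L2_norm M f)\<^sup>2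
         \<longrightarrow>
         finite {j. lam j \<in> S} \<and>
         (1 - \<epsilon> - \<epsilon>')\<^sup>2 \<le>
           measure (riem_volume M) E / measure (riem_volume M) (rm_points M)
             * real (card {j. lam j \<in> S})))"
proof -
  interpret compact_riemannian_1 M by unfold_locales (use assms in auto)
  obtain \<gamma> l where \<gamma>: "unit_speed M UNIV \<gamma>" "l > 0"
    "\<And>s t. \<gamma> s = \<gamma> t \<longleftrightarrow> (\<exists>k::int. t = s + of_int k * l)"
    using unit_speed_circle by blast
  interpret unit_speed_circle M \<gamma> l by unfold_locales (use \<gamma> in auto)
  show ?thesis
  proof (intro conjI allI impI ballI)
    show "\<exists>l>0. isometric M (circle l)" using isometric_circle l_pos by blast
  next
    fix e lam \<mu> assume "laplace_eigenbasis M e lam"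
    then interpret circle_eigenbasis M \<gamma> l e lam by unfold_locales
    show "finite {j. lam j = \<mu>}" by (rule multiplicity_finite)
    fix x assume "x \<in> rm_points M"
    then show "(\<Sum>j\<in>{j. lam j = \<mu>}. (cmod (e j x))\<^sup>2) =
        real (card {j. lam j = \<mu>}) / measure (riem_volume M) (rm_points M)"
      unfolding measure_riem_volume by (rule eigenspace_kernel)
  next
    fix e lam E S f and \<epsilon> \<epsilon>' :: real
    assume "laplace_eigenbasis M e lam"
    then interpret circle_eigenbasis M \<gamma> l e lam by unfold_locales
    assume *: "E \<in> sets (riem_volume M) \<and> finite S \<and> S \<subseteq> range lam \<and>
         0 \<le> \<epsilon> \<and> \<epsilon> < 1 \<and> 0 \<le> \<epsilon>' \<and> \<epsilon>' < 1 \<and>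
         0 < 1 - \<epsilon> - \<epsilon>' \<and> 1 - \<epsilon> - \<epsilon>' \<le> 1 \<and>
         f \<in> L2 M \<and> \<not> (AE x in riem_volume M. f x = 0) \<and>
         (LINT x:E|riem_volume M. (cmod (f x))\<^sup>2) \<ge> (1 - \<epsilon>) * (L2_norm M f)\<^sup>2 \<and>
         (\<Sum>j\<in>{j. lam j \<in> S}. (cmod (L2_inner M f (e j)))\<^sup>2) \<ge> (1 - \<epsilon>') * (L2_norm M f)\<^sup>2"
    obtain x where "x \<in> rm_points M" using nonempty by blast
    with * show "finite {j. lam j \<in> S}" using spectral_kernel(1) by blast
    show "(1 - \<epsilon> - \<epsilon>')\<^sup>2 \<le> measure (riem_volume M) E / measure (riem_volume M) (rm_points M)
        * real (card {j. lam j \<in> S})"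
      unfolding measure_riem_volume by (rule uncertainty_principle) (use * in auto)
  qed
qed

end
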